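(* Let $a,b$ be positive integers and let $c_1\ge c_2\ge 0$ be even integers; put $m=(c_1+c_2)/2$. For nonnegative integers $p,q,r$ let $$B(p,q,r)=\prod_{i=1}^{p}\prod_{j=1}^{q}\prod_{k=1}^{r}\frac{i+j+k-1}{i+j+k-2}$$ (an empty product being $1$); this is the number of plane partitions contained in a $p\times q\times r$ box. Call an $a\times m$ array $(A_{i,j})$ of integers in $\{0,1,\dots,b\}$ whose rows and columns are weakly decreasing and which satisfies $A_{i,j}+A_{a+1-i,\,m+1-j}=b$ for all $i,j$ a self-complementary array (these correspond to self-complementary plane partitions in an $a\times b\times m$ box). (1) If $a$ and $b$ are even, the number of self-complementary arrays such that (when $c_1>0$) $A_{a/2,\,c_1/2}\ge b/2$ equals $B\left(\tfrac a2,\tfrac b2,\tfrac{c_1}2\right)B\left(\tfrac a2,\tfrac b2,\tfrac{c_2}2\right)$. (2) If $a$ is odd and $b$ is even, the number of self-complementary arrays such that $A_{(a+1)/2,\,j}=b/2$ for all $j$ with $c_2/2<j\le c_1/2$ equals $B\left(\tfrac {a-1}2,\tfrac b2,\tfrac{c_1}2\right)B\left(\tfrac {a+1}2,\tfrac b2,\tfrac{c_2}2\right)$. (3) Let $a$ and $b$ be odd, put $i_0=(a+1)/2$ and let $E=\{(i_0,j): c_2/2<j\le c_1/2\}$ (a set of "empty" cells). Consider fillings $A$ of the cells of the $a\times m$ grid not in $E$ with integers in $\{0,\dots,b\}$ such that: $A_{i,j}+A_{a+1-i,\,m+1-j}=b$ for all cells $(i,j)\notin E$; $A_{i,j}\ge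 A_{i,j+1}$ and $A_{i,j}\ge A_{i+1,j}$ whenever both cells involved exist and are not in $E$; for every $(i_0,j)\in E$, the entry above it (if it exists) satisfies $A_{i_0-1,j}\ge (b-1)/2$ and the entry below it (if it exists) satisfies $A_{i_0+1,j}\le (b+1)/2$; and, if $c_2>0$, the entry to the left of the empty cells satisfies $A_{i_0,\,c_2/2}\ge (b+1)/2$. The number of such fillings equals $B\left(\tfrac {a-1}2,\tfrac {b+1}2,\tfrac{c_1}2\right)B\left(\tfrac {a+1}2,\tfrac {b-1}2,\tfrac{c_2}2\right)$.
   Context: A plane partition in an $a\times b\times m$ box is encoded by an $a\times m$ array of integers in $\{0,\dots,b\}$ with weakly decreasing rows and columns (entry = height of the stack of cubes); it is self-complementary iff entries related by a $180^\circ$ rotation of the array sum to $b$. The side conditions in (1)–(3) encode that the corresponding centrally symmetric rhombus tiling of the hexagon with sides $a,b,m$ contains a fixed central "middle line" (a segment, a strip of rhombi, or a segment with two triangles attached) of length about $(c_1-c_2)/2$. Rows are indexed $1,\dots,a$ from top, columns $1,\dots,m$ from left. *)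

theory Defs
  imports Complex_Main "HOL-Library.FuncSet"
begin

text \<open>
  An array is a function on cells \<open>(row, column)\<close>, both indices starting at 1. Fillings of a set
  of cells \<open>D\<close> are extensional functions on \<open>D\<close>, so that distinct functions are distinct fillings.
\<close>

definition MacMahon_box :: "nat \<Rightarrow> nat \<Rightarrow> nat \<Rightarrow> real" where
  "MacMahon_box p q r =
     (\<Prod>i=1..p. \<Prod>j=1..q. \<Prod>k=1..r.
        (real i + real j + real k - 1) / (real i + real j + real k - 2))"

definition cells :: "nat \<Rightarrow> nat \<Rightarrow> (nat \<times> nat) set" where
  "cells a m = {1..a} \<times> {1..m}"

text \<open>Only pairs of adjacent cells that both lie in \<open>D\<close> are compared.\<close>

definition weakly_decreasing :: "(nat \<times> nat) set \<Rightarrow> (nat \<times> nat \<Rightarrow> nat) \<Rightarrow> bool" where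
  "weakly_decreasing D A \<longleftrightarrow>
     (\<forall>i j. (i, j) \<in> D \<longrightarrow> (i, j + 1) \<in> D \<longrightarrow> A (i, j) \<ge> A (i, j + 1)) \<and>
     (\<forall>i j. (i, j) \<in> D \<longrightarrow> (i + 1, j) \<in> D \<longrightarrow> A (i, j) \<ge> A (i + 1, j))"

definition sc_fillings ::
    "nat \<Rightarrow> nat \<Rightarrow> nat \<Rightarrow> (nat \<times> nat) set \<Rightarrow> (nat \<times> nat \<Rightarrow> nat) set" where
  "sc_fillings a b m D =
     {A \<in> D \<rightarrow>\<^sub>E {0..b}.
        weakly_decreasing D A \<and>
        (\<forall>(i, j) \<in> D. A (i, j) + A (a + 1 - i, m + 1 - j) = b)}"

definition sc_arrays :: "nat \<Rightarrow> nat \<Rightarrow> nat \<Rightarrow> (nat \<times> nat \<Rightarrow> nat) set" where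
  "sc_arrays a b m = sc_fillings a b m (cells a m)"

definition empty_cells :: "nat \<Rightarrow> nat \<Rightarrow> nat \<Rightarrow> (nat \<times> nat) set" where
  "empty_cells a c1 c2 = {((a + 1) div 2, j) | j. c2 div 2 < j \<and> j \<le> c1 div 2}"

text \<open>
  For odd \<open>a\<close> and \<open>b\<close>. A neighbour above or below an empty cell exists iff it is a cell of the
  grid; in particular, for \<open>a = 1\<close> the would-be row 0 is not in the grid.
\<close>

definition sc_fillings_around_empty ::
    "nat \<Rightarrow> nat \<Rightarrow> nat \<Rightarrow> nat \<Rightarrow> (nat \<times> nat \<Rightarrow> nat) set" where
  "sc_fillings_around_empty a b c1 c2 =
     (let m = (c1 + c2) div 2; i0 = (a + 1) div 2; E = empty_cells a c1 c2 in
      {A \<in> sc_fillings a b m (cells a m - E).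
         (\<forall>(i, j) \<in> E.
            ((i - 1, j) \<in> cells a m \<longrightarrow> A (i - 1, j) \<ge> (b - 1) div 2) \<and>
            ((i + 1, j) \<in> cells a m \<longrightarrow> A (i + 1, j) \<le> (b + 1) div 2)) \<and>
         (c2 > 0 \<longrightarrow> A (i0, c2 div 2) \<ge> (b + 1) div 2)})"

end

theory Submission
  imports Defs "Jordan_Normal_Form.Determinant"
begin

text \<open>
  Write \<open>c\<^sub>1 = 2 s\<close>, \<open>c\<^sub>2 = 2 t\<close>. After a shift by rows, the entries of a self-complementary array on one
  side of its centre form a column-strict tableau with entries at most \<open>N = (a + b) div 2\<close>, whose shape
  \<open>\<nu>\<close> is complementary to itself in the \<open>a \<times> m\<close> rectangle; the middle line becomes the condition
  \<open>\<nu>\<^sub>n \<ge> s\<close>, where \<open>n = a div 2\<close> (with rows counted from 1). By Jacobi--Trudi the number of arrays is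
  therefore a sum of determinants in the complete symmetric functions \<open>h\<close> at \<open>N\<close> ones. The rows of these
  determinants come in pairs with row indices of constant sum, so the sum depends only on
  an alternating form, which telescopes to
  \<open>\<Omega>(x\<^sup>k, x\<^sup>l) = (L\<^sub>s \<otimes> L\<^sub>t) ((x\<^sup>k y\<^sup>l - x\<^sup>l y\<^sup>k) / (x - y))\<close> for moment functionals \<open>L\<^sub>s\<close>, \<open>L\<^sub>t\<close> given by \<open>h\<close>
  near \<open>s\<close> and \<open>t\<close>. The multiples of an orthogonal polynomial of \<open>L\<^sub>t\<close> form an isotropic subspace, and this
  factors the sum into the Toeplitz determinants \<open>det h(s - i + j)\<close> and \<open>det h(t - i + j)\<close>, that is, into the
  two box numbers. If \<open>a\<close> is odd and \<open>b\<close> is even, the shape only interlaces with its complement; summing over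
  its lower half replaces \<open>N\<close> by \<open>N + 1\<close> variables in the lower rows.
\<close>

section \<open>Determinants of indexed families\<close>

text \<open>For \<open>N = N'\<close> the theorem \<open>sum_shapes\<close> is the value at ones of
  the classical multiplicity-free expansion of a product of two rectangular Schur functions, with
  \<open>n\<close> rows of length \<open>s\<close> and \<open>d = a - n\<close> rows of length
  \<open>t\<close>. That identity does not settle odd \<open>a\<close> and even \<open>b\<close>,
  where the lower rows of the determinants carry one more variable than the upper ones. So the
  factorisation is proved for two unrelated sequences \<open>h\<close> and \<open>h'\<close>, where
  \<open>h'\<close> vanishes at negative arguments and has a nonzero Toeplitz determinant. The
  isotropic space comes from telescoping: exchanging two columns amounts to shifting the summation
  variable, which leaves only boundary terms with arguments just above \<open>t - d\<close>;
  orthogonality is exactly vanishing on the window \<open>t - d < l \<le> t\<close>. The nonzero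
  determinant guarantees that the orthogonal polynomial exists, and it is supplied by the positivity
  of box numbers.\<close>

definition Det :: "nat \<Rightarrow> (nat \<Rightarrow> nat \<Rightarrow> 'a::comm_ring_1) \<Rightarrow> 'a" where
  "Det n f = det (mat n n (\<lambda>(i, j). f i j))"

lemma Det_leibniz:
  "Det n f = (\<Sum>p | p permutes {0..<n}. signof p * (\<Prod>i=0..<n. f i (p i)))"
proof -
  have "det (mat n n (\<lambda>(i, j). f i j))
      = (\<Sum>p | p permutes {0..<n}. signof p * (\<Prod>i=0..<n. mat n n (\<lambda>(i, j). f i j) $$ (i, p i)))"
    by (rule det_def') simp
  also have "\<dots> = (\<Sum>p | p permutes {0..<n}. signof p * (\<Prod>i=0..<n. f i (p i)))"
    by (intro sum.cong refl arg_cong2[where f="(*)"] prod.cong) (auto dest: permutes_in_image)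
  finally show ?thesis unfolding Det_def .
qed

lemma Det_cong:
  assumes "\<And>i j. i < n \<Longrightarrow> j < n \<Longrightarrow> f i j = g i j"
  shows "Det n f = Det n g"
  unfolding Det_def using assms by (intro arg_cong[where f=det] eq_matI) auto

lemma Det_0 [simp]: "Det 0 f = 1"
  unfolding Det_def by (simp add: det_dim_zero)

lemma Det_transpose: "Det n (\<lambda>i j. f j i) = Det n f"
proof -
  have "transpose_mat (mat n n (\<lambda>(i, j). f i j)) = mat n n (\<lambda>(i, j). f j i)"
    by (rule eq_matI) auto
  then show ?thesis unfolding Det_def
    by (metis det_transpose mat_carrier)
qed

lemma Det_mult: "Det n f * Det n g = Det n (\<lambda>i j. \<Sum>k<n. f i k * g k j)"
proof -
  have "mat n n (\<lambda>(i, j). f i j) * mat n n (\<lambda>(i, j). g i j)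
      = mat n n (\<lambda>(i, j). \<Sum>k<n. f i k * g k j)"
    by (rule eq_matI) (auto simp: scalar_prod_def atLeast0LessThan)
  then show ?thesis unfolding Det_def
    by (metis det_mult mat_carrier)
qed

lemma Det_upper_triangular:
  assumes "\<And>i j. j < i \<Longrightarrow> i < n \<Longrightarrow> f i j = 0"
  shows "Det n f = (\<Prod>i<n. f i i)"
proof -
  let ?A = "mat n n (\<lambda>(i, j). f i j)"
  have "det ?A = prod_list (diag_mat ?A)"
    by (rule det_upper_triangular[where n=n]) (auto simp: upper_triangular_def assms)
  also have "\<dots> = prod_list (map (\<lambda>i. f i i) [0..<n])"
    unfolding diag_mat_def by (rule arg_cong[where f=prod_list]) auto
  also have "\<dots> = (\<Prod>i<n. f i i)"
    by (simp add: prod.list_conv_set_nth atLeast0LessThan)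
  finally show ?thesis unfolding Det_def .
qed

lemma Det_lower_triangular:
  assumes "\<And>i j. i < j \<Longrightarrow> j < n \<Longrightarrow> f i j = 0"
  shows "Det n f = (\<Prod>i<n. f i i)"
  using Det_upper_triangular[of n "\<lambda>i j. f j i"] assms by (simp add: Det_transpose[of n f])

lemma Det_permute_rows:
  assumes "p permutes {0..<n}"
  shows "Det n (\<lambda>i. f (p i)) = signof p * Det n f"
proof -
  have "Det n (\<lambda>i. f (p i)) = det (mat n n (\<lambda>(i, j). mat n n (\<lambda>(i, j). f i j) $$ (p i, j)))"
    unfolding Det_def using assms
    by (intro arg_cong[where f=det] eq_matI) (auto dest: permutes_in_image)
  also have "\<dots> = signof p * Det n f"
    unfolding Det_def by (rule det_permute_rows[OF _ assms]) simp
  finally show ?thesis .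
qed

lemma Det_zero_row:
  assumes "k < n" "\<And>j. j < n \<Longrightarrow> f k j = 0"
  shows "Det n f = 0"
  unfolding Det_leibniz
proof (rule sum.neutral, clarify)
  fix p assume "p permutes {0..<n}"
  then have "p k < n" using assms(1) by (auto dest: permutes_in_image)
  then have "(\<Prod>i=0..<n. f i (p i)) = 0"
    using assms by (intro prod_zero bexI[of _ k]) auto
  then show "signof p * (\<Prod>i=0..<n. f i (p i)) = 0" by simp
qed

lemma Det_identical_rows:
  assumes "i < n" "j < n" "i \<noteq> j" "\<And>k. k < n \<Longrightarrow> f i k = f j k"
  shows "Det n f = 0"
  unfolding Det_def
  by (rule det_identical_rows[OF _ \<open>i \<noteq> j\<close> \<open>i < n\<close> \<open>j < n\<close>]) (auto intro!: eq_vecI simp: assms)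

lemma Det_row_sum:
  assumes "\<And>i. i < n \<Longrightarrow> finite (S i)"
  shows "Det n (\<lambda>i j. \<Sum>x\<in>S i. f i x j) = (\<Sum>y\<in>PiE {0..<n} S. Det n (\<lambda>i j. f i (y i) j))"
proof -
  have "Det n (\<lambda>i j. \<Sum>x\<in>S i. f i x j)
      = (\<Sum>p | p permutes {0..<n}. signof p * (\<Sum>y\<in>PiE {0..<n} S. \<Prod>i=0..<n. f i (y i) (p i)))"
    unfolding Det_leibniz using assms
    by (intro sum.cong refl arg_cong2[where f="(*)"] prod_sum_PiE) auto
  also have "\<dots> = (\<Sum>y\<in>PiE {0..<n} S. \<Sum>p | p permutes {0..<n}. signof p * (\<Prod>i=0..<n. f i (y i) (p i)))"
    unfolding sum_distrib_left by (rule sum.swap)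
  finally show ?thesis unfolding Det_leibniz .
qed

text \<open>The row operation is unitriangular. The start \<open>k\<close> allows only the lower
  rows to be differenced: \<open>k = 0\<close> serves the Jacobi-Trudi induction,
  \<open>k = n\<close> the summation over the lower half of a shape.\<close>

lemma Det_row_diff:
  "Det n (\<lambda>i j. if k \<le> i \<and> Suc i < n then f i j - f (Suc i) j else f i j) = Det n f"
proof -
  let ?U = "\<lambda>i l. (if l = i then 1 else if l = Suc i \<and> k \<le> i then - 1 else 0 :: 'a)"
  have "Det n ?U = 1"
    by (subst Det_upper_triangular) auto
  then have "Det n f = Det n (\<lambda>i j. \<Sum>l<n. ?U i l * f l j)"
    using Det_mult[of n ?U f] by simp
  also have "\<dots> = Det n (\<lambda>i j. if k \<le> i \<and> Suc i < n then f i j - f (Suc i) j else f i j)"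
  proof (rule Det_cong)
    fix i j assume "i < n" "j < n"
    have "(\<Sum>l<n. ?U i l * f l j)
        = (\<Sum>l<n. (if l = i then f i j else 0) - (if l = Suc i then (if k \<le> i then f l j else 0) else 0))"
      by (rule sum.cong) auto
    also have "\<dots> = (if k \<le> i \<and> Suc i < n then f i j - f (Suc i) j else f i j)"
      using \<open>i < n\<close> by (auto simp: sum_subtractf)
    finally show "(\<Sum>l<n. ?U i l * f l j) = \<dots>" .
  qed
  finally show ?thesis by simp
qed

lemma Det_block_lower:
  fixes f :: "nat \<Rightarrow> nat \<Rightarrow> 'a::idom"
  assumes "d \<le> n" "\<And>i j. d \<le> i \<Longrightarrow> i < n \<Longrightarrow> j < d \<Longrightarrow> f i j = 0"
  shows "Det n f = Det d f * Det (n - d) (\<lambda>i j. f (d + i) (d + j))"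
proof -
  have "mat n n (\<lambda>(i, j). f i j) = four_block_mat (mat d d (\<lambda>(i, j). f i j))
      (mat d (n - d) (\<lambda>(i, j). f i (d + j))) (0\<^sub>m (n - d) d)
      (mat (n - d) (n - d) (\<lambda>(i, j). f (d + i) (d + j)))"
    using assms by (intro eq_matI) (auto simp: not_less)
  then show ?thesis unfolding Det_def
    by (simp add: det_four_block_mat_lower_left_zero[where n=d and m="n-d"])
qed

text \<open>The adjugate supplies a solution. It later yields the coefficients of an orthogonal
  polynomial.\<close>

lemma Det_solve:
  fixes f :: "nat \<Rightarrow> nat \<Rightarrow> 'a::field"
  assumes "Det n f \<noteq> 0"
  obtains x where "\<And>i. i < n \<Longrightarrow> (\<Sum>j<n. f i j * x j) = b i"
proof -
  define A where "A = mat n n (\<lambda>(i, j). f i j)"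
  have A: "A \<in> carrier_mat n n" by (simp add: A_def)
  have adj: "adj_mat A \<in> carrier_mat n n" "A * adj_mat A = det A \<cdot>\<^sub>m 1\<^sub>m n"
    using adj_mat[OF A] by auto
  have dA: "det A \<noteq> 0" using assms by (simp add: A_def Det_def)
  define x where "x = (\<lambda>j. (\<Sum>k<n. adj_mat A $$ (j, k) * b k) / det A)"
  have "(\<Sum>j<n. f i j * x j) = b i" if i: "i < n" for i
  proof -
    have *: "(\<Sum>j<n. f i j * adj_mat A $$ (j, k)) = (if i = k then det A else 0)" if k: "k < n" for k
    proof -
      have "(A * adj_mat A) $$ (i, k) = (\<Sum>j<n. f i j * adj_mat A $$ (j, k))"
        using i k A adj(1) by (auto simp: scalar_prod_def A_def atLeast0LessThan)
      then show ?thesis using adj(2) i k A by (auto split: if_splits)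
    qed
    have "(\<Sum>j<n. f i j * x j) = (\<Sum>j<n. \<Sum>k<n. f i j * adj_mat A $$ (j, k) * b k) / det A"
      by (simp add: x_def sum_divide_distrib sum_distrib_left mult.assoc)
    also have "(\<Sum>j<n. \<Sum>k<n. f i j * adj_mat A $$ (j, k) * b k)
        = (\<Sum>k<n. (\<Sum>j<n. f i j * adj_mat A $$ (j, k)) * b k)"
      by (subst sum.swap) (simp add: sum_distrib_right)
    also have "\<dots> = (\<Sum>k<n. if i = k then det A * b k else 0)"
      by (rule sum.cong) (auto simp: *)
    also have "\<dots> = det A * b i" using i by simp
    finally show ?thesis using dA by simp
  qed
  then show thesis using that by blast
qed

section \<open>Determinants with paired rows\<close>

definition strict_dec :: "nat \<Rightarrow> (nat \<Rightarrow> 'b::linorder) \<Rightarrow> bool" where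
  "strict_dec n y \<longleftrightarrow> (\<forall>i j. i < j \<longrightarrow> j < n \<longrightarrow> y j < y i)"

definition strict_tuples :: "nat \<Rightarrow> 'b::linorder set \<Rightarrow> (nat \<Rightarrow> 'b) set" where
  "strict_tuples n S = {y \<in> {0..<n} \<rightarrow>\<^sub>E S. strict_dec n y}"

lemma strict_dec_inj: "strict_dec n y \<Longrightarrow> inj_on y {0..<n}"
  unfolding strict_dec_def inj_on_def
  by (metis atLeastLessThan_iff less_irrefl linorder_neqE_nat)

lemma strict_dec_list:
  assumes "strict_dec n y"
  shows "rev (map y [0..<n]) = sorted_list_of_set (y ` {0..<n})"
proof -
  have "sorted (rev (map y [0..<n]))"
    using assms by (auto simp: strict_dec_def sorted_rev_iff_nth_mono sorted_iff_nth_mono rev_nth less_imp_le le_less)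
  moreover have "distinct (rev (map y [0..<n]))"
    using strict_dec_inj[OF assms] by (simp add: distinct_map)
  ultimately show ?thesis
    by (metis list.set_map set_rev set_upt sorted_list_of_set.idem_if_sorted_distinct)
qed

text \<open>Only injective tuples contribute, and each of them is a strictly decreasing tuple
  composed with a unique permutation. At the price of the factor \<open>fact n\<close>, an ordered
  sum is traded for one over independent coordinates.\<close>

lemma sum_symmetric_tuples:
  fixes \<Phi> :: "(nat \<Rightarrow> 'b::linorder) \<Rightarrow> 'a::comm_ring_1"
  assumes "finite S"
    and loc: "\<And>y y'. (\<And>i. i < n \<Longrightarrow> y i = y' i) \<Longrightarrow> \<Phi> y = \<Phi> y'"
    and symm: "\<And>y p. p permutes {0..<n} \<Longrightarrow> \<Phi> (y \<circ> p) = \<Phi> y"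
    and alt: "\<And>y. \<not> inj_on y {0..<n} \<Longrightarrow> \<Phi> y = 0"
  shows "(\<Sum>y\<in>{0..<n} \<rightarrow>\<^sub>E S. \<Phi> y) = of_nat (fact n) * (\<Sum>y\<in>strict_tuples n S. \<Phi> y)"
proof -
  let ?T = "{0..<n} \<rightarrow>\<^sub>E S"
  let ?P = "{p. p permutes {0..<n}}"
  let ?\<psi> = "\<lambda>(z, p). restrict (z \<circ> p) {0..<n}"
  have fin: "finite ?T" using assms(1) by (simp add: finite_PiE)
  have "(\<Sum>y\<in>?T. \<Phi> y) = (\<Sum>y\<in>{y\<in>?T. inj_on y {0..<n}}. \<Phi> y)"
    using fin alt by (intro sum.mono_neutral_right) auto
  also have "\<dots> = (\<Sum>zp\<in>strict_tuples n S \<times> ?P. \<Phi> (?\<psi> zp))"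
  proof (rule sum.reindex_bij_betw[symmetric], unfold bij_betw_def, intro conjI)
    show "inj_on ?\<psi> (strict_tuples n S \<times> ?P)"
    proof (rule inj_onI, clarify)
      fix z p z' p'
      assume z: "z \<in> strict_tuples n S" "z' \<in> strict_tuples n S"
        and p: "p permutes {0..<n}" "p' permutes {0..<n}"
        and eq: "restrict (z \<circ> p) {0..<n} = restrict (z' \<circ> p') {0..<n}"
      have pt: "z (p i) = z' (p' i)" if "i < n" for i
        using fun_cong[OF eq, of i] that by simp
      have "z ` {0..<n} = (z \<circ> p) ` {0..<n}"
        by (simp only: image_comp[symmetric] permutes_image[OF p(1)])
      also have "\<dots> = (z' \<circ> p') ` {0..<n}" using pt by (intro image_cong) auto
      also have "\<dots> = z' ` {0..<n}"
        by (simp only: image_comp[symmetric] permutes_image[OF p(2)])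
      finally have "rev (map z [0..<n]) = rev (map z' [0..<n])"
        using z by (simp add: strict_dec_list strict_tuples_def)
      then have zz': "z i = z' i" if "i < n" for i
        using that by (simp add: map_eq_conv)
      have "z = z'"
        using z zz' by (auto simp: strict_tuples_def intro!: PiE_ext[of _ "{0..<n}" "\<lambda>_. S"])
      moreover have "p = p'"
      proof
        fix i show "p i = p' i"
        proof (cases "i < n")
          case True
          then have "p i \<in> {0..<n}" "p' i \<in> {0..<n}" using p by (auto dest: permutes_in_image)
          moreover have "inj_on z {0..<n}" using z by (auto simp: strict_tuples_def strict_dec_inj)
          ultimately show ?thesis using pt[OF True] \<open>z = z'\<close> by (auto dest: inj_onD)
        next
          case False then show ?thesis by (simp add: permutes_not_in[OF p(1)] permutes_not_in[OF p(2)])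
        qed
      qed
      ultimately show "z = z' \<and> p = p'" by simp
    qed
    show "?\<psi> ` (strict_tuples n S \<times> ?P) = {y \<in> ?T. inj_on y {0..<n}}"
    proof (intro equalityI subsetI)
      fix y assume "y \<in> ?\<psi> ` (strict_tuples n S \<times> ?P)"
      then obtain z p where z: "z \<in> strict_tuples n S" and p: "p permutes {0..<n}"
        and y: "y = restrict (z \<circ> p) {0..<n}" by auto
      have "z \<circ> p \<in> {0..<n} \<rightarrow> S"
        using z p by (auto simp: strict_tuples_def dest: permutes_in_image)
      moreover have "inj_on (z \<circ> p) {0..<n}"
        using z p by (intro comp_inj_on)
          (auto simp: strict_tuples_def strict_dec_inj permutes_image permutes_inj_on)
      ultimately show "y \<in> {y \<in> ?T. inj_on y {0..<n}}"
        unfolding y by (auto simp: inj_on_def)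
    next
      fix y assume "y \<in> {y \<in> ?T. inj_on y {0..<n}}"
      then have y: "y \<in> ?T" "inj_on y {0..<n}" by auto
      define xs where "xs = rev (sorted_list_of_set (y ` {0..<n}))"
      have xs: "length xs = n" "set xs = y ` {0..<n}" "distinct xs" "sorted (rev xs)"
        using y by (auto simp: xs_def card_image)
      define z where "z = restrict (\<lambda>i. xs ! i) {0..<n}"
      have zi: "z ` {0..<n} = y ` {0..<n}"
        using xs nth_image[of n xs] by (simp add: z_def)
      have "strict_dec n z"
        unfolding strict_dec_def
      proof (intro allI impI)
        fix i j assume ij: "i < j" "j < n"
        then have "xs ! j \<le> xs ! i" using xs by (simp add: sorted_rev_iff_nth_mono)
        moreover have "xs ! j \<noteq> xs ! i" using ij xs by (simp add: nth_eq_iff_index_eq)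
        ultimately show "z j < z i" using ij by (simp add: z_def)
      qed
      moreover have "z \<in> ?T"
      proof (rule PiE_I)
        fix i assume "i \<in> {0..<n}"
        then have "z i \<in> y ` {0..<n}" using zi by blast
        then show "z i \<in> S" using y by auto
      qed (simp add: z_def)
      ultimately have z: "z \<in> strict_tuples n S" by (simp add: strict_tuples_def)
      have injz: "inj_on z {0..<n}" by (rule strict_dec_inj) fact
      define p where "p = (\<lambda>i. if i \<in> {0..<n} then inv_into {0..<n} z (y i) else i)"
      have "bij_betw (inv_into {0..<n} z \<circ> y) {0..<n} {0..<n}"
        by (rule bij_betw_trans[OF bij_betw_imageI[OF y(2) refl]
              bij_betw_inv_into[OF bij_betw_imageI[OF injz zi]]])
      then have "bij_betw p {0..<n} {0..<n}"
        by (rule bij_betw_cong[THEN iffD1, rotated]) (auto simp: p_def)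
      then have p: "p permutes {0..<n}"
        by (rule bij_imp_permutes) (auto simp: p_def)
      have "restrict (z \<circ> p) {0..<n} = y"
      proof
        fix i
        show "restrict (z \<circ> p) {0..<n} i = y i"
        proof (cases "i < n")
          case True
          then have "y i \<in> z ` {0..<n}" unfolding zi by simp
          then have "z (inv_into {0..<n} z (y i)) = y i" by (rule f_inv_into_f)
          then show ?thesis using True by (simp add: p_def)
        next
          case False
          then show ?thesis using PiE_arb[OF y(1), of i] by simp
        qed
      qed
      then show "y \<in> ?\<psi> ` (strict_tuples n S \<times> ?P)"
        using z p by (intro image_eqI[of _ _ "(z, p)"]) auto
    qed
  qed
  also have "\<dots> = (\<Sum>zp\<in>strict_tuples n S \<times> ?P. \<Phi> (fst zp))"
  proof (rule sum.cong[OF refl], clarify)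
    fix z p assume p: "p permutes {0..<n}"
    have "\<Phi> (restrict (z \<circ> p) {0..<n}) = \<Phi> (z \<circ> p)" by (rule loc) simp
    then show "\<Phi> (restrict (z \<circ> p) {0..<n}) = \<Phi> (fst (z, p))" using symm[OF p] by simp
  qed
  also have "\<dots> = (\<Sum>z\<in>strict_tuples n S. \<Sum>p\<in>?P. \<Phi> z)"
    unfolding sum.cartesian_product by (rule sum.cong) auto
  also have "\<dots> = of_nat (fact n) * (\<Sum>y\<in>strict_tuples n S. \<Phi> y)"
    by (simp add: card_permutations[OF refl] sum_distrib_left)
  finally show ?thesis .
qed

section \<open>Alternating forms behind determinants with mirrored rows\<close>

definition pair_rows ::
  "nat \<Rightarrow> nat \<Rightarrow> ('b \<Rightarrow> nat \<Rightarrow> 'a) \<Rightarrow> (nat \<Rightarrow> nat \<Rightarrow> 'a) \<Rightarrow> ('b \<Rightarrow> nat \<Rightarrow> 'a) \<Rightarrow> (nat \<Rightarrow> 'b) \<Rightarrow> nat \<Rightarrow> nat \<Rightarrow> 'a"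
  where "pair_rows n a v X v' y i j =
    (if i < n then v (y i) j else if i < a - n then X i j else v' (y (a - 1 - i)) j)"

text \<open>Permuting the parameters \<open>y\<close> permutes the upper rows and, in mirror image,
  the lower rows. The two signs cancel, so the determinant is symmetric in \<open>y\<close>; equal
  parameters give equal rows.\<close>

lemma sum_tuples_pair_rows:
  fixes v :: "'b::linorder \<Rightarrow> nat \<Rightarrow> 'a::idom"
  assumes "finite S" "2 * n \<le> a"
  shows "(\<Sum>y\<in>{0..<n} \<rightarrow>\<^sub>E S. Det a (pair_rows n a v X v' y))
    = of_nat (fact n) * (\<Sum>y\<in>strict_tuples n S. Det a (pair_rows n a v X v' y))"
proof (rule sum_symmetric_tuples[OF assms(1)])
  fix y y' :: "nat \<Rightarrow> 'b" assume "\<And>i. i < n \<Longrightarrow> y i = y' i"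
  then show "Det a (pair_rows n a v X v' y) = Det a (pair_rows n a v X v' y')"
    using assms(2) by (intro Det_cong) (auto simp: pair_rows_def)
next
  fix y :: "nat \<Rightarrow> 'b" assume "\<not> inj_on y {0..<n}"
  then obtain i j where "i < n" "j < n" "i \<noteq> j" "y i = y j" by (auto simp: inj_on_def)
  then show "Det a (pair_rows n a v X v' y) = 0"
    using assms(2) by (intro Det_identical_rows[of i a j]) (auto simp: pair_rows_def)
next
  fix y :: "nat \<Rightarrow> 'b" and q assume q: "q permutes {0..<n}"
  define r where "r = (\<lambda>i. if i < a then a - 1 - i else i)"
  have rr: "r (r i) = i" for i by (auto simp: r_def)
  have r: "r permutes {0..<a}"
    by (rule bij_imp_permutes, rule bij_betw_byWitness[where f'=r]) (auto simp: rr, auto simp: r_def)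
  have qa: "q permutes {0..<a}" using permutes_subset[OF q, of "{0..<a}"] assms(2) by auto
  \<comment> \<open>\<open>r\<close> reverses the order of the rows, so its conjugate of
    \<open>q\<close> acts on the mirror rows as \<open>q\<close> does on the upper ones. Conjugation
    keeps the sign, hence the sign of \<sigma> is a square.\<close>
  define \<sigma> where "\<sigma> = q \<circ> (r \<circ> q \<circ> r)"
  have perm: "permutation q" "permutation r" using qa r by (auto simp: permutation_permutes)
  have \<sigma>: "\<sigma> permutes {0..<a}"
    unfolding \<sigma>_def by (intro permutes_compose r qa)
  have "inv_into UNIV r = r" by (rule inv_unique_comp) (auto simp: rr)
  then have "sign (r \<circ> q \<circ> r) = sign q"
    using perm by (simp add: sign_compose permutation_compose sign_idempotent mult.commute mult.left_commute)
  then have "sign \<sigma> = 1"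
    using perm by (simp add: \<sigma>_def sign_compose permutation_compose sign_idempotent
        mult.commute mult.left_commute)
  have q_in: "q i < n" if "i < n" for i using q that by (auto dest: permutes_in_image)
  have q_out: "q i = i" if "\<not> i < n" for i using q that by (auto simp: permutes_def)
  have "Det a (pair_rows n a v X v' (y \<circ> q)) = Det a (\<lambda>i. pair_rows n a v X v' y (\<sigma> i))"
  proof (rule Det_cong)
    fix i j assume i: "i < a"
    consider "i < n" | "n \<le> i" "i < a - n" | "a - n \<le> i" by linarith
    then show "pair_rows n a v X v' (y \<circ> q) i j = pair_rows n a v X v' y (\<sigma> i) j"
    proof cases
      case 1
      then have "\<sigma> i = q i" using assms(2) i by (auto simp: \<sigma>_def r_def q_out)
      then show ?thesis using 1 q_in by (simp add: pair_rows_def)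
    next
      case 2
      then have "\<sigma> i = i" using assms(2) i by (auto simp: \<sigma>_def r_def q_out)
      then show ?thesis using 2 by (simp add: pair_rows_def)
    next
      case 3
      then have *: "q (a - 1 - i) < n" using i assms(2) by (intro q_in) auto
      then have "\<sigma> i = a - 1 - q (a - 1 - i)" using assms(2) i by (auto simp: \<sigma>_def r_def q_out)
      then show ?thesis using 3 * i assms(2) by (auto simp: pair_rows_def)
    qed
  qed
  also have "\<dots> = Det a (pair_rows n a v X v' y)"
    using Det_permute_rows[OF \<sigma>, of "pair_rows n a v X v' y"] \<open>sign \<sigma> = 1\<close> by simp
  finally show "Det a (pair_rows n a v X v' (y \<circ> q)) = Det a (pair_rows n a v X v' y)" .
qed

text \<open>The Leibniz expansion after the free parameters have been summed out. Without middle
  rows and with all \<open>W i\<close> equal, it is up to sign \<open>fact n\<close> times the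
  Pfaffian of the alternating form \<open>W k k' - W k' k\<close>. The form may depend on
  \<open>i\<close> so that it can be replaced in one slot at a time.\<close>

definition pair_sum ::
  "nat \<Rightarrow> nat \<Rightarrow> (nat \<Rightarrow> nat \<Rightarrow> 'a) \<Rightarrow> (nat \<Rightarrow> nat \<Rightarrow> nat \<Rightarrow> 'a::comm_ring_1) \<Rightarrow> 'a"
  where "pair_sum n a X W = (\<Sum>p | p permutes {0..<a}.
    signof p * ((\<Prod>i\<in>{n..<a - n}. X i (p i)) * (\<Prod>i=0..<n. W i (p i) (p (a - 1 - i)))))"

lemma sum_pair_rows_eq_pair_sum:
  fixes v :: "'b::linorder \<Rightarrow> nat \<Rightarrow> 'a::idom"
  assumes "finite S" "2 * n \<le> a"
  shows "(\<Sum>y\<in>{0..<n} \<rightarrow>\<^sub>E S. Det a (pair_rows n a v X v' y))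
    = pair_sum n a X (\<lambda>_ k k'. \<Sum>u\<in>S. v u k * v' u k')"
proof -
  have split: "(\<Prod>i=0..<a. pair_rows n a v X v' y i (p i)) =
      (\<Prod>i\<in>{n..<a - n}. X i (p i)) * (\<Prod>i=0..<n. v (y i) (p i) * v' (y i) (p (a - 1 - i)))" for y p
  proof -
    have "(\<Prod>i=0..<a. pair_rows n a v X v' y i (p i)) =
        (\<Prod>i\<in>{0..<n}. pair_rows n a v X v' y i (p i)) *
        ((\<Prod>i\<in>{n..<a - n}. pair_rows n a v X v' y i (p i)) *
        (\<Prod>i\<in>{a - n..<a}. pair_rows n a v X v' y i (p i)))"
      using assms(2) by (simp add: prod.atLeastLessThan_concat)
    also have "(\<Prod>i\<in>{0..<n}. pair_rows n a v X v' y i (p i)) = (\<Prod>i\<in>{0..<n}. v (y i) (p i))"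
      by (rule prod.cong) (auto simp: pair_rows_def)
    also have "(\<Prod>i\<in>{n..<a - n}. pair_rows n a v X v' y i (p i)) = (\<Prod>i\<in>{n..<a - n}. X i (p i))"
      by (rule prod.cong) (auto simp: pair_rows_def)
    also have "(\<Prod>i\<in>{a - n..<a}. pair_rows n a v X v' y i (p i))
        = (\<Prod>i\<in>{0..<n}. v' (y i) (p (a - 1 - i)))"
      using assms(2)
      by (intro prod.reindex_bij_witness[where i="\<lambda>i. a - 1 - i" and j="\<lambda>i. a - 1 - i"])
        (auto simp: pair_rows_def)
    finally show ?thesis by (simp add: prod.distrib mult_ac)
  qed
  have "(\<Sum>y\<in>{0..<n} \<rightarrow>\<^sub>E S. Det a (pair_rows n a v X v' y)) =
     (\<Sum>p | p permutes {0..<a}. signof p * ((\<Prod>i\<in>{n..<a - n}. X i (p i)) *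
       (\<Sum>y\<in>{0..<n} \<rightarrow>\<^sub>E S. \<Prod>i=0..<n. v (y i) (p i) * v' (y i) (p (a - 1 - i)))))"
    unfolding Det_leibniz split
    by (subst sum.swap) (simp add: sum_distrib_left mult.assoc)
  also have "\<dots> = pair_sum n a X (\<lambda>_ k k'. \<Sum>u\<in>S. v u k * v' u k')"
    unfolding pair_sum_def using assms(1) by (simp add: prod_sum_PiE)
  finally show ?thesis .
qed

text \<open>Composing the permutation with the transposition of two mirror positions reverses its
  sign and exchanges the arguments of one form.\<close>

lemma pair_sum_transpose:
  assumes "2 * n \<le> a" "i0 < n"
  shows "pair_sum n a X (W(i0 := \<lambda>k k'. W i0 k' k)) = - pair_sum n a X W"
proof -
  let ?q = "transpose i0 (a - 1 - i0)"
  let ?W = "W(i0 := \<lambda>k k'. W i0 k' k)"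
  let ?f = "\<lambda>W p. signof p * ((\<Prod>i\<in>{n..<a - n}. X i (p i)) * (\<Prod>i=0..<n. W i (p i) (p (a - 1 - i))))"
  have q: "?q permutes {0..<a}" using assms by (intro permutes_swap_id) auto
  have "pair_sum n a X ?W = (\<Sum>p | p permutes {0..<a}. ?f ?W (p \<circ> ?q))"
    unfolding pair_sum_def by (rule sum_permutations_compose_right[OF q])
  also have "\<dots> = (\<Sum>p | p permutes {0..<a}. - ?f W p)"
  proof (rule sum.cong[OF refl])
    fix p assume "p \<in> {p. p permutes {0..<a}}"
    then have "permutation p" by (auto simp: permutation_permutes)
    moreover have "permutation ?q" using q by (auto simp: permutation_permutes)
    ultimately have "sign (p \<circ> ?q) = - sign p"
      using assms by (simp add: sign_compose sign_swap_id)
    moreover have "(\<Prod>i\<in>{n..<a - n}. X i ((p \<circ> ?q) i)) = (\<Prod>i\<in>{n..<a - n}. X i (p i))"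
      using assms by (intro prod.cong) (auto simp: transpose_def)
    moreover have "(\<Prod>i=0..<n. ?W i ((p \<circ> ?q) i) ((p \<circ> ?q) (a - 1 - i)))
        = (\<Prod>i=0..<n. W i (p i) (p (a - 1 - i)))"
      using assms by (intro prod.cong) (auto simp: transpose_def)
    ultimately show "?f ?W (p \<circ> ?q) = - ?f W p" by simp
  qed
  finally show ?thesis by (simp add: pair_sum_def sum_negf)
qed

lemma pair_sum_diff:
  assumes "i0 < n"
  shows "pair_sum n a X (W(i0 := \<lambda>k k'. A k k' - B k k'))
    = pair_sum n a X (W(i0 := A)) - pair_sum n a X (W(i0 := B))"
proof -
  have "(\<Prod>i=0..<n. (W(i0 := C)) i (p i) (p (a - 1 - i)))
      = C (p i0) (p (a - 1 - i0)) * (\<Prod>i\<in>{0..<n} - {i0}. W i (p i) (p (a - 1 - i)))" for C p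
    using assms by (subst prod.remove[of _ i0]) (auto intro!: prod.cong arg_cong2[where f="(*)"])
  then show ?thesis
    unfolding pair_sum_def by (simp add: sum_subtractf[symmetric] algebra_simps)
qed

text \<open>By \<open>pair_sum_transpose\<close> the transposed form contributes with the opposite
  sign, so antisymmetrising one slot doubles the sum.\<close>

lemma pair_sum_antisym:
  assumes "2 * n \<le> a"
  shows "2 ^ n * pair_sum n a X (\<lambda>_. W) = pair_sum n a X (\<lambda>_ k k'. W k k' - W k' k)"
proof -
  let ?\<Omega> = "\<lambda>k k'. W k k' - W k' k"
  have "2 ^ l * pair_sum n a X (\<lambda>_. W) = pair_sum n a X (\<lambda>i. if i < l then ?\<Omega> else W)"
    if "l \<le> n" for l
    using that
  proof (induction l)
    case (Suc l)
    let ?V = "\<lambda>i. if i < l then ?\<Omega> else W"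
    have "(\<lambda>i. if i < Suc l then ?\<Omega> else W) = ?V(l := \<lambda>k k'. W k k' - W k' k)"
      by (auto simp: fun_eq_iff)
    then have "pair_sum n a X (\<lambda>i. if i < Suc l then ?\<Omega> else W)
        = pair_sum n a X (?V(l := W)) - pair_sum n a X (?V(l := \<lambda>k k'. W k' k))"
      using Suc.prems by (simp add: pair_sum_diff)
    also have "?V(l := W) = ?V" by auto
    also have "pair_sum n a X (?V(l := \<lambda>k k'. W k' k)) = - pair_sum n a X ?V"
      using pair_sum_transpose[OF assms, of l X ?V] Suc.prems by simp
    finally show ?case using Suc by (simp add: mult.assoc)
  qed simp
  from this[of n] show ?thesis unfolding pair_sum_def
    by (simp cong: prod.cong_simp)
qed

text \<open>
  The blocks of indices below and above \<open>d\<close> have sizes \<open>d\<close> and \<open>n\<close>. A permutation contributing to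
  the sum must therefore match every index of the second block with one of the first, so that the
  values of the form on the first block do not matter.
\<close>

lemma pair_sum_isotropic:
  assumes a: "a = n + d" "n \<le> d"
    and W0: "\<And>k k'. d \<le> k \<Longrightarrow> k < a \<Longrightarrow> d \<le> k' \<Longrightarrow> k' < a \<Longrightarrow> W k k' = 0"
    and V0: "\<And>k k'. d \<le> k \<Longrightarrow> k < a \<Longrightarrow> d \<le> k' \<Longrightarrow> k' < a \<Longrightarrow> V k k' = 0"
    and X0: "\<And>i k. n \<le> i \<Longrightarrow> i < d \<Longrightarrow> d \<le> k \<Longrightarrow> k < a \<Longrightarrow> X i k = 0"
    and eq: "\<And>k k'. k < d \<Longrightarrow> d \<le> k' \<Longrightarrow> k' < a \<Longrightarrow> W k k' = V k k'"
      "\<And>k k'. k < d \<Longrightarrow> d \<le> k' \<Longrightarrow> k' < a \<Longrightarrow> W k' k = V k' k"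
  shows "pair_sum n a X (\<lambda>_. W) = pair_sum n a X (\<lambda>_. V)"
  unfolding pair_sum_def
proof (rule sum.cong[OF refl])
  fix p assume "p \<in> {p. p permutes {0..<a}}"
  then have p: "p permutes {0..<a}" by simp
  have pa: "p i < a" if "i < a" for i using p that by (auto dest: permutes_in_image)
  let ?L = "\<lambda>W. (\<Prod>i\<in>{n..<a - n}. X i (p i)) * (\<Prod>i=0..<n. W i (p i) (p (a - 1 - i)))"
  consider (mid) i where "n \<le> i" "i < d" "d \<le> p i"
    | (both) i where "i < n" "d \<le> p i" "d \<le> p (a - 1 - i)"
    | (none) "\<And>i. n \<le> i \<Longrightarrow> i < d \<Longrightarrow> p i < d"
        "\<And>i. i < n \<Longrightarrow> p i < d \<or> p (a - 1 - i) < d"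
    by (meson not_less)
  then have "?L (\<lambda>_. W) = ?L (\<lambda>_. V)"
  proof cases
    case mid
    then have "(\<Prod>i\<in>{n..<a - n}. X i (p i)) = 0"
      using a pa by (intro prod_zero bexI[of _ i] X0) auto
    then show ?thesis by simp
  next
    case both
    then have "(\<Prod>i=0..<n. W (p i) (p (a - 1 - i))) = 0" "(\<Prod>i=0..<n. V (p i) (p (a - 1 - i))) = 0"
      using a pa by (intro prod_zero bexI[of _ i] W0 V0; auto)+
    then show ?thesis by simp
  next
    case none
    \<comment> \<open>\<open>Q\<close> holds the positions sent to the second block. There are
      \<open>n\<close> of them, none in the middle and no two in one mirror pair. So \<phi>, which
      maps a position to its pair, is injective and hence onto: every pair meets the second
      block.\<close>
    define Q where "Q = {j. j < a \<and> d \<le> p j}"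
    have "bij_betw p Q {d..<a}"
      unfolding bij_betw_def
    proof
      show "inj_on p Q" using permutes_inj[OF p] by (rule inj_on_subset) simp
      show "p ` Q = {d..<a}"
      proof (intro equalityI subsetI)
        fix k assume "k \<in> {d..<a}"
        moreover from this obtain j where "j \<in> {0..<a}" "p j = k"
          using permutes_image[OF p] by (metis atLeastLessThan_iff imageE le0)
        ultimately show "k \<in> p ` Q" by (auto simp: Q_def)
      qed (auto simp: Q_def pa)
    qed
    then have cQ: "card Q = n" using a by (auto dest: bij_betw_same_card)
    define \<phi> where "\<phi> = (\<lambda>j. if j < n then j else a - 1 - j)"
    have Qcases: "j < n \<or> d \<le> j" if "j \<in> Q" for j
      using that none(1)[of j] unfolding Q_def by (metis (mono_tags, lifting) mem_Collect_eq not_le)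
    have "inj_on \<phi> Q"
    proof (rule inj_onI)
      fix j j' assume j: "j \<in> Q" "j' \<in> Q" "\<phi> j = \<phi> j'"
      have False if "l < n" "d \<le> l'" "\<phi> l = \<phi> l'" "l \<in> Q" "l' \<in> Q" for l l'
      proof -
        have "l = a - 1 - l'" "l' < a" using that a by (auto simp: \<phi>_def Q_def)
        then have "a - 1 - l = l'" by linarith
        then show False using none(2)[OF \<open>l < n\<close>] that by (simp add: Q_def)
      qed
      note mixed = this[of j j'] this[of j' j]
      consider "j < n" "j' < n" | "d \<le> j" "d \<le> j'" | "j < n" "d \<le> j'" | "d \<le> j" "j' < n"
        using Qcases[OF j(1)] Qcases[OF j(2)] by blast
      then show "j = j'"
      proof cases
        case 2
        moreover have "j < a" "j' < a" using j by (auto simp: Q_def)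
        moreover have "a - 1 - j = a - 1 - j'" using 2 j(3) a by (simp add: \<phi>_def)
        ultimately show ?thesis by linarith
      qed (use j mixed in \<open>auto simp: \<phi>_def\<close>)
    qed
    moreover have "\<phi> ` Q \<subseteq> {0..<n}" using Qcases a by (fastforce simp: \<phi>_def Q_def)
    ultimately have surj: "\<phi> ` Q = {0..<n}"
      using cQ by (intro card_subset_eq) (auto simp: card_image)
    have "W (p i) (p (a - 1 - i)) = V (p i) (p (a - 1 - i))" if i: "i < n" for i
    proof -
      obtain j where j: "j \<in> Q" "\<phi> j = i" using surj i by (metis atLeastLessThan_iff imageE le0)
      then have "j = i \<or> j = a - 1 - i" using Qcases[OF j(1)] a by (auto simp: \<phi>_def Q_def split: if_splits)
      then have "d \<le> p i \<or> d \<le> p (a - 1 - i)" using j by (auto simp: Q_def)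
      then show ?thesis using none(2)[OF i] eq pa[of i] pa[of "a - 1 - i"] i a by auto
    qed
    then show ?thesis by simp
  qed
  then show "signof p * ?L (\<lambda>_. W) = signof p * ?L (\<lambda>_. V)" by simp
qed

text \<open>On an isotropic block only the pairing with the first block matters, so \<Omega> can be
  exchanged for a model form with the same pairing, for which a single strict tuple exists. The
  determinant of that tuple is block triangular and leaves the pairing matrix. Cancelling
  \<open>2 ^ n\<close> and \<open>fact n\<close> uses characteristic zero.\<close>

lemma sum_strict_tuples_isotropic:
  fixes v :: "'b::linorder \<Rightarrow> nat \<Rightarrow> 'a::field_char_0"
  assumes a: "a = n + d" "n \<le> d" and "finite S"
    and \<Omega>: "\<And>k k'. \<Omega> k k' = (\<Sum>u\<in>S. v u k * v' u k' - v u k' * v' u k)"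
    and \<Omega>0: "\<And>k k'. d \<le> k \<Longrightarrow> k < a \<Longrightarrow> d \<le> k' \<Longrightarrow> k' < a \<Longrightarrow> \<Omega> k k' = 0"
    and X0: "\<And>i k. n \<le> i \<Longrightarrow> i < d \<Longrightarrow> d \<le> k \<Longrightarrow> k < a \<Longrightarrow> X i k = 0"
  shows "(\<Sum>y\<in>strict_tuples n S. Det a (pair_rows n a v X v' y))
    = Det d (\<lambda>i k. if i < n then \<Omega> k (d + (n - 1 - i)) else X i k)"
proof -
  have na: "2 * n \<le> a" using a by simp
  define W where "W = (\<lambda>k k'. \<Sum>u\<in>S. v u k * v' u k')"
  \<comment> \<open>The model: \<open>w j\<close> is the pairing with column \<open>d + j\<close>,
    restricted to the first block, and \<open>w' j\<close> is the unit vector at that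
    column.\<close>
  define w where "w = (\<lambda>j k. if k < d then \<Omega> k (d + j) else 0)"
  define w' where "w' = (\<lambda>j k. if k = d + j then 1 else 0 :: 'a)"
  define V where "V = (\<lambda>k k'. \<Sum>j\<in>{0..<n}. w j k * w' j k')"
  have Veq: "V k k' = (if k < d \<and> d \<le> k' \<and> k' < a then \<Omega> k k' else 0)" for k k'
  proof -
    have "V k k' = (\<Sum>j\<in>{0..<n}. if j = k' - d then (if d \<le> k' then w j k else 0) else 0)"
      unfolding V_def w'_def by (rule sum.cong) auto
    then show ?thesis using a by (auto simp: w_def)
  qed
  have W\<Omega>: "W k k' - W k' k = \<Omega> k k'" for k k'
    by (simp add: W_def \<Omega> sum_subtractf mult.commute)
  have anti: "\<Omega> k k' = - \<Omega> k' k" for k k'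
    by (simp add: W\<Omega>[symmetric])
  let ?Z = "\<Sum>y\<in>strict_tuples n S. Det a (pair_rows n a v X v' y)"
  let ?y = "restrict (\<lambda>i. n - 1 - i) {0..<n}"
  have "strict_tuples n {0..<n} = {?y}"
  proof (intro equalityI subsetI)
    fix y assume "y \<in> strict_tuples n {0..<n}"
    then have y: "y \<in> {0..<n} \<rightarrow>\<^sub>E {0..<n}" "strict_dec n y" by (auto simp: strict_tuples_def)
    then have "y ` {0..<n} = {0..<n}"
      by (intro card_subset_eq) (auto simp: card_image strict_dec_inj)
    moreover have sy: "strict_dec n ?y" by (auto simp: strict_dec_def)
    moreover have "?y ` {0..<n} = {0..<n}"
      by (rule card_subset_eq) (auto simp only: card_image[OF strict_dec_inj[OF sy]], auto)
    ultimately have "rev (map y [0..<n]) = rev (map ?y [0..<n])"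
      using y strict_dec_list by metis
    then have "y i = ?y i" if "i < n" for i using that by (simp add: map_eq_conv)
    then have "y = ?y" using y by (intro PiE_ext[of _ "{0..<n}" "\<lambda>_. {0..<n}"]) auto
    then show "y \<in> {?y}" by simp
  qed (auto simp: strict_tuples_def strict_dec_def)
  then have strict1: "(\<Sum>y\<in>strict_tuples n {0..<n}. Det a (pair_rows n a w X w' y))
      = Det a (pair_rows n a w X w' ?y)" by simp
  have "2 ^ n * (of_nat (fact n) * ?Z) = 2 ^ n * pair_sum n a X (\<lambda>_. W)"
    using sum_tuples_pair_rows[OF assms(3) na, of v X v']
      sum_pair_rows_eq_pair_sum[OF assms(3) na, of v X v'] by (simp add: W_def)
  also have "\<dots> = pair_sum n a X (\<lambda>_. \<Omega>)"
    using pair_sum_antisym[OF na, of X W] by (simp add: W\<Omega>)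
  also have "\<dots> = pair_sum n a X (\<lambda>_ k k'. V k k' - V k' k)"
    using a \<Omega>0 X0 by (intro pair_sum_isotropic[of a n d]) (auto simp: Veq intro: anti)
  also have "\<dots> = 2 ^ n * pair_sum n a X (\<lambda>_. V)"
    by (rule pair_sum_antisym[OF na, symmetric])
  also have "pair_sum n a X (\<lambda>_. V) = of_nat (fact n) * Det a (pair_rows n a w X w' ?y)"
    using sum_tuples_pair_rows[of "{0..<n}" n a w X w'] na strict1
      sum_pair_rows_eq_pair_sum[of "{0..<n}" n a w X w'] by (simp add: V_def)
  finally have "?Z = Det a (pair_rows n a w X w' ?y)" by simp
  also have "\<dots> = Det d (pair_rows n a w X w' ?y) *
      Det (a - d) (\<lambda>i j. pair_rows n a w X w' ?y (d + i) (d + j))"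
    using a by (intro Det_block_lower) (auto simp: pair_rows_def w'_def)
  also have "Det (a - d) (\<lambda>i j. pair_rows n a w X w' ?y (d + i) (d + j)) = 1"
    using a by (subst Det_upper_triangular) (auto simp: pair_rows_def w'_def)
  also have "Det d (pair_rows n a w X w' ?y)
      = Det d (\<lambda>i k. if i < n then \<Omega> k (d + (n - 1 - i)) else X i k)"
    using a by (intro Det_cong) (auto simp: pair_rows_def w_def)
  finally show ?thesis by simp
qed

section \<open>A product formula for Toeplitz determinants\<close>

lemma sum_int_shift_diff:
  fixes \<phi> :: "int \<Rightarrow> 'a::ab_group_add"
  assumes "0 \<le> \<delta>" "s \<le> U - \<delta>" "\<And>w. U - \<delta> < w \<Longrightarrow> w \<le> U \<Longrightarrow> \<phi> w = 0"
  shows "(\<Sum>u\<in>{s..U}. \<phi> u - \<phi> (u - \<delta>)) = - (\<Sum>w\<in>{s - \<delta>..<s}. \<phi> w)"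
proof -
  have "(\<Sum>u\<in>{s..U}. \<phi> (u - \<delta>)) = (\<Sum>u\<in>{s - \<delta>..U - \<delta>}. \<phi> u)"
    by (rule sum.reindex_bij_witness[where i="\<lambda>u. u + \<delta>" and j="\<lambda>u. u - \<delta>"]) auto
  also have "{s - \<delta>..U - \<delta>} = {s - \<delta>..<s} \<union> {s..U - \<delta>}" using assms by auto
  also have "(\<Sum>u\<in>\<dots>. \<phi> u) = (\<Sum>w\<in>{s - \<delta>..<s}. \<phi> w) + (\<Sum>u\<in>{s..U - \<delta>}. \<phi> u)"
    by (rule sum.union_disjoint) auto
  also have "(\<Sum>u\<in>{s..U - \<delta>}. \<phi> u) = (\<Sum>u\<in>{s..U}. \<phi> u)"
    using assms by (intro sum.mono_neutral_left) auto
  finally show ?thesis by (simp add: sum_subtractf)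
qed

text \<open>Exchanging \<open>k\<close> and \<open>k'\<close> has the effect of shifting
  \<open>u\<close> by \<open>k - k'\<close>. The two sums cancel except at their ends; at the upper
  end \<open>f'\<close> is zero, so only terms just below \<open>s\<close> survive.\<close>

lemma sum_swap_telescope:
  fixes f f' :: "int \<Rightarrow> 'a::comm_ring_1"
  assumes "k' \<le> k" "s \<le> U - (k - k')" "\<And>l. l < R - U + k \<Longrightarrow> f' l = 0"
  shows "(\<Sum>u\<in>{s..U}. f (u + k) * f' (R - u + k') - f (u + k') * f' (R - u + k))
    = - (\<Sum>w\<in>{s - (k - k')..<s}. f (w + k) * f' (R - w + k'))"
proof -
  let ?\<phi> = "\<lambda>w. f (w + k) * f' (R - w + k')"
  have "(\<Sum>u\<in>{s..U}. f (u + k) * f' (R - u + k') - f (u + k') * f' (R - u + k))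
      = (\<Sum>u\<in>{s..U}. ?\<phi> u - ?\<phi> (u - (k - k')))"
    by (rule sum.cong) (auto simp: algebra_simps)
  also have "\<dots> = - (\<Sum>w\<in>{s - (k - k')..<s}. ?\<phi> w)"
    using assms by (intro sum_int_shift_diff) auto
  finally show ?thesis .
qed

text \<open>The last hypothesis covers precisely the arguments of \<open>f'\<close> in the boundary
  terms of the telescoped sum.\<close>

lemma sum_swap_vanishes:
  fixes f f' :: "int \<Rightarrow> 'a::comm_ring_1"
  assumes "\<bar>k - k'\<bar> \<le> U - s" "\<And>l. l < R - U + max k k' \<Longrightarrow> f' l = 0"
    and "\<And>l. R - s + min k k' < l \<Longrightarrow> l \<le> R - s + max k k' \<Longrightarrow> f' l = 0"
  shows "(\<Sum>u\<in>{s..U}. f (u + k) * f' (R - u + k') - f (u + k') * f' (R - u + k)) = 0"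
proof -
  have *: "(\<Sum>u\<in>{s..U}. f (u + k) * f' (R - u + k') - f (u + k') * f' (R - u + k)) = 0"
    if "k' \<le> k" "k - k' \<le> U - s" "\<And>l. l < R - U + k \<Longrightarrow> f' l = 0"
      "\<And>l. R - s + k' < l \<Longrightarrow> l \<le> R - s + k \<Longrightarrow> f' l = 0" for k k'
  proof -
    have "(\<Sum>w\<in>{s - (k - k')..<s}. f (w + k) * f' (R - w + k')) = 0"
      using that by (intro sum.neutral) auto
    then show ?thesis using that by (subst sum_swap_telescope) auto
  qed
  show ?thesis
  proof (cases "k' \<le> k")
    case True
    then show ?thesis using assms by (intro *) auto
  next
    case False
    then have "(\<Sum>u\<in>{s..U}. f (u + k') * f' (R - u + k) - f (u + k) * f' (R - u + k')) = 0"
      using assms by (intro *) auto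
    then show ?thesis by (simp add: sum_subtractf)
  qed
qed

text \<open>
  The sum over strict tuples is governed by the alternating form
  \<open>\<Omega>(k, k') = \<Sum>\<^sub>u h(u + k) h'(R - u + k') - h(u + k') h'(R - u + k)\<close>. Choosing a monic polynomial
  \<open>P\<close> of degree \<open>d\<close> that is orthogonal, with respect to the moments \<open>h'\<close>, to all lower powers makes
  the \<open>n\<close>-dimensional space of multiples of \<open>P\<close> isotropic for \<open>\<Omega>\<close>. The pairing of this space
  with the polynomials of degree below \<open>d\<close> is a product of a Toeplitz matrix in \<open>h\<close>,
  a unitriangular matrix and a Toeplitz matrix in \<open>h'\<close>.
\<close>

theorem sum_strict_tuples_Toeplitz:
  fixes h h' :: "int \<Rightarrow> 'a::field_char_0" and s t R U :: int and n d a :: nat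
  assumes d: "n \<le> d" "d \<le> Suc n" and a: "a = n + d" and R: "R = s + t - int a + 1"
    and U: "U \<ge> s + t + 4 * int a + 4" and t: "0 \<le> t"
    and neg: "\<And>l. l < 0 \<Longrightarrow> h' l = 0"
    and nz: "Det d (\<lambda>i j. h' (t - int i + int j)) \<noteq> 0"
  shows "(\<Sum>y\<in>strict_tuples n {s - int n + 1..U}.
      Det a (pair_rows n a (\<lambda>u j. h (u + int j)) (\<lambda>i j. h' (t - int n + int j))
        (\<lambda>u j. h' (R - u + int j)) y))
    = Det n (\<lambda>i j. h (s - int i + int j)) * Det d (\<lambda>i j. h' (t - int i + int j))"
proof -
  \<comment> \<open>The orthogonality equations: the unknowns are the lower coefficients of
    \<open>P\<close>, and its leading coefficient 1 produces the right-hand side.\<close>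
  obtain c where c: "\<And>y. y < d \<Longrightarrow> (\<Sum>i<d. h' (t - int y + int i) * c i) = - h' (t - int y + int d)"
    using Det_solve[OF nz, of "\<lambda>y. - h' (t - int y + int d)"] by blast
  define P where "P = (\<lambda>i. if i < d then c i else if i = d then 1 else 0)"
  have Pd: "P d = 1" by (simp add: P_def)
  define g where "g = (\<lambda>l. \<Sum>i\<le>d. P i * h (l + int i))"
  define g' where "g' = (\<lambda>l. \<Sum>i\<le>d. P i * h' (l + int i))"
  define s0 where "s0 = s - int n + 1"
  \<comment> \<open>The boundary terms at the start \<open>s0\<close> of the range have arguments
    just above \<open>R - s0\<close>. Here that is the lower end of the window
    \<open>t - d < l \<le> t\<close> on which \<open>g'\<close> vanishes.\<close>
  have Rs0: "R - s0 = t - int d" by (simp add: R s0_def a)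
  have s0_eq: "s0 = R - t + int d" using Rs0 by simp
  have g'_eq: "g' l = (\<Sum>i<d. h' (l + int i) * c i) + h' (l + int d)" for l
    by (simp add: g'_def lessThan_Suc_atMost[symmetric] P_def mult.commute)
  have g'0: "g' l = 0" if "t - int d < l" "l \<le> t" for l
    using c[of "nat (t - l)"] that by (simp add: g'_eq)
  have g'neg: "g' l = 0" if "l < - int d" for l
    unfolding g'_def using that by (intro sum.neutral) (auto simp: neg)

  define v where "v = (\<lambda>u j. h (u + int j))"
  define v' where "v' = (\<lambda>u j. h' (R - u + int j))"
  define X where "X = (\<lambda>(i::nat) j. h' (t - int n + int j))"
  define T where "T = (\<lambda>x j. if j < d then x j else \<Sum>i\<le>d. P i * x (j - d + i) :: 'a)"
  let ?S = "{s0..U}"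
  have column_op: "Det a (pair_rows n a v X v' y)
      = Det a (pair_rows n a (\<lambda>u. T (v u)) (\<lambda>i. T (X i)) (\<lambda>u. T (v' u)) y)" for y
  proof -
    \<comment> \<open>Column \<open>j \<ge> d\<close> is replaced by the combination of columns that
      represents \<open>P\<close> times the power \<open>j - d\<close> of the variable.
      \<open>Q\<close> is unitriangular because \<open>P\<close> is monic.\<close>
    define Q where "Q = (\<lambda>k j. if j < d then (if k = j then 1 else 0)
        else if j - d \<le> k \<and> k \<le> j then P (k - (j - d)) else 0)"
    have "Det a Q = (\<Prod>i<a. Q i i)" by (rule Det_upper_triangular) (auto simp: Q_def)
    also have "\<dots> = 1" by (rule prod.neutral) (auto simp: Q_def Pd)
    finally have Q1: "Det a Q = 1" .
    have TQ: "(\<Sum>k<a. x k * Q k j) = T x j" if "j < a" for x j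
    proof (cases "j < d")
      case True
      then have "(\<Sum>k<a. x k * Q k j) = (\<Sum>k<a. if k = j then x j else 0)"
        by (intro sum.cong) (auto simp: Q_def)
      then show ?thesis using True that by (simp add: T_def)
    next
      case False
      have "(\<Sum>k<a. x k * Q k j) = (\<Sum>k\<in>{j - d..j}. x k * Q k j)"
        using False that by (intro sum.mono_neutral_right) (auto simp: Q_def)
      also have "\<dots> = (\<Sum>i\<le>d. P i * x (j - d + i))"
        using False by (intro sum.reindex_bij_witness[where i="\<lambda>i. j - d + i" and j="\<lambda>k. k - (j - d)"])
          (auto simp: Q_def)
      finally show ?thesis using False by (simp add: T_def)
    qed
    have "Det a (pair_rows n a v X v' y) = Det a (\<lambda>i j. \<Sum>k<a. pair_rows n a v X v' y i k * Q k j)"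
      using Det_mult[of a "pair_rows n a v X v' y" Q] Q1 by simp
    also have "\<dots> = Det a (pair_rows n a (\<lambda>u. T (v u)) (\<lambda>i. T (X i)) (\<lambda>u. T (v' u)) y)"
      by (rule Det_cong) (auto simp: pair_rows_def TQ)
    finally show ?thesis .
  qed
  have Tv: "T (v u) j = (if j < d then h (u + int j) else g (u + int (j - d)))" for u j
    by (auto simp: T_def v_def g_def algebra_simps)
  have Tv': "T (v' u) j = (if j < d then h' (R - u + int j) else g' (R - u + int (j - d)))" for u j
    by (auto simp: T_def v'_def g'_def algebra_simps)
  have TX: "T (X i) j = (if j < d then h' (t - int n + int j) else g' (t - int n + int (j - d)))" for i j
    by (auto simp: T_def X_def g'_def algebra_simps)

  define \<Omega> where "\<Omega> = (\<lambda>k k'. \<Sum>u\<in>?S. T (v u) k * T (v' u) k' - T (v u) k' * T (v' u) k)"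
  have isotropic: "\<Omega> k k' = 0" if "d \<le> k" "k < a" "d \<le> k'" "k' < a" for k k'
  proof -
    define j j' where "j = int (k - d)" and "j' = int (k' - d)"
    have j: "0 \<le> j" "j < int n" "0 \<le> j'" "j' < int n" using that a by (auto simp: j_def j'_def)
    have "\<Omega> k k' = (\<Sum>u\<in>?S. g (u + j) * g' (R - u + j') - g (u + j') * g' (R - u + j))"
      using that by (simp add: \<Omega>_def Tv Tv' j_def j'_def)
    \<comment> \<open>The offsets are below \<open>n \<le> d\<close>, which keeps all boundary
      arguments inside the window of \<open>g'\<close>.\<close>
    also have "\<dots> = 0"
      using j U R Rs0 t d a by (intro sum_swap_vanishes g'0 g'neg) (auto simp: s0_def)
    finally show ?thesis .
  qed

  define G where "G = (\<lambda>x k. \<Sum>y<d. (if x \<le> y then P (x + d - y) else 0) * h' (t - int y + int k))"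
  have pairing: "\<Omega> k (d + j) = (\<Sum>x<d. h (s0 + int j + int x) * G x k)" if k: "k < d" and j: "j < n" for k j
  proof -
    \<comment> \<open>Because this sum vanishes, the factors \<open>h\<close> and \<open>g'\<close>
      may trade their offsets. Both products in \<Omega> then have offset \<open>j\<close> on the
      left and \<open>k\<close> on the right, and their difference is, up to sign, the pairing of
      the divided difference (P(x) - P(y)) / (x - y), whose coefficients are those of
      \<open>P\<close>.\<close>
    have "(\<Sum>u\<in>?S. h (u + int j) * g' (R - u + int k) - h (u + int k) * g' (R - u + int j)) = 0"
      using k j U R Rs0 t d a by (intro sum_swap_vanishes g'0 g'neg) (auto simp: s0_def)
    then have "\<Omega> k (d + j) = (\<Sum>u\<in>?S. h (u + int j) * g' (R - u + int k) - g (u + int j) * h' (R - u + int k))"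
      using k by (simp add: \<Omega>_def Tv Tv' sum_subtractf)
    also have "\<dots> = (\<Sum>u\<in>?S. \<Sum>i\<le>d. P i * (h (u + int j) * h' (R - u + int k + int i)
        - h (u + int j + int i) * h' (R - u + int k)))"
      by (intro sum.cong refl)
        (simp add: g_def g'_def sum_distrib_left sum_distrib_right sum_subtractf algebra_simps)
    also have "\<dots> = (\<Sum>i\<le>d. P i * (\<Sum>u\<in>?S. h (u + int j) * h' (R - u + int k + int i)
        - h (u + int j + int i) * h' (R - u + int k)))"
      unfolding sum_distrib_left by (rule sum.swap)
    also have "\<dots> = (\<Sum>i\<le>d. P i * (\<Sum>y<i. h (s0 + int j + int i - 1 - int y) * h' (t - int d + 1 + int k + int y)))"
    proof (intro sum.cong refl arg_cong2[where f="(*)"])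
      fix i assume "i \<in> {..d}"
      then have i: "i \<le> d" by simp
      let ?R = "R + int k - int j"
      have "(\<Sum>u\<in>?S. h (u + int j) * h' (R - u + int k + int i) - h (u + int j + int i) * h' (R - u + int k))
          = - (\<Sum>u\<in>?S. h (u + (int j + int i)) * h' (?R - u + int j) - h (u + int j) * h' (?R - u + (int j + int i)))"
        by (simp add: sum_negf[symmetric] algebra_simps)
      also have "\<dots> = (\<Sum>w\<in>{s0 - int i..<s0}. h (w + (int j + int i)) * h' (?R - w + int j))"
        using i k j U R Rs0 t d a by (subst sum_swap_telescope) (auto simp: s0_def neg)
      also have "\<dots> = (\<Sum>y<i. h (s0 + int j + int i - 1 - int y) * h' (t - int d + 1 + int k + int y))"
        by (intro sum.reindex_bij_witness[where i="\<lambda>y. s0 - 1 - int y" and j="\<lambda>w. nat (s0 - 1 - w)"])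
          (auto simp: s0_eq algebra_simps)
      finally show "(\<Sum>u\<in>?S. h (u + int j) * h' (R - u + int k + int i) - h (u + int j + int i) * h' (R - u + int k))
          = \<dots>" .
    qed
    also have "\<dots> = (\<Sum>(i, y)\<in>Sigma {..d} (\<lambda>i. {..<i}). P i * (h (s0 + int j + int i - 1 - int y) * h' (t - int d + 1 + int k + int y)))"
      by (simp add: sum_distrib_left sum.Sigma)
    \<comment> \<open>Reversing \<open>y\<close> turns the index of the coefficient into
      \<open>x + d - y\<close>, so the coefficient matrix is triangular with \<open>P d = 1\<close>
      on its diagonal.\<close>
    also have "\<dots> = (\<Sum>(x, y)\<in>{(x, y). x \<le> y \<and> y < d}.
        P (x + d - y) * (h (s0 + int j + int x) * h' (t - int y + int k)))"
      by (rule sum.reindex_bij_witness[where i="\<lambda>(x, y). (x + d - y, d - 1 - y)"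
            and j="\<lambda>(i, y). (i - 1 - y, d - 1 - y)"])
        (auto simp: of_nat_diff algebra_simps)
    also have "\<dots> = (\<Sum>(x, y)\<in>{..<d} \<times> {..<d}.
        (if x \<le> y then P (x + d - y) * (h (s0 + int j + int x) * h' (t - int y + int k)) else 0))"
      by (rule sum.mono_neutral_cong_left) (auto split: if_splits)
    also have "\<dots> = (\<Sum>x<d. h (s0 + int j + int x) * G x k)"
      unfolding G_def sum_distrib_left sum.cartesian_product[symmetric]
      by (intro sum.cong refl) auto
    finally show ?thesis .
  qed

  \<comment> \<open>For \<open>d = n + 1\<close> the \<open>n\<close> Toeplitz rows are completed by
    a unit row. It selects the last row of \<open>G\<close>, which is the middle row of the
    determinant.\<close>
  define F where "F = (\<lambda>i x. if i < n then h (s - int i + int x) else if x = n then 1 else 0)"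
  have F: "Det d F = Det n (\<lambda>i j. h (s - int i + int j))"
  proof -
    have "Det d F = Det n F * Det (d - n) (\<lambda>i j. F (n + i) (n + j))"
      using d by (intro Det_block_lower) (auto simp: F_def)
    also have "Det (d - n) (\<lambda>i j. F (n + i) (n + j)) = 1"
      using d by (subst Det_upper_triangular) (auto simp: F_def intro!: prod.neutral)
    finally show ?thesis by (simp add: F_def cong: Det_cong)
  qed
  have GA: "Det d G = Det d (\<lambda>i j. h' (t - int i + int j))"
  proof -
    have "Det d (\<lambda>x y. if x \<le> y then P (x + d - y) else 0) = (\<Prod>i<d. P d)"
      by (subst Det_upper_triangular) auto
    then show ?thesis
      using Det_mult[of d "\<lambda>x y. if x \<le> y then P (x + d - y) else 0" "\<lambda>y k. h' (t - int y + int k)"]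
      by (simp add: G_def Pd)
  qed

  have "(\<Sum>y\<in>strict_tuples n ?S. Det a (pair_rows n a v X v' y))
      = (\<Sum>y\<in>strict_tuples n ?S. Det a (pair_rows n a (\<lambda>u. T (v u)) (\<lambda>i. T (X i)) (\<lambda>u. T (v' u)) y))"
    by (simp only: column_op)
  also have "\<dots> = Det d (\<lambda>i k. if i < n then \<Omega> k (d + (n - 1 - i)) else T (X i) k)"
    by (rule sum_strict_tuples_isotropic[OF a d(1) _ _ isotropic])
      (use d t a in \<open>auto simp: \<Omega>_def TX intro!: g'0\<close>)
  also have "\<dots> = Det d (\<lambda>i k. \<Sum>x<d. F i x * G x k)"
  proof (rule Det_cong)
    fix i k assume ik: "i < d" "k < d"
    show "(if i < n then \<Omega> k (d + (n - 1 - i)) else T (X i) k) = (\<Sum>x<d. F i x * G x k)"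
    proof (cases "i < n")
      case True
      then have s_eq: "s0 + int (n - 1 - i) = s - int i"
        by (simp add: s0_def of_nat_diff)
      have "n - 1 - i < n" using True by simp
      from pairing[OF ik(2) this] show ?thesis using True unfolding s_eq by (simp add: F_def)
    next
      case False
      then have dn: "i = n" "d = Suc n" using ik d by auto
      have "(\<Sum>x<d. F i x * G x k) = (\<Sum>x<d. if x = n then G n k else 0)"
        by (rule sum.cong) (auto simp: F_def False)
      also have "\<dots> = G n k" using dn by simp
      also have "\<dots> = (\<Sum>y<d. if y = n then h' (t - int n + int k) else 0)"
        unfolding G_def using dn Pd by (intro sum.cong) auto
      also have "\<dots> = h' (t - int n + int k)" using dn by simp
      finally show ?thesis using ik dn by (simp add: TX)
    qed
  qed
  also have "\<dots> = Det d F * Det d G" by (rule Det_mult[symmetric])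
  finally show ?thesis by (simp add: F GA v_def X_def v'_def s0_def)
qed

section \<open>Semistandard tableaux and the box formula\<close>

text \<open>
  \<open>csym N k\<close> is the complete homogeneous symmetric polynomial of degree \<open>k\<close> evaluated at \<open>N\<close> ones.
\<close>

definition csym :: "nat \<Rightarrow> int \<Rightarrow> real" where
  "csym N k = (if k < 0 then 0 else real ((N + nat k - 1) choose nat k))"

lemma csym_neg: "k < 0 \<Longrightarrow> csym N k = 0"
  by (simp add: csym_def)

lemma csym_0: "csym 0 k = (if k = 0 then 1 else 0)"
  by (auto simp: csym_def binomial_eq_0)

lemma csym_Suc: "csym (Suc N) k = csym (Suc N) (k - 1) + csym N k"
proof -
  consider "k < 0" | "k = 0" | l where "k = int (Suc l)"
    by (metis not0_implies_Suc zero_less_imp_eq_int linorder_neqE_linordered_idom less_irrefl of_nat_0)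
  then show ?thesis
  proof cases
    case 3
    then have "nat k = Suc l" "nat (k - 1) = l" by auto
    then show ?thesis using 3 by (simp add: csym_def)
  qed (auto simp: csym_def)
qed

text \<open>Adding a variable amounts to summing over degrees, so the sum telescopes by
  \<open>csym_Suc\<close>. The case \<open>x = Suc y\<close> is an empty range.\<close>

lemma sum_csym:
  "x \<le> Suc y \<Longrightarrow> (\<Sum>r\<in>{x..y}. csym N (int r + k)) = csym (Suc N) (int y + k) - csym (Suc N) (int x - 1 + k)"
proof (induction y)
  case 0
  then consider "x = 0" | "x = 1" by linarith
  then show ?case using csym_Suc[of N k] by cases auto
next
  case (Suc y)
  show ?case
  proof (cases "x = Suc (Suc y)")
    case False
    then have "{x..Suc y} = insert (Suc y) {x..y}" using Suc.prems by auto
    then show ?thesis using Suc False csym_Suc[of N "int (Suc y) + k"] by (simp add: algebra_simps)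
  qed simp
qed

text \<open>The order is the reverse of the usual one: entries decrease weakly along rows and
  strictly down columns. The value 0 marks the cells outside the shape, so a tableau determines its
  shape.\<close>

definition ssyt :: "nat \<Rightarrow> (nat \<Rightarrow> nat) \<Rightarrow> (nat \<Rightarrow> nat \<Rightarrow> nat) set" where
  "ssyt N \<nu> = {T. (\<forall>i j. 0 < T i j \<longleftrightarrow> j < \<nu> i) \<and> (\<forall>i j. T i j \<le> N) \<and>
     (\<forall>i j. T i (Suc j) \<le> T i j) \<and> (\<forall>i j. 0 < T (Suc i) j \<longrightarrow> T (Suc i) j < T i j)}"

lemma ssyt_antimono:
  assumes "T \<in> ssyt N \<nu>"
  shows "j \<le> j' \<Longrightarrow> T i j' \<le> T i j"
  using assms lift_Suc_antimono_le[of "T i" j j'] by (simp add: ssyt_def)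

text \<open>Elements of \<open>PiE\<close> are \<open>undefined\<close> outside
  \<open>{0..<a}\<close>, whereas a shape has to be 0 there.\<close>

definition zero_extend :: "nat \<Rightarrow> (nat \<Rightarrow> 'b::zero) \<Rightarrow> nat \<Rightarrow> 'b" where
  "zero_extend a y i = (if i < a then y i else 0)"

text \<open>Removing the entries 1 from a tableau of shape \<open>\<nu>\<close> leaves a shape that interlaces \<open>\<nu>\<close>.\<close>

lemma ssyt_Suc:
  fixes \<nu> :: "nat \<Rightarrow> nat" and a N :: nat
  defines "I \<equiv> PiE {0..<a} (\<lambda>i. {\<nu> (Suc i)..\<nu> i})"
    and "L \<equiv> \<lambda>T i j. if j < \<nu> i then Suc (T i j) else 0"
  assumes supp: "\<And>i. a \<le> i \<Longrightarrow> \<nu> i = 0"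
  shows "bij_betw L (\<Union>y\<in>I. ssyt N (zero_extend a y)) (ssyt (Suc N) \<nu>)"
  unfolding bij_betw_def
proof
  have le: "zero_extend a y i \<le> \<nu> i" if "y \<in> I" for y i
    using that by (auto simp: I_def zero_extend_def PiE_iff)
  show "inj_on L (\<Union>y\<in>I. ssyt N (zero_extend a y))"
  proof (rule inj_onI)
    fix T T' assume T: "T \<in> (\<Union>y\<in>I. ssyt N (zero_extend a y))" "T' \<in> (\<Union>y\<in>I. ssyt N (zero_extend a y))"
      and eq: "L T = L T'"
    have out: "T i j = 0" if "T \<in> (\<Union>y\<in>I. ssyt N (zero_extend a y))" "\<nu> i \<le> j" for T i j
    proof -
      from that obtain y where y: "y \<in> I" "T \<in> ssyt N (zero_extend a y)" by blast
      then have "0 < T i j \<longleftrightarrow> j < zero_extend a y i" by (simp add: ssyt_def)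
      then show ?thesis using le[OF y(1), of i] that by simp
    qed
    have "T i j = T' i j" for i j
    proof -
      have "L T i j = L T' i j" using eq by simp
      then show ?thesis using out[OF T(1), of i j] out[OF T(2), of i j]
        by (cases "j < \<nu> i") (simp_all add: L_def)
    qed
    then show "T = T'" by (intro ext)
  qed
  show "L ` (\<Union>y\<in>I. ssyt N (zero_extend a y)) = ssyt (Suc N) \<nu>"
  proof (intro equalityI subsetI)
    fix T assume "T \<in> L ` (\<Union>y\<in>I. ssyt N (zero_extend a y))"
    then obtain y T' where y: "y \<in> I" and T': "T' \<in> ssyt N (zero_extend a y)" and T: "T = L T'" by auto
    have "T (Suc i) j < T i j" if "0 < T (Suc i) j" for i j
    proof -
      have j: "j < \<nu> (Suc i)" using that by (auto simp: T L_def split: if_splits)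
      then have "i < a" using supp[of "Suc i"] by (cases "i < a") auto
      then have "\<nu> (Suc i) \<le> y i \<and> y i \<le> \<nu> i" using y by (auto simp: I_def PiE_iff)
      then have "j < y i" "y i \<le> \<nu> i" using j by auto
      then have "0 < T' i j" using T' \<open>i < a\<close> by (simp add: ssyt_def zero_extend_def)
      moreover have "0 < T' (Suc i) j \<longrightarrow> T' (Suc i) j < T' i j" using T' by (simp add: ssyt_def)
      ultimately show ?thesis using j \<open>j < y i\<close> \<open>y i \<le> \<nu> i\<close> by (cases "T' (Suc i) j") (auto simp: T L_def)
    qed
    then show "T \<in> ssyt (Suc N) \<nu>" using T' by (auto simp: ssyt_def T L_def)
  next
    fix T assume T: "T \<in> ssyt (Suc N) \<nu>"
    \<comment> \<open>\<open>y i\<close> counts the entries of row \<open>i\<close> that are at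
      least 2; rows decrease, so these come first.\<close>
    define y where "y = restrict (\<lambda>i. LEAST j. T i j < 2) {0..<a}"
    have pos: "0 < T i j \<longleftrightarrow> j < \<nu> i" for i j using T by (simp add: ssyt_def)
    have y: "2 \<le> T i j \<longleftrightarrow> j < zero_extend a y i" for i j
    proof (cases "i < a")
      case True
      have "T i (\<nu> i) < 2" using pos[of i "\<nu> i"] by simp
      then have "T i (y i) < 2" using True by (auto simp: y_def intro: LeastI)
      then have "\<not> 2 \<le> T i j" if "y i \<le> j" using ssyt_antimono[OF T that, of i] by simp
      moreover have "2 \<le> T i j" if "j < y i" using True that not_less_Least[of j "\<lambda>j. T i j < 2"]
        by (simp add: y_def)
      ultimately show ?thesis using True by (cases "j < y i") (auto simp: zero_extend_def)
    next
      case False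
      then show ?thesis using pos[of i j] supp[of i] by (simp add: zero_extend_def)
    qed
    have "y \<in> I"
      unfolding I_def
    proof (rule PiE_I)
      fix i assume "i \<in> {0..<a}"
      then have yi: "zero_extend a y i = y i" by (simp add: zero_extend_def)
      have "y i \<le> \<nu> i"
      proof (rule ccontr)
        assume "\<not> y i \<le> \<nu> i"
        then have "2 \<le> T i (\<nu> i)" using y[of i "\<nu> i"] yi by simp
        then show False using pos[of i "\<nu> i"] by simp
      qed
      moreover have "\<nu> (Suc i) \<le> y i"
      proof (rule ccontr)
        assume "\<not> \<nu> (Suc i) \<le> y i"
        then have "0 < T (Suc i) (y i)" using pos by simp
        moreover from this have "T (Suc i) (y i) < T i (y i)" using T by (simp add: ssyt_def)
        ultimately have "2 \<le> T i (y i)" by linarith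
        then show False using y[of i "y i"] yi by simp
      qed
      ultimately show "y i \<in> {\<nu> (Suc i)..\<nu> i}" by simp
    qed (simp add: y_def)
    define T' where "T' = (\<lambda>i j. T i j - 1)"
    have "T' \<in> ssyt N (zero_extend a y)"
      unfolding ssyt_def mem_Collect_eq
    proof (intro conjI allI impI)
      fix i j
      show "0 < T' i j \<longleftrightarrow> j < zero_extend a y i" using y[of i j] by (auto simp: T'_def)
      show "T' i j \<le> N" using T by (simp add: T'_def ssyt_def le_diff_conv)
      show "T' i (Suc j) \<le> T' i j" using T by (simp add: T'_def ssyt_def diff_le_mono)
      assume "0 < T' (Suc i) j"
      then have "1 < T (Suc i) j" by (simp add: T'_def)
      moreover have "0 < T (Suc i) j \<longrightarrow> T (Suc i) j < T i j" using T by (simp add: ssyt_def)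
      ultimately show "T' (Suc i) j < T' i j" by (simp add: T'_def)
    qed
    moreover have "T i j = L T' i j" for i j
      using pos[of i j] by (cases "j < \<nu> i") (auto simp: L_def T'_def)
    then have "T = L T'" by (intro ext)
    ultimately show "T \<in> L ` (\<Union>y\<in>I. ssyt N (zero_extend a y))" using \<open>y \<in> I\<close> by blast
  qed
qed

lemma ssyt_disjoint:
  assumes "T \<in> ssyt N \<nu>" "T \<in> ssyt N \<mu>"
  shows "\<nu> = \<mu>"
proof
  fix i
  have "0 < T i j \<longleftrightarrow> j < \<nu> i" "0 < T i j \<longleftrightarrow> j < \<mu> i" for j
    using assms by (simp_all add: ssyt_def)
  then have iff: "j < \<nu> i \<longleftrightarrow> j < \<mu> i" for j by simp
  show "\<nu> i = \<mu> i" using iff[of "\<nu> i"] iff[of "\<mu> i"] by simp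
qed

text \<open>Jacobi-Trudi by induction on the number of letters. The row lengths left after removing
  the entries 1 range over independent intervals, so the determinants can be summed row by row. Each
  row sum is the difference of two consecutive rows with one more variable, which
  \<open>Det_row_diff\<close> undoes.\<close>

theorem card_ssyt:
  fixes \<nu> :: "nat \<Rightarrow> nat"
  assumes "\<And>i. \<nu> (Suc i) \<le> \<nu> i" "\<And>i. a \<le> i \<Longrightarrow> \<nu> i = 0"
  shows "finite (ssyt N \<nu>) \<and>
    real (card (ssyt N \<nu>)) = Det a (\<lambda>i j. csym N (int (\<nu> i) - int i + int j))"
  using assms
proof (induction N arbitrary: \<nu>)
  case 0
  show ?case
  proof (cases "\<forall>i. \<nu> i = 0")
    case True
    then have "ssyt 0 \<nu> = {\<lambda>_ _. 0}" by (auto simp: ssyt_def fun_eq_iff)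
    moreover have "Det a (\<lambda>i j. csym 0 (int (\<nu> i) - int i + int j)) = (\<Prod>i<a. 1)"
      using True by (subst Det_upper_triangular) (auto simp: csym_0)
    ultimately show ?thesis by simp
  next
    case False
    then obtain i where "\<nu> i \<noteq> 0" by auto
    moreover have "\<nu> i \<le> \<nu> 0" using lift_Suc_antimono_le[of \<nu> 0 i] 0 by simp
    ultimately have 1: "0 < \<nu> 0" by simp
    then have "0 < a" using 0(2)[of 0] by (cases a) auto
    then have "Det a (\<lambda>i j. csym 0 (int (\<nu> i) - int i + int j)) = 0"
      using 1 by (intro Det_zero_row[of 0]) (auto simp: csym_0)
    moreover have "ssyt 0 \<nu> = {}" using 1 by (auto simp: ssyt_def)
    ultimately show ?thesis by simp
  qed
next
  case (Suc N)
  let ?I = "PiE {0..<a} (\<lambda>i. {\<nu> (Suc i)..\<nu> i})"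
  have IH: "finite (ssyt N (zero_extend a y)) \<and> real (card (ssyt N (zero_extend a y)))
      = Det a (\<lambda>i j. csym N (int (y i) - int i + int j))" if "y \<in> ?I" for y
  proof -
    have "zero_extend a y (Suc i) \<le> zero_extend a y i" for i
    proof (cases "Suc i < a")
      case True
      then have "y (Suc i) \<le> \<nu> (Suc i)" "\<nu> (Suc i) \<le> y i" using that by (auto simp: PiE_iff)
      then show ?thesis using True by (simp add: zero_extend_def)
    qed (simp add: zero_extend_def)
    then have "finite (ssyt N (zero_extend a y)) \<and> real (card (ssyt N (zero_extend a y)))
        = Det a (\<lambda>i j. csym N (int (zero_extend a y i) - int i + int j))"
      by (rule Suc.IH) (simp add: zero_extend_def)
    moreover have "Det a (\<lambda>i j. csym N (int (zero_extend a y i) - int i + int j))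
        = Det a (\<lambda>i j. csym N (int (y i) - int i + int j))"
      by (rule Det_cong) (simp add: zero_extend_def)
    ultimately show ?thesis by simp
  qed
  note bij = ssyt_Suc[of a \<nu> N, OF Suc.prems(2)]
  have fin: "finite ?I" by (simp add: finite_PiE)
  have disj: "ssyt N (zero_extend a y) \<inter> ssyt N (zero_extend a y') = {}"
    if "y \<in> ?I" "y' \<in> ?I" "y \<noteq> y'" for y y'
  proof (rule ccontr)
    assume "ssyt N (zero_extend a y) \<inter> ssyt N (zero_extend a y') \<noteq> {}"
    then have eq: "zero_extend a y = zero_extend a y'" using ssyt_disjoint by blast
    have "y i = y' i" if "i \<in> {0..<a}" for i
      using fun_cong[OF eq, of i] that by (simp add: zero_extend_def)
    then have "y = y'" using that by (intro PiE_ext[of _ "{0..<a}"]) auto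
    then show False using that by simp
  qed
  have finU: "finite (\<Union>y\<in>?I. ssyt N (zero_extend a y))" using fin IH by blast
  have "real (card (ssyt (Suc N) \<nu>)) = real (card (\<Union>y\<in>?I. ssyt N (zero_extend a y)))"
    using bij_betw_same_card[OF bij] by simp
  also have "\<dots> = (\<Sum>y\<in>?I. real (card (ssyt N (zero_extend a y))))"
    using fin IH disj by (subst card_UN_disjoint) auto
  also have "\<dots> = (\<Sum>y\<in>?I. Det a (\<lambda>i j. csym N (int (y i) - int i + int j)))"
    using IH by (intro sum.cong) auto
  also have "\<dots> = Det a (\<lambda>i j. \<Sum>x\<in>{\<nu> (Suc i)..\<nu> i}. csym N (int x - int i + int j))"
    by (rule Det_row_sum[symmetric]) simp
  also have "\<dots> = Det a (\<lambda>i j. if 0 \<le> i \<and> Suc i < a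
      then csym (Suc N) (int (\<nu> i) - int i + int j) - csym (Suc N) (int (\<nu> (Suc i)) - int (Suc i) + int j)
      else csym (Suc N) (int (\<nu> i) - int i + int j))"
  proof (rule Det_cong)
    fix i j assume ij: "i < a" "j < a"
    \<comment> \<open>After the last row the shape is empty and the degree \<open>j - a\<close> is
      negative, so the last row fits the pattern of differences with 0 as its successor.\<close>
    have last: "csym (Suc N) (int (\<nu> (Suc i)) - int (Suc i) + int j) = 0" if "\<not> Suc i < a"
      using that ij Suc.prems(2)[of "Suc i"] by (intro csym_neg) simp
    have "(\<Sum>x\<in>{\<nu> (Suc i)..\<nu> i}. csym N (int x - int i + int j)) =
        csym (Suc N) (int (\<nu> i) - int i + int j) - csym (Suc N) (int (\<nu> (Suc i)) - int (Suc i) + int j)"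
      using sum_csym[of "\<nu> (Suc i)" "\<nu> i" N "int j - int i"] Suc.prems(1)[of i]
      by (simp add: algebra_simps)
    then show "(\<Sum>x\<in>{\<nu> (Suc i)..\<nu> i}. csym N (int x - int i + int j)) =
      (if 0 \<le> i \<and> Suc i < a
      then csym (Suc N) (int (\<nu> i) - int i + int j) - csym (Suc N) (int (\<nu> (Suc i)) - int (Suc i) + int j)
      else csym (Suc N) (int (\<nu> i) - int i + int j))"
      using last by simp
  qed
  also have "\<dots> = Det a (\<lambda>i j. csym (Suc N) (int (\<nu> i) - int i + int j))"
    by (rule Det_row_diff)
  finally show ?case using bij_betw_finite[OF bij] finU by simp
qed

section \<open>Evaluation of the rectangular Jacobi-Trudi determinant\<close>

lemma Det_scale:
  "Det n (\<lambda>i j. \<alpha> i * \<beta> j * f i j) = (\<Prod>i<n. \<alpha> i) * (\<Prod>i<n. \<beta> i) * Det n f"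
  unfolding Det_leibniz sum_distrib_left
proof (rule sum.cong[OF refl])
  fix p assume "p \<in> {p. p permutes {0..<n}}"
  then have "(\<Prod>i=0..<n. \<beta> (p i)) = (\<Prod>i=0..<n. \<beta> i)"
    using prod.permute[of p "{0..<n}" \<beta>] by (simp add: o_def)
  then show "signof p * (\<Prod>i=0..<n. \<alpha> i * \<beta> (p i) * f i (p i))
      = (\<Prod>i<n. \<alpha> i) * (\<Prod>i<n. \<beta> i) * (signof p * (\<Prod>i=0..<n. f i (p i)))"
    by (simp add: prod.distrib atLeast0LessThan mult_ac)
qed

lemma Det_reverse: "Det n (\<lambda>i j. f (n - 1 - i) (n - 1 - j)) = Det n f"
proof -
  define r where "r = (\<lambda>i. if i < n then n - 1 - i else i)"
  have r: "r permutes {0..<n}"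
    by (rule bij_imp_permutes, rule bij_betw_byWitness[where f'=r]) (auto simp: r_def)
  have "Det n (\<lambda>i j. f (n - 1 - i) (n - 1 - j)) = Det n (\<lambda>i j. f (r i) (r j))"
    by (rule Det_cong) (simp add: r_def)
  also have "\<dots> = signof r * Det n (\<lambda>i j. f i (r j))"
    by (rule Det_permute_rows[OF r, of "\<lambda>i j. f i (r j)"])
  also have "Det n (\<lambda>i j. f i (r j)) = Det n (\<lambda>i j. f j (r i))"
    by (rule Det_transpose[symmetric])
  also have "\<dots> = signof r * Det n (\<lambda>i j. f j i)"
    by (rule Det_permute_rows[OF r, of "\<lambda>i j. f j i"])
  also have "Det n (\<lambda>i j. f j i) = Det n f"
    by (rule Det_transpose)
  finally show ?thesis
    by (simp add: mult.assoc[symmetric] of_int_mult[symmetric] sign_idempotent del: of_int_mult)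
qed

lemma Det_1: "Det (Suc 0) f = f 0 0"
  by (subst Det_upper_triangular) auto

text \<open>This combination of consecutive rows turns column \<open>j + 1\<close> of the binomial
  matrix into a multiple of column \<open>j\<close>, with a factor that splits into a row part and a
  column part. Hence elimination reproduces the same kind of matrix.\<close>

lemma binomial_elimination:
  fixes q s i j :: nat
  defines "x \<equiv> q + s + i"
  shows "real (s + i + 1) * real (Suc x choose (q + Suc j)) - real (q + s + i + 1) * real (x choose (q + Suc j))
    = real (q + s + i + 1) * (real (j + 1) / real (q + j + 1)) * real (x choose (q + j))"
proof -
  let ?c = "real (x choose (q + j))" and ?d = "real (x choose (q + Suc j))"
  have up: "real (Suc (q + j)) * real (Suc x choose Suc (q + j)) = real (Suc x) * ?c"
    using Suc_times_binomial[of "q + j" x] by (metis of_nat_mult)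
  have pascal: "real (Suc x choose Suc (q + j)) = ?c + ?d" by simp
  have "real (Suc (q + j)) * ?d = (real x - real (q + j)) * ?c"
    using up unfolding pascal by (simp add: algebra_simps)
  moreover have "real x - real (q + j) = real s + real i - real j" by (simp add: x_def)
  ultimately have "real (Suc (q + j)) * (real (s + i + 1) * real (Suc x choose Suc (q + j)) - real (q + s + i + 1) * ?d)
      = real (s + i + 1) * (real (Suc x) * ?c) - real (q + s + i + 1) * ((real s + real i - real j) * ?c)"
    using up by (simp only: right_diff_distrib mult.left_commute[of "real (Suc (q + j))"])
  also have "\<dots> = real (q + s + i + 1) * real (j + 1) * ?c"
    by (simp add: x_def algebra_simps)
  finally have "real (Suc (q + j)) * (real (s + i + 1) * real (Suc x choose Suc (q + j)) - real (q + s + i + 1) * ?d)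
      = real (q + s + i + 1) * real (j + 1) * ?c" .
  then show ?thesis by (simp add: field_simps del: binomial_Suc_Suc)
qed

text \<open>Gaussian elimination on the first column: row 0 is kept, and every later row is combined
  with its predecessor. Absorption clears the column below its top entry; the complementary minor is
  the smaller matrix up to scaling.\<close>

lemma Det_binomial_Suc:
  "(\<Prod>i<n. real (s + i + 1)) * Det (Suc n) (\<lambda>i j. real ((q + s + i) choose (q + j)))
    = real ((q + s) choose q) * ((\<Prod>i<n. real (q + s + i + 1)) * (\<Prod>j<n. real (j + 1) / real (q + j + 1))
      * Det n (\<lambda>i j. real ((q + s + i) choose (q + j))))"
proof -
  let ?C = "\<lambda>i j. real ((q + s + i) choose (q + j))"
  let ?L = "\<lambda>i k. if k = i then (if i = 0 then 1 else real (s + i))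
      else if Suc k = i then - real (q + s + i) else 0"
  let ?M = "\<lambda>i j. \<Sum>k<Suc n. ?L i k * ?C k j"
  have M0: "?M 0 j = ?C 0 j" for j
  proof -
    have "?M 0 j = (\<Sum>k<Suc n. if k = 0 then ?C 0 j else 0)"
      by (rule sum.cong) auto
    then show ?thesis by simp
  qed
  have MSuc: "?M (Suc i) j = real (s + i + 1) * ?C (Suc i) j - real (q + s + i + 1) * ?C i j" if "i < n" for i j
  proof -
    have "?M (Suc i) j = (\<Sum>k<Suc n. (if k = Suc i then real (s + i + 1) * ?C (Suc i) j else 0)
        - (if k = i then real (q + s + i + 1) * ?C i j else 0))"
      by (rule sum.cong) (auto simp: algebra_simps)
    then show ?thesis using that by (simp add: sum_subtractf)
  qed
  have "(\<Prod>i<n. real (s + i + 1)) = Det (Suc n) ?L"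
    by (subst Det_lower_triangular) (auto simp: prod.lessThan_Suc_shift simp del: prod.lessThan_Suc)
  then have "(\<Prod>i<n. real (s + i + 1)) * Det (Suc n) ?C = Det (Suc n) ?M"
    by (simp only: Det_mult)
  also have "\<dots> = Det 1 ?M * Det (Suc n - 1) (\<lambda>i j. ?M (1 + i) (1 + j))"
  proof (rule Det_block_lower)
    fix i j :: nat assume "1 \<le> i" "i < Suc n" "j < 1"
    then obtain i' where i': "i = Suc i'" "i' < n" "j = 0" by (cases i) auto
    have "(s + i' + 1) * (Suc (q + s + i') choose q) = (q + s + i' + 1) * ((q + s + i') choose q)"
      using binomial_absorb_comp[of "Suc (q + s + i')" q] by (simp add: Suc_diff_le)
    then have "real (s + i' + 1) * real (Suc (q + s + i') choose q) = real (q + s + i' + 1) * real ((q + s + i') choose q)"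
      by (metis of_nat_mult)
    then show "?M i j = 0" unfolding i' MSuc[OF i'(2)] by simp
  qed simp
  also have "Det 1 ?M = real ((q + s) choose q)"
    by (simp only: One_nat_def Det_1 M0) simp
  also have "Det (Suc n - 1) (\<lambda>i j. ?M (1 + i) (1 + j))
      = Det n (\<lambda>i j. real (q + s + i + 1) * (real (j + 1) / real (q + j + 1)) * ?C i j)"
  proof (simp only: diff_Suc_1, rule Det_cong)
    fix i j assume "i < n"
    from binomial_elimination[of s i q j]
    show "?M (1 + i) (1 + j) = real (q + s + i + 1) * (real (j + 1) / real (q + j + 1)) * ?C i j"
      unfolding plus_1_eq_Suc MSuc[OF \<open>i < n\<close>] by (simp only: add_Suc_right)
  qed
  finally show ?thesis by (simp only: Det_scale)
qed

text \<open>The layer added by \<open>i = n + 1\<close> telescopes in \<open>k\<close> to the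
  product \<open>w n q\<close>, which is compared with the elimination factors by induction on
  \<open>n\<close>. Denominators are cleared throughout.\<close>

lemma MacMahon_box_Suc:
  "MacMahon_box (Suc n) q s * ((\<Prod>i<n. real (s + i + 1)) * (\<Prod>i<n. real (q + i + 1)))
    = MacMahon_box n q s * (real ((q + s) choose q) * ((\<Prod>i<n. real (q + s + i + 1)) * (\<Prod>i<n. real (i + 1))))"
proof -
  have inner: "(\<Prod>k=1..s. (real (Suc n) + real j + real k - 1) / (real (Suc n) + real j + real k - 2))
      = (real n + real j + real s) / (real n + real j)" if "1 \<le> j" for n j
    using that by (induction s) (auto simp: prod.nat_ivl_Suc' field_simps)
  define w where "w = (\<lambda>n q. \<Prod>j=1..q. (real n + real j + real s) / (real n + real j))"
  have w_Suc: "w (Suc n) q = w n q * ((real n + real q + real s + 1) * (real n + 1)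
      / ((real n + real s + 1) * (real n + real q + 1)))" for n q
  proof (induction q)
    case (Suc q)
    have w_step: "w n (Suc q) = w n q * ((real n + real q + real s + 1) / (real n + real q + 1))" for n
      by (simp add: w_def prod.nat_ivl_Suc' add_ac)
    have D: "real (Suc n) + real q + real s + 1 = real n + real (Suc q) + real s + 1"
      "real (Suc n) + real q + 1 = real n + real (Suc q) + 1" by simp_all
    show ?case unfolding w_step Suc D by (simp add: mult_ac)
  qed (simp add: w_def)
  have w_0: "w 0 q = real ((q + s) choose q)"
  proof (induction q)
    case (Suc q)
    have "real (Suc q) * real ((Suc q + s) choose Suc q) = real (Suc q + s) * real ((q + s) choose q)"
      using Suc_times_binomial[of q "q + s"] by (metis add_Suc of_nat_mult)
    then show ?case using Suc by (simp add: w_def prod.nat_ivl_Suc' field_simps del: binomial_Suc_Suc)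
  qed (simp add: w_def)
  have "w n q * ((\<Prod>i<n. real (s + i + 1)) * (\<Prod>i<n. real (q + i + 1)))
      = real ((q + s) choose q) * ((\<Prod>i<n. real (q + s + i + 1)) * (\<Prod>i<n. real (i + 1)))"
  proof (induction n)
    case (Suc n)
    have "w (Suc n) q * (real (s + n + 1) * real (q + n + 1)) = w n q * (real (q + s + n + 1) * real (n + 1))"
    proof -
      have "real (s + n + 1) * real (q + n + 1) = (real n + real s + 1) * (real n + real q + 1)"
        "real (q + s + n + 1) * real (n + 1) = (real n + real q + real s + 1) * (real n + 1)"
        by (simp_all add: algebra_simps)
      moreover have "0 < (real n + real s + 1) * (real n + real q + 1)" by (intro mult_pos_pos) auto
      ultimately show ?thesis by (simp only: w_Suc) simp
    qed
    then have "w (Suc n) q * (real (s + n + 1) * real (q + n + 1)) *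
          ((\<Prod>i<n. real (s + i + 1)) * (\<Prod>i<n. real (q + i + 1)))
        = w n q * ((\<Prod>i<n. real (s + i + 1)) * (\<Prod>i<n. real (q + i + 1))) * (real (q + s + n + 1) * real (n + 1))"
      by (simp only: mult_ac)
    then show ?case unfolding Suc by (simp only: prod.lessThan_Suc mult_ac)
  qed (simp add: w_0)
  moreover have "MacMahon_box (Suc n) q s = MacMahon_box n q s * w n q"
  proof -
    have "(\<Prod>j=1..q. \<Prod>k=1..s. (real (Suc n) + real j + real k - 1) / (real (Suc n) + real j + real k - 2)) = w n q"
      unfolding w_def by (intro prod.cong refl inner) auto
    then show ?thesis unfolding MacMahon_box_def by (simp only: prod.nat_ivl_Suc' mult.commute)
  qed
  ultimately show ?thesis by (simp only: mult.assoc)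
qed

lemma Det_binomial_eq_MacMahon_box:
  "Det n (\<lambda>i j. real ((q + s + i) choose (q + j))) = MacMahon_box n q s"
proof (induction n)
  case 0
  then show ?case by (simp add: MacMahon_box_def)
next
  case (Suc n)
  let ?D = "Det (Suc n) (\<lambda>i j. real ((q + s + i) choose (q + j)))"
  have nz: "(\<Prod>i<n. real (s + i + 1)) \<noteq> 0" "(\<Prod>i<n. real (q + i + 1)) \<noteq> 0" by auto
  have "(\<Prod>j<n. real (j + 1) / real (q + j + 1)) * (\<Prod>i<n. real (q + i + 1)) = (\<Prod>i<n. real (i + 1))"
    by (simp add: prod_dividef del: of_nat_Suc of_nat_add)
  then have "(\<Prod>i<n. real (s + i + 1)) * ?D * (\<Prod>i<n. real (q + i + 1))
    = MacMahon_box n q s * (real ((q + s) choose q) * ((\<Prod>i<n. real (q + s + i + 1)) * (\<Prod>i<n. real (i + 1))))"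
    unfolding Det_binomial_Suc Suc by (simp only: mult_ac flip: \<open>_ = (\<Prod>i<n. real (i + 1))\<close>)
  also have "\<dots> = MacMahon_box (Suc n) q s * ((\<Prod>i<n. real (s + i + 1)) * (\<Prod>i<n. real (q + i + 1)))"
    by (rule MacMahon_box_Suc[symmetric])
  finally show ?case using nz by (simp add: mult_ac del: prod_zero_iff)
qed

text \<open>Vandermonde convolution in \<open>j\<close> splits off a unitriangular matrix of
  binomials. Reversing rows and columns of the other factor gives the binomial matrix evaluated
  before, with \<open>q = N - n\<close>.\<close>

theorem Det_csym_eq_MacMahon_box:
  assumes "n \<le> N"
  shows "Det n (\<lambda>i j. csym N (int s - int i + int j)) = MacMahon_box n (N - n) s"
proof -
  let ?f = "\<lambda>i k. real ((N - 1 + s - i) choose (N - 1 - k))"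
  have "csym N (int s - int i + int j) = (\<Sum>k<n. ?f i k * real (j choose k))" if ij: "i < n" "j < n" for i j
  proof -
    \<comment> \<open>Since \<open>i < n \<le> N\<close>, the natural subtraction loses nothing.
      Negative degrees correspond to an upper index below \<open>N - 1\<close>, where the binomial
      is 0.\<close>
    have "csym N (int s - int i + int j) = real ((N - 1 + s - i + j) choose (N - 1))"
    proof (cases "i \<le> s + j")
      case True
      then obtain l where l: "s + j = i + l" using le_Suc_ex by blast
      then have "int s - int i + int j = int l" "N + l - 1 = N - 1 + l" "N - 1 + s - i + j = N - 1 + l"
        using ij assms by auto
      then show ?thesis using binomial_symmetric[of l "N - 1 + l"] by (simp add: csym_def)
    next
      case False
      then show ?thesis using ij assms by (simp add: csym_def binomial_eq_0)
    qed
    also have "\<dots> = (\<Sum>k\<le>N - 1. real (j choose k) * ?f i k)"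
      using vandermonde[of j "N - 1 + s - i" "N - 1"] by (simp add: add.commute flip: of_nat_mult of_nat_sum)
    also have "\<dots> = (\<Sum>k<n. real (j choose k) * ?f i k)"
      using ij assms by (intro sum.mono_neutral_right) (auto simp: binomial_eq_0)
    finally show ?thesis by (simp add: mult.commute)
  qed
  then have "Det n (\<lambda>i j. csym N (int s - int i + int j)) = Det n (\<lambda>i j. \<Sum>k<n. ?f i k * real (j choose k))"
    by (intro Det_cong)
  also have "\<dots> = Det n ?f * Det n (\<lambda>k j. real (j choose k))"
    by (rule Det_mult[symmetric])
  also have "Det n (\<lambda>k j. real (j choose k)) = 1"
    by (subst Det_upper_triangular) (auto simp: binomial_eq_0)
  also have "Det n ?f = Det n (\<lambda>i j. ?f (n - 1 - i) (n - 1 - j))"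
    by (rule Det_reverse[symmetric])
  also have "\<dots> = Det n (\<lambda>i j. real ((N - n + s + i) choose (N - n + j)))"
    using assms by (intro Det_cong) (auto intro!: arg_cong2[where f="(choose)"])
  finally show ?thesis by (simp add: Det_binomial_eq_MacMahon_box)
qed

lemma MacMahon_box_pos: "0 < MacMahon_box p q r"
  unfolding MacMahon_box_def by (intro prod_pos divide_pos_pos) auto

section \<open>Sums over shapes\<close>

text \<open>Rows are counted from 0. For odd \<open>a\<close> the middle row has length
  \<open>t\<close>, not half of \<open>s + t\<close>: together with its mirror image it leaves
  \<open>s - t\<close> central columns free, and these are the empty cells.\<close>

definition shapes :: "nat \<Rightarrow> nat \<Rightarrow> nat \<Rightarrow> (nat \<Rightarrow> nat) set" where
  "shapes a s t = {\<nu>. (\<forall>i. \<nu> (Suc i) \<le> \<nu> i) \<and> (\<forall>i\<ge>a. \<nu> i = 0) \<and>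
     (\<forall>i < a div 2. \<nu> i + \<nu> (a - 1 - i) = s + t) \<and> (odd a \<longrightarrow> \<nu> (a div 2) = t) \<and>
     (0 < a div 2 \<longrightarrow> s \<le> \<nu> (a div 2 - 1))}"

lemma antimono_Suc:
  fixes \<nu> :: "nat \<Rightarrow> nat"
  assumes "\<And>i. \<nu> (Suc i) \<le> \<nu> i" "i \<le> j"
  shows "\<nu> j \<le> \<nu> i"
  using lift_Suc_antimono_le[of \<nu> i j] assms by blast

lemma strict_dec_int:
  fixes y :: "nat \<Rightarrow> int"
  assumes "strict_dec n y" "i \<le> j" "j < n"
  shows "y j + int j \<le> y i + int i"
  using assms(2,3)
proof (induction j rule: dec_induct)
  case (step k)
  then have "y (Suc k) < y k" using assms(1) by (auto simp: strict_dec_def)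
  then show ?case using step by simp
qed simp

text \<open>The upper half determines the shape, through \<open>y i = \<mu> i - i\<close>. The
  mirror row has index \<open>R - y i\<close>, because the two row lengths add up to
  \<open>s + t\<close> and the two row numbers to \<open>a - 1\<close>. The lower end of the range
  encodes \<open>s \<le> \<mu> (n - 1)\<close>.\<close>

lemma sum_shapes_eq_strict_tuples:
  fixes h h' :: "int \<Rightarrow> 'a::field_char_0"
  assumes "t \<le> s" and n: "n = a div 2" and R: "R = int s + int t - int a + 1"
  shows "(\<Sum>\<mu>\<in>shapes a s t. Det a (\<lambda>i j. (if i < n then h else h') (int (\<mu> i) - int i + int j)))
    = (\<Sum>y\<in>strict_tuples n {int s - int n + 1..int (s + t)}.
        Det a (pair_rows n a (\<lambda>u j. h (u + int j)) (\<lambda>i j. h' (int t - int n + int j))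
          (\<lambda>u j. h' (R - u + int j)) y))"
proof -
  have an: "n \<le> a" "2 * n \<le> a" "a \<le> 2 * n + 1" "odd a \<Longrightarrow> a = 2 * n + 1" "even a \<Longrightarrow> a = 2 * n"
    by (auto simp: n)
  define f where "f = (\<lambda>(\<mu>::nat \<Rightarrow> nat). restrict (\<lambda>i. int (\<mu> i) - int i) {0..<n})"
  define g where "g = (\<lambda>y i. if i < n then nat (y i + int i) else if i < a - n then t
      else if i < a then nat (int (s + t) - (y (a - 1 - i) + int (a - 1 - i))) else 0)"
  have \<mu>: "\<mu> (Suc i) \<le> \<mu> i" "a \<le> i \<Longrightarrow> \<mu> i = 0" "i < n \<Longrightarrow> \<mu> i + \<mu> (a - 1 - i) = s + t"
    "odd a \<Longrightarrow> \<mu> n = t" "0 < n \<Longrightarrow> s \<le> \<mu> (n - 1)" if "\<mu> \<in> shapes a s t" for \<mu> i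
    using that by (auto simp: shapes_def n)
  \<comment> \<open>As \<open>y i + i\<close> decreases weakly, the lower bound at
    \<open>i = n - 1\<close> and the upper bound at \<open>i = 0\<close> control all
    coordinates.\<close>
  have y: "s \<le> y i + int i" "y i + int i \<le> s + t" if "y \<in> strict_tuples n {int s - int n + 1..int (s + t)}" "i < n" for y i
  proof -
    have y: "strict_dec n y" "y i \<in> {int s - int n + 1..int (s + t)}"
      "y 0 \<in> {int s - int n + 1..int (s + t)}" "y (n - 1) \<in> {int s - int n + 1..int (s + t)}"
      using that by (auto simp: strict_tuples_def PiE_iff)
    have "i \<le> n - 1" "n - 1 < n" "int (n - 1) = int n - 1" using that(2) by auto
    then show "s \<le> y i + int i" using strict_dec_int[OF y(1), of i "n - 1"] y(4) that(2) by auto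
    show "y i + int i \<le> s + t" using strict_dec_int[OF y(1), of 0 i] y(3) that(2) by auto
  qed
  have f_in: "f \<mu> \<in> strict_tuples n {int s - int n + 1..int (s + t)}" if m: "\<mu> \<in> shapes a s t" for \<mu>
  proof -
    have le: "\<mu> j \<le> \<mu> i" if "i \<le> j" for i j
      using antimono_Suc[of \<mu> i j] \<mu>(1)[OF m] that by simp
    have "int (\<mu> i) - int i \<in> {int s - int n + 1..int (s + t)}" if "i < n" for i
    proof -
      have "i \<le> n - 1" "0 < n" using that by auto
      then have "s \<le> \<mu> i" using le[of i "n - 1"] \<mu>(5)[OF m] by linarith
      then show ?thesis using \<mu>(3)[OF m that] that by auto
    qed
    moreover have "strict_dec n (f \<mu>)"
      unfolding strict_dec_def
    proof (intro allI impI)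
      fix i j assume "i < j" "j < n"
      then show "f \<mu> j < f \<mu> i" using le[of i j] by (simp add: f_def)
    qed
    ultimately show ?thesis by (auto simp: f_def strict_tuples_def)
  qed
  have g_in: "g y \<in> shapes a s t" if S: "y \<in> strict_tuples n {int s - int n + 1..int (s + t)}" for y
  proof -
    have sd: "strict_dec n y" using S by (simp add: strict_tuples_def)
    have "g y (Suc i) \<le> g y i" for i
    proof -
      consider "Suc i < n" | "Suc i = n" | "n \<le> i" "Suc i < a - n" | "i = n" "i < a - n" "a - n \<le> Suc i" "Suc i < a"
        | "a - n \<le> i" "Suc i < a" | "a \<le> Suc i" using an by linarith
      then show ?thesis
      proof cases
        case 1
        then show ?thesis using strict_dec_int[OF sd, of i "Suc i"] by (simp add: g_def nat_mono)
      next
        case 2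
        show ?thesis
        proof (cases "n < a - n")
          case True
          then show ?thesis using 2 y(1)[OF S, of i] \<open>t \<le> s\<close> by (simp add: g_def)
        next
          case False
          then have "a - 1 - n = i" "n < a" using 2 an by auto
          then show ?thesis using False 2 y(1)[OF S, of i] \<open>t \<le> s\<close> an by (simp add: g_def)
        qed
      next
        case 3
        then show ?thesis using an by simp
      next
        case 4
        then have "a - 1 - Suc i < n" using an by auto
        then show ?thesis using 4 y(1)[OF S, of "a - 1 - Suc i"] an by (simp add: g_def)
      next
        case 5
        then have "a - 1 - Suc i < n" "a - 1 - i < n" "a - 1 - Suc i \<le> a - 1 - i" using an by auto
        then show ?thesis using 5 strict_dec_int[OF sd, of "a - 1 - Suc i" "a - 1 - i"] an by (simp add: g_def nat_mono)
      qed (use an in \<open>simp add: g_def\<close>)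
    qed
    moreover have "g y i + g y (a - 1 - i) = s + t" if "i < n" for i
    proof -
      have "a - 1 - (a - 1 - i) = i" "\<not> a - 1 - i < n" "\<not> a - 1 - i < a - n" "a - 1 - i < a" using that an by auto
      then have "g y (a - 1 - i) = nat (int (s + t) - (y i + int i))" by (simp add: g_def)
      moreover have "g y i = nat (y i + int i)" using that by (simp add: g_def)
      ultimately show ?thesis using y[OF S that] by linarith
    qed
    moreover have "odd a \<Longrightarrow> g y n = t" using an by (simp add: g_def)
    moreover have "s \<le> g y (n - 1)" if "0 < n" using y(1)[OF S, of "n - 1"] that by (simp add: g_def)
    moreover have "g y i = 0" if "a \<le> i" for i using that an by (simp add: g_def)
    ultimately show ?thesis by (simp add: shapes_def n[symmetric])
  qed
  have gf: "g (f \<mu>) = \<mu>" if m: "\<mu> \<in> shapes a s t" for \<mu>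
  proof
    fix i
    consider "i < n" | "n \<le> i" "i < a - n" | "a - n \<le> i" "i < a" | "a \<le> i" using an by linarith
    then show "g (f \<mu>) i = \<mu> i"
    proof cases
      case 2
      then have "odd a" "i = n" using an by (auto intro: ccontr)
      then show ?thesis using 2 \<mu>(4)[OF m] by (simp add: g_def)
    next
      case 3
      then have r: "a - 1 - i < n" "a - 1 - (a - 1 - i) = i" using an by auto
      then have "g (f \<mu>) i = nat (int (s + t) - int (\<mu> (a - 1 - i)))"
        using 3 an by (simp add: g_def f_def)
      moreover have "\<mu> (a - 1 - i) + \<mu> i = s + t" using \<mu>(3)[OF m r(1)] r(2) by simp
      ultimately show ?thesis by linarith
    qed (use \<mu>(2)[OF m] an in \<open>auto simp: g_def f_def\<close>)
  qed
  have fg: "f (g y) = y" if S: "y \<in> strict_tuples n {int s - int n + 1..int (s + t)}" for y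
  proof
    fix i
    show "f (g y) i = y i"
    proof (cases "i < n")
      case True
      then show ?thesis using y(1)[OF S True] by (simp add: f_def g_def)
    next
      case False
      moreover have "y \<in> {0..<n} \<rightarrow>\<^sub>E {int s - int n + 1..int (s + t)}" using S by (simp add: strict_tuples_def)
      ultimately show ?thesis using PiE_arb[of y "{0..<n}" _ i] by (simp add: f_def)
    qed
  qed
  have det: "Det a (\<lambda>i j. (if i < n then h else h') (int (\<mu> i) - int i + int j)) =
      Det a (pair_rows n a (\<lambda>u j. h (u + int j)) (\<lambda>i j. h' (int t - int n + int j))
          (\<lambda>u j. h' (R - u + int j)) (f \<mu>))" if m: "\<mu> \<in> shapes a s t" for \<mu>
  proof (rule Det_cong)
    fix i j assume i: "i < a"
    consider "i < n" | "n \<le> i" "i < a - n" | "a - n \<le> i" "i < a" using i by linarith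
    then show "(if i < n then h else h') (int (\<mu> i) - int i + int j) =
       pair_rows n a (\<lambda>u j. h (u + int j)) (\<lambda>i j. h' (int t - int n + int j)) (\<lambda>u j. h' (R - u + int j)) (f \<mu>) i j"
    proof cases
      case 2
      then have "odd a" "i = n" using an by (auto intro: ccontr)
      then show ?thesis using 2 \<mu>(4)[OF m] by (simp add: pair_rows_def)
    next
      case 3
      then have "a - 1 - i < n" "a - 1 - (a - 1 - i) = i" using an by auto
      then have "int (\<mu> i) - int i = R - f \<mu> (a - 1 - i)"
        using 3 \<mu>(3)[OF m, of "a - 1 - i"] by (simp add: R f_def of_nat_diff)
      moreover have "\<not> i < n" "\<not> i < a - n" using 3 an by auto
      ultimately show ?thesis by (simp add: pair_rows_def)
    qed (simp add: pair_rows_def f_def)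
  qed
  show ?thesis
    by (rule sum.reindex_bij_witness[where i=g and j=f]) (simp_all only: f_in g_in fg gf det)
qed

theorem sum_shapes:
  assumes "t \<le> s" and n: "n = a div 2" and "n \<le> N" "a - n \<le> N'"
  shows "(\<Sum>\<mu>\<in>shapes a s t. Det a (\<lambda>i j. csym (if i < n then N else N') (int (\<mu> i) - int i + int j)))
    = MacMahon_box n (N - n) s * MacMahon_box (a - n) (N' - (a - n)) t"
proof -
  define R U where "R = int s + int t - int a + 1" and "U = int s + int t + 4 * int a + 4"
  let ?D = "\<lambda>y. Det a (pair_rows n a (\<lambda>u j. csym N (u + int j)) (\<lambda>i j. csym N' (int t - int n + int j))
          (\<lambda>u j. csym N' (R - u + int j)) y)"
  have an: "n \<le> a - n" "a - n \<le> Suc n" "a = n + (a - n)" by (auto simp: n)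
  have nz: "Det (a - n) (\<lambda>i j. csym N' (int t - int i + int j)) \<noteq> 0"
    using Det_csym_eq_MacMahon_box[OF assms(4), of t] MacMahon_box_pos[of "a - n" "N' - (a - n)" t] by simp
  \<comment> \<open>A tuple with an entry above \<open>s + t\<close> comes from no shape, but it
    contributes 0: all degrees in its last row are negative. So the range may be extended to the
    large \<open>U\<close> on which the telescoping relies.\<close>
  have vanish: "?D y = 0" if y: "y \<in> strict_tuples n {int s - int n + 1..U}"
    "y \<notin> strict_tuples n {int s - int n + 1..int (s + t)}" for y
  proof -
    have sd: "strict_dec n y" using y by (simp add: strict_tuples_def)
    obtain i where i: "i < n" "int (s + t) < y i"
      using y by (auto simp: strict_tuples_def PiE_iff not_le)
    then have "int (s + t) < y 0" using sd by (cases "i = 0") (auto simp: strict_dec_def intro: less_trans)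
    then show ?thesis using i an
      by (intro Det_zero_row[of "a - 1"]) (auto simp: pair_rows_def R_def of_nat_diff intro!: csym_neg)
  qed
  have "(\<Sum>\<mu>\<in>shapes a s t. Det a (\<lambda>i j. csym (if i < n then N else N') (int (\<mu> i) - int i + int j)))
      = (\<Sum>\<mu>\<in>shapes a s t. Det a (\<lambda>i j. (if i < n then csym N else csym N') (int (\<mu> i) - int i + int j)))"
    by (intro sum.cong refl Det_cong) auto
  also have "\<dots> = (\<Sum>y\<in>strict_tuples n {int s - int n + 1..int (s + t)}. ?D y)"
    by (rule sum_shapes_eq_strict_tuples) (use assms R_def in auto)
  also have "\<dots> = (\<Sum>y\<in>strict_tuples n {int s - int n + 1..U}. ?D y)"
  proof (rule sum.mono_neutral_left)
    show "finite (strict_tuples n {int s - int n + 1..U})"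
      by (simp add: strict_tuples_def finite_PiE)
    show "strict_tuples n {int s - int n + 1..int (s + t)} \<subseteq> strict_tuples n {int s - int n + 1..U}"
      by (auto simp: strict_tuples_def U_def PiE_iff intro: order_trans)
  qed (use vanish in auto)
  also have "\<dots> = Det n (\<lambda>i j. csym N (int s - int i + int j)) * Det (a - n) (\<lambda>i j. csym N' (int t - int i + int j))"
    by (rule sum_strict_tuples_Toeplitz[OF an R_def _ _ csym_neg nz]) (auto simp: U_def)
  finally show ?thesis
    using assms by (simp add: Det_csym_eq_MacMahon_box)
qed

lemma finite_shapes: "finite (shapes a s t)"
proof -
  have "shapes a s t \<subseteq> zero_extend a ` ({0..<a} \<rightarrow>\<^sub>E {0..s + t})"
  proof
    fix \<nu> assume \<nu>: "\<nu> \<in> shapes a s t"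
    have "\<nu> i \<le> s + t" for i
    proof (cases "a = 0")
      case False
      have "\<nu> 0 \<le> s + t"
      proof (cases "a div 2")
        case 0
        then have "a = 1" using False by auto
        then show ?thesis using \<nu> by (simp add: shapes_def)
      next
        case (Suc k)
        then have "\<nu> 0 + \<nu> (a - 1 - 0) = s + t" using \<nu> by (auto simp: shapes_def simp del: diff_zero)
        then show ?thesis by simp
      qed
      then show ?thesis using antimono_Suc[of \<nu> 0 i] \<nu> by (auto simp: shapes_def intro: order_trans)
    qed (use \<nu> in \<open>simp add: shapes_def\<close>)
    then have "restrict \<nu> {0..<a} \<in> {0..<a} \<rightarrow>\<^sub>E {0..s + t}" by auto
    moreover have "\<nu> = zero_extend a (restrict \<nu> {0..<a})"
      using \<nu> by (auto simp: zero_extend_def shapes_def fun_eq_iff)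
    ultimately show "\<nu> \<in> zero_extend a ` ({0..<a} \<rightarrow>\<^sub>E {0..s + t})" by blast
  qed
  then show ?thesis by (rule finite_subset) (simp add: finite_PiE)
qed

lemma card_UN_ssyt:
  assumes "finite \<Lambda>" "\<And>\<nu> i. \<nu> \<in> \<Lambda> \<Longrightarrow> \<nu> (Suc i) \<le> \<nu> i" "\<And>\<nu> i. \<nu> \<in> \<Lambda> \<Longrightarrow> a \<le> i \<Longrightarrow> \<nu> i = 0"
  shows "real (card (\<Union>\<nu>\<in>\<Lambda>. ssyt N \<nu>)) = (\<Sum>\<nu>\<in>\<Lambda>. Det a (\<lambda>i j. csym N (int (\<nu> i) - int i + int j)))"
proof -
  have "finite (ssyt N \<nu>) \<and> real (card (ssyt N \<nu>)) = Det a (\<lambda>i j. csym N (int (\<nu> i) - int i + int j))"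
    if "\<nu> \<in> \<Lambda>" for \<nu> using assms(2,3)[OF that] by (intro card_ssyt) auto
  note card = this
  have "card (\<Union>\<nu>\<in>\<Lambda>. ssyt N \<nu>) = (\<Sum>\<nu>\<in>\<Lambda>. card (ssyt N \<nu>))"
    using assms(1) card by (intro card_UN_disjoint) (auto dest: ssyt_disjoint)
  then show ?thesis using card by simp
qed

theorem card_UN_ssyt_shapes:
  assumes "t \<le> s" "a - a div 2 \<le> N"
  shows "real (card (\<Union>\<nu>\<in>shapes a s t. ssyt N \<nu>))
    = MacMahon_box (a div 2) (N - a div 2) s * MacMahon_box (a - a div 2) (N - (a - a div 2)) t"
proof -
  have "real (card (\<Union>\<nu>\<in>shapes a s t. ssyt N \<nu>))
      = (\<Sum>\<nu>\<in>shapes a s t. Det a (\<lambda>i j. csym N (int (\<nu> i) - int i + int j)))"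
    by (rule card_UN_ssyt[OF finite_shapes]) (auto simp: shapes_def)
  then show ?thesis
    using sum_shapes[OF assms(1) refl _ assms(2), of N] assms(2) by simp
qed

text \<open>
  Shapes that arise when \<open>a\<close> is odd and \<open>b\<close> is even: here \<open>\<nu>\<close> is not determined by its upper
  half, but it interlaces with its own complement.
\<close>

definition interlacing_shapes :: "nat \<Rightarrow> nat \<Rightarrow> nat \<Rightarrow> (nat \<Rightarrow> nat) set" where
  "interlacing_shapes a s t = {\<nu>. (\<forall>i. \<nu> (Suc i) \<le> \<nu> i) \<and> (\<forall>i\<ge>a. \<nu> i = 0) \<and>
     (\<forall>i<a. \<nu> i + \<nu> (a - 1 - i) \<le> s + t) \<and> (\<forall>i. Suc i < a \<longrightarrow> s + t \<le> \<nu> i + \<nu> (a - 2 - i)) \<and>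
     \<nu> (a div 2) \<le> t}"

definition lower_shapes :: "nat \<Rightarrow> (nat \<Rightarrow> nat) \<Rightarrow> (nat \<Rightarrow> nat) set" where
  "lower_shapes a \<mu> = PiE {0..<a} (\<lambda>i. if i < a div 2 then {\<mu> i} else {\<mu> (Suc i)..\<mu> i})"

text \<open>A shape \<nu> splits into the shape \<mu> with the same upper half and the lower rows of
  \<nu>. With \<open>\<mu> i = s + t - \<nu> (a - 1 - i)\<close> below the middle and
  \<open>\<mu> n = t\<close>, the inequalities between \<nu> and its complement say that these lower
  rows interlace \<mu>.\<close>

lemma sum_interlacing_shapes:
  assumes "odd a" "t \<le> s"
  shows "(\<Sum>\<nu>\<in>interlacing_shapes a s t. f \<nu>)
    = (\<Sum>\<mu>\<in>shapes a s t. \<Sum>x\<in>lower_shapes a \<mu>. f (zero_extend a x) :: 'a::comm_monoid_add)"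
proof -
  define n where "n = a div 2"
  have an: "a = 2 * n + 1" using assms(1) by (auto simp: n_def)
  define e where "e = (\<lambda>\<nu> i. if i < n then \<nu> i else if i = n then t else if i < a then s + t - \<nu> (a - 1 - i) else 0)"
  have mem: "x i \<in> (if i < n then {\<mu> i} else {\<mu> (Suc i)..\<mu> i})" if "x \<in> lower_shapes a \<mu>" "i < a" for x \<mu> i
  proof -
    have "x \<in> PiE {0..<a} (\<lambda>i. if i < n then {\<mu> i} else {\<mu> (Suc i)..\<mu> i})"
      using that(1) by (simp only: lower_shapes_def n_def)
    then show ?thesis by (rule PiE_mem) (use that(2) in simp)
  qed
  have S: "x i = \<mu> i" if "x \<in> lower_shapes a \<mu>" "i < n" for x \<mu> i
    using mem[OF that(1), of i] that an by simp
  have S': "\<mu> (Suc i) \<le> x i \<and> x i \<le> \<mu> i" if "x \<in> lower_shapes a \<mu>" "n \<le> i" "i < a" for x \<mu> i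
    using mem[OF that(1), of i] that by simp
  have mirror: "a - 1 - i = 2 * n - i" "a - 2 - i = 2 * n - 1 - i" for i using an by auto
  have M: "\<mu> (Suc i) \<le> \<mu> i" "a \<le> i \<Longrightarrow> \<mu> i = 0" "i < n \<Longrightarrow> \<mu> i + \<mu> (2 * n - i) = s + t"
    "\<mu> n = t" if "\<mu> \<in> shapes a s t" for \<mu> i
    using that assms(1) unfolding shapes_def n_def[symmetric] mirror by blast+
  have into: "zero_extend a x \<in> interlacing_shapes a s t" if \<mu>: "\<mu> \<in> shapes a s t" and x: "x \<in> lower_shapes a \<mu>" for \<mu> x
  proof -
    have le: "zero_extend a x i \<le> \<mu> i" for i
      using S[OF x, of i] S'[OF x, of i] by (cases "i < n") (auto simp: zero_extend_def)
    have ge: "\<mu> (Suc i) \<le> zero_extend a x i" for i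
      using S[OF x, of i] S'[OF x, of i] M(1,2)[OF \<mu>, of i] M(2)[OF \<mu>, of "Suc i"] an
      by (cases "i < n") (auto simp: zero_extend_def)
    have up: "zero_extend a x i = \<mu> i" if "i < n" for i
      using S[OF x that] that an by (simp add: zero_extend_def)
    have sum_le: "zero_extend a x i + zero_extend a x (2 * n - i) \<le> s + t" if "i \<le> n" for i
      using le[of i] le[of "2 * n - i"] M(3,4)[OF \<mu>] that assms(2) by (cases "i < n") fastforce+
    have sum_ge: "s + t \<le> zero_extend a x i + zero_extend a x (2 * n - 1 - i)" if "i < n" for i
    proof -
      have "Suc (2 * n - 1 - i) = 2 * n - i" using that by simp
      then show ?thesis using ge[of "2 * n - 1 - i"] up[OF that] M(3)[OF \<mu> that] by simp
    qed
    have "zero_extend a x i + zero_extend a x (a - 1 - i) \<le> s + t" if "i < a" for i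
    proof (cases "i \<le> n")
      case True
      then show ?thesis using sum_le[of i] an by simp
    next
      case False
      then have "2 * n - i \<le> n" "2 * n - (2 * n - i) = i" using that an by auto
      then show ?thesis using sum_le[of "2 * n - i"] an by (simp add: add.commute)
    qed
    moreover have "s + t \<le> zero_extend a x i + zero_extend a x (a - 2 - i)" if "Suc i < a" for i
    proof (cases "i < n")
      case True
      then show ?thesis using sum_ge[of i] an by (simp add: numeral_2_eq_2)
    next
      case False
      then have "2 * n - 1 - i < n" "2 * n - 1 - (2 * n - 1 - i) = i" "a - 2 - i = 2 * n - 1 - i"
        using that an by auto
      then show ?thesis using sum_ge[of "2 * n - 1 - i"] by (simp add: add.commute)
    qed
    moreover have "zero_extend a x (Suc i) \<le> zero_extend a x i" for i
      using le[of "Suc i"] ge[of i] by simp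
    ultimately show ?thesis
      using le[of n] M(4)[OF \<mu>] by (simp add: interlacing_shapes_def zero_extend_def n_def[symmetric])
  qed
  have \<nu>: "\<nu> (Suc i) \<le> \<nu> i" "a \<le> i \<Longrightarrow> \<nu> i = 0" "i < a \<Longrightarrow> \<nu> i + \<nu> (2 * n - i) \<le> s + t"
    "Suc i < a \<Longrightarrow> s + t \<le> \<nu> i + \<nu> (2 * n - 1 - i)" "\<nu> n \<le> t" if "\<nu> \<in> interlacing_shapes a s t" for \<nu> i
    using that unfolding interlacing_shapes_def n_def[symmetric] mirror by blast+
  \<comment> \<open>The middle-line bound for \<mu> is implied: the interlacing inequality at row
    \<open>n - 1\<close> and \<open>\<nu> n \<le> t\<close> give
    \<open>s \<le> \<nu> (n - 1)\<close>.\<close>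
  have up: "s \<le> \<nu> i" if N: "\<nu> \<in> interlacing_shapes a s t" and "i < n" for \<nu> i
  proof -
    have "2 * n - 1 - (n - 1) = n" using that by simp
    then have "s \<le> \<nu> (n - 1)" using \<nu>(4)[OF N, of "n - 1"] \<nu>(5)[OF N] an that by simp
    also have "\<nu> (n - 1) \<le> \<nu> i" using antimono_Suc[of \<nu> i "n - 1"] \<nu>(1)[OF N] that by simp
    finally show ?thesis .
  qed
  have e_in: "e \<nu> \<in> shapes a s t" if N: "\<nu> \<in> interlacing_shapes a s t" for \<nu>
  proof -
    have "e \<nu> (Suc i) \<le> e \<nu> i" for i
    proof -
      consider "Suc i < n" | "Suc i = n" | "i = n" | "n < i" by linarith
      then show ?thesis
      proof cases
        case 1
        then show ?thesis using \<nu>(1)[OF N] by (simp add: e_def)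
      next
        case 2
        then show ?thesis using up[OF N, of i] assms(2) by (simp add: e_def)
      next
        case 3
        show ?thesis
        proof (cases "n = 0")
          case False
          then show ?thesis using 3 up[OF N, of "n - 1"] an by (simp add: e_def)
        qed (simp add: e_def 3 an)
      next
        case 4
        show ?thesis
        proof (cases "Suc i < a")
          case True
          then have "Suc (2 * n - Suc i) = 2 * n - i" using an by simp
          then show ?thesis using 4 True \<nu>(1)[OF N, of "2 * n - Suc i"] an by (simp add: e_def)
        qed (use 4 in \<open>simp add: e_def\<close>)
      qed
    qed
    moreover have "e \<nu> i + e \<nu> (a - 1 - i) = s + t" if "i < n" for i
    proof -
      have "\<not> a - 1 - i < n" "a - 1 - i \<noteq> n" "a - 1 - i < a" "a - 1 - (a - 1 - i) = i" "i < a"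
        using that an by auto
      moreover from this have "e \<nu> (a - 1 - i) = s + t - \<nu> i" by (simp only: e_def if_True if_False)
      moreover have "e \<nu> i = \<nu> i" using that by (simp add: e_def)
      ultimately show ?thesis using \<nu>(3)[OF N, of i] by simp
    qed
    moreover have "e \<nu> i = 0" if "a \<le> i" for i using that an by (simp add: e_def)
    moreover have "e \<nu> n = t" by (simp add: e_def)
    moreover have "s \<le> e \<nu> (n - 1)" if "0 < n" using up[OF N, of "n - 1"] that by (simp add: e_def)
    ultimately show ?thesis unfolding shapes_def n_def[symmetric] by blast
  qed
  have restr_in: "restrict \<nu> {0..<a} \<in> lower_shapes a (e \<nu>)" if N: "\<nu> \<in> interlacing_shapes a s t" for \<nu>
    unfolding lower_shapes_def n_def[symmetric]
  proof (rule PiE_I)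
    fix i assume "i \<in> {0..<a}"
    then have i: "i < a" by simp
    have "e \<nu> (Suc i) \<le> \<nu> i \<and> \<nu> i \<le> e \<nu> i" if "n \<le> i"
    proof
      show "\<nu> i \<le> e \<nu> i" using that i \<nu>(3)[OF N i] \<nu>(5)[OF N] an by (auto simp: e_def)
      show "e \<nu> (Suc i) \<le> \<nu> i"
      proof (cases "Suc i < a")
        case True
        then show ?thesis using that \<nu>(4)[OF N True] an by (simp add: e_def)
      qed (use that in \<open>simp add: e_def\<close>)
    qed
    then show "restrict \<nu> {0..<a} i \<in> (if i < n then {e \<nu> i} else {e \<nu> (Suc i)..e \<nu> i})"
      using i by (auto simp: e_def)
  qed simp
  have e_zero: "e (zero_extend a x) = \<mu>" if m: "\<mu> \<in> shapes a s t" and x: "x \<in> lower_shapes a \<mu>" for \<mu> x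
  proof
    fix i
    consider "i < n" | "i = n" | "n < i" "i < a" | "a \<le> i" by linarith
    then show "e (zero_extend a x) i = \<mu> i"
    proof cases
      case 1
      then show ?thesis using S[OF x 1] an by (simp add: e_def zero_extend_def)
    next
      case 3
      then have i: "2 * n - i < n" "2 * n - (2 * n - i) = i" using an by auto
      then show ?thesis using 3 S[OF x i(1)] M(3)[OF m i(1)] an by (simp add: e_def zero_extend_def)
    qed (use M[OF m] an in \<open>auto simp: e_def\<close>)
  qed
  have zero_restr: "zero_extend a (restrict \<nu> {0..<a}) = \<nu>" if "\<nu> \<in> interlacing_shapes a s t" for \<nu>
    using \<nu>(2)[OF that] by (auto simp: zero_extend_def fun_eq_iff)
  have restr_zero: "restrict (zero_extend a x) {0..<a} = x" if "x \<in> lower_shapes a \<mu>" for x \<mu>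
  proof
    fix i show "restrict (zero_extend a x) {0..<a} i = x i"
      using that PiE_arb[of x "{0..<a}" _ i] by (cases "i < a") (auto simp: zero_extend_def lower_shapes_def)
  qed
  have "(\<Sum>\<mu>\<in>shapes a s t. \<Sum>x\<in>lower_shapes a \<mu>. f (zero_extend a x))
      = (\<Sum>(\<mu>, x)\<in>Sigma (shapes a s t) (lower_shapes a). f (zero_extend a x))"
    by (rule sum.Sigma) (auto simp: finite_shapes lower_shapes_def intro!: finite_PiE)
  also have "\<dots> = (\<Sum>\<nu>\<in>interlacing_shapes a s t. f \<nu>)"
    by (rule sum.reindex_bij_witness[where i="\<lambda>\<nu>. (e \<nu>, restrict \<nu> {0..<a})" and j="\<lambda>(\<mu>, x). zero_extend a x"])
      (auto simp: into e_in restr_in e_zero restr_zero zero_restr)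
  finally show ?thesis by simp
qed

lemma finite_interlacing_shapes: "finite (interlacing_shapes a s t)"
proof -
  have "interlacing_shapes a s t \<subseteq> zero_extend a ` ({0..<a} \<rightarrow>\<^sub>E {0..s + t})"
  proof
    fix \<nu> assume \<nu>: "\<nu> \<in> interlacing_shapes a s t"
    have "\<nu> i \<le> s + t" if "i < a" for i
    proof -
      have "\<nu> i + \<nu> (a - 1 - i) \<le> s + t" using \<nu> that unfolding interlacing_shapes_def by blast
      then show ?thesis by simp
    qed
    then have "restrict \<nu> {0..<a} \<in> {0..<a} \<rightarrow>\<^sub>E {0..s + t}" by auto
    moreover have "\<nu> = zero_extend a (restrict \<nu> {0..<a})"
      using \<nu> by (auto simp: zero_extend_def interlacing_shapes_def fun_eq_iff)
    ultimately show "\<nu> \<in> zero_extend a ` ({0..<a} \<rightarrow>\<^sub>E {0..s + t})" by blast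
  qed
  then show ?thesis by (rule finite_subset) (simp add: finite_PiE)
qed

text \<open>Summing over the lower rows is one step of the Jacobi-Trudi induction restricted to the
  rows from \<open>n\<close> on. It raises their number of variables to \<open>Suc N\<close>, which
  is why \<open>sum_shapes\<close> admits two different numbers.\<close>

theorem card_UN_ssyt_interlacing_shapes:
  assumes "odd a" "t \<le> s" "a div 2 \<le> N"
  shows "real (card (\<Union>\<nu>\<in>interlacing_shapes a s t. ssyt N \<nu>))
    = MacMahon_box (a div 2) (N - a div 2) s * MacMahon_box (a - a div 2) (Suc N - (a - a div 2)) t"
proof -
  define n where "n = a div 2"
  have "(\<Sum>x\<in>lower_shapes a \<mu>. Det a (\<lambda>i j. csym N (int (zero_extend a x i) - int i + int j)))
      = Det a (\<lambda>i j. csym (if i < n then N else Suc N) (int (\<mu> i) - int i + int j))"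
    if \<mu>: "\<mu> \<in> shapes a s t" for \<mu>
  proof -
    let ?S = "\<lambda>i. if i < n then {\<mu> i} else {\<mu> (Suc i)..\<mu> i}"
    let ?f = "\<lambda>i j. csym (if i < n then N else Suc N) (int (\<mu> i) - int i + int j)"
    have "(\<Sum>x\<in>lower_shapes a \<mu>. Det a (\<lambda>i j. csym N (int (zero_extend a x i) - int i + int j)))
        = (\<Sum>x\<in>PiE {0..<a} ?S. Det a (\<lambda>i j. csym N (int (x i) - int i + int j)))"
      unfolding lower_shapes_def n_def by (intro sum.cong refl Det_cong) (simp add: zero_extend_def)
    also have "\<dots> = Det a (\<lambda>i j. \<Sum>x\<in>?S i. csym N (int x - int i + int j))"
      by (rule Det_row_sum[symmetric]) auto
    also have "\<dots> = Det a (\<lambda>i j. if n \<le> i \<and> Suc i < a then ?f i j - ?f (Suc i) j else ?f i j)"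
    proof (rule Det_cong)
      fix i j assume ij: "i < a" "j < a"
      have "csym (Suc N) (int (\<mu> (Suc i)) - int (Suc i) + int j) = 0" if "\<not> Suc i < a"
        using that ij \<mu> by (intro csym_neg) (simp add: shapes_def)
      moreover have "(\<Sum>x\<in>{\<mu> (Suc i)..\<mu> i}. csym N (int x - int i + int j)) =
          csym (Suc N) (int (\<mu> i) - int i + int j) - csym (Suc N) (int (\<mu> (Suc i)) - int (Suc i) + int j)"
        using sum_csym[of "\<mu> (Suc i)" "\<mu> i" N "int j - int i"] \<mu>
        by (simp add: algebra_simps shapes_def le_SucI)
      ultimately show "(\<Sum>x\<in>?S i. csym N (int x - int i + int j))
          = (if n \<le> i \<and> Suc i < a then ?f i j - ?f (Suc i) j else ?f i j)"
        by (cases "i < n") auto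
    qed
    also have "\<dots> = Det a ?f" by (rule Det_row_diff)
    finally show ?thesis .
  qed
  then have "(\<Sum>\<nu>\<in>interlacing_shapes a s t. Det a (\<lambda>i j. csym N (int (\<nu> i) - int i + int j)))
      = (\<Sum>\<mu>\<in>shapes a s t. Det a (\<lambda>i j. csym (if i < n then N else Suc N) (int (\<mu> i) - int i + int j)))"
    by (simp add: sum_interlacing_shapes[OF assms(1,2)])
  also have "\<dots> = MacMahon_box n (N - n) s * MacMahon_box (a - n) (Suc N - (a - n)) t"
    using assms by (intro sum_shapes) (auto simp: n_def elim!: oddE)
  finally show ?thesis
    by (subst card_UN_ssyt[where a=a])
      (auto simp: finite_interlacing_shapes n_def interlacing_shapes_def[THEN eqset_imp_iff])
qed

text \<open>The shape records where \<open>B\<close> is positive. Monotonicity is asked for only at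
  positive entries, because the arrays in question carry the filler 0 on cells outside the
  region.\<close>

lemma ssyt_of_int_array:
  fixes B :: "nat \<Rightarrow> nat \<Rightarrow> int"
  assumes supp: "\<And>i j. 0 < B i j \<Longrightarrow> i < a \<and> j < m"
    and rows: "\<And>i j. 0 < B i (Suc j) \<Longrightarrow> B i (Suc j) \<le> B i j"
    and cols: "\<And>i j. 0 < B (Suc i) j \<Longrightarrow> B (Suc i) j < B i j"
    and bound: "\<And>i j. B i j \<le> int N"
  obtains \<nu> where "(\<lambda>i j. nat (B i j)) \<in> ssyt N \<nu>" "\<And>i j. j < \<nu> i \<longleftrightarrow> 0 < B i j"
    "\<And>i. \<nu> (Suc i) \<le> \<nu> i" "\<And>i. a \<le> i \<Longrightarrow> \<nu> i = 0" "\<And>i. \<nu> i \<le> m"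
proof -
  define \<nu> where "\<nu> = (\<lambda>i. LEAST j. B i j \<le> 0)"
  have ex: "B i m \<le> 0" for i using supp[of i m] by (cases "0 < B i m") auto
  have end0: "B i (\<nu> i) \<le> 0" for i unfolding \<nu>_def by (rule LeastI[of _ m]) (rule ex)
  have after: "B i j \<le> 0" if "\<nu> i \<le> j" for i j
    using that
  proof (induction j rule: dec_induct)
    case (step j)
    then show ?case using rows[of i j] by linarith
  qed (rule end0)
  have pos: "j < \<nu> i \<longleftrightarrow> 0 < B i j" for i j
    using not_less_Least[of j "\<lambda>j. B i j \<le> 0"] after[of i j] unfolding \<nu>_def by (metis linorder_not_le)
  have "\<nu> (Suc i) \<le> \<nu> i" for i
    using pos[of "\<nu> i" "Suc i"] cols[of i "\<nu> i"] end0[of i] by linarith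
  moreover have "\<nu> i = 0" if "a \<le> i" for i
    using pos[of 0 i] supp[of i 0] that by auto
  moreover have "\<nu> i \<le> m" for i
    unfolding \<nu>_def by (rule Least_le) (rule ex)
  moreover have "(\<lambda>i j. nat (B i j)) \<in> ssyt N \<nu>"
    unfolding ssyt_def mem_Collect_eq
  proof (intro conjI allI impI)
    fix i j
    show "0 < nat (B i j) \<longleftrightarrow> j < \<nu> i" by (simp add: pos)
    show "nat (B i j) \<le> N" using bound[of i j] by simp
    show "nat (B i (Suc j)) \<le> nat (B i j)" using rows[of i j] by linarith
    assume "0 < nat (B (Suc i) j)"
    then show "nat (B (Suc i) j) < nat (B i j)" using cols[of i j] by simp
  qed
  ultimately show ?thesis using that pos by blast
qed

lemma sum_eq_if_complementary:
  assumes "x \<le> m" "y \<le> m" "\<And>j. j < m \<Longrightarrow> j < x \<longleftrightarrow> \<not> m - 1 - j < y"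
  shows "x + y = (m::nat)"
proof (rule antisym)
  show "m \<le> x + y" using assms(1) assms(3)[of x] by (cases "x = m") auto
  show "x + y \<le> m"
  proof (cases "x = 0")
    case False
    then have "\<not> m - 1 - (x - 1) < y" using assms(1) assms(3)[of "x - 1"] by simp
    then show ?thesis using False assms(1) by simp
  qed (use assms(2) in simp)
qed

section \<open>Self-complementary arrays and tableaux\<close>

text \<open>
  Rows and columns are counted from 0 here. Subtracting \<open>i - c\<close> from row \<open>i\<close> turns a self-complementary
  array into an integer array \<open>excess A\<close> with strictly decreasing columns in which opposite entries
  sum to \<open>\<epsilon>\<close>; its positive part is a tableau that determines the array.
\<close>

locale self_complementary =
  fixes a b m :: nat and ok :: "nat \<Rightarrow> nat \<Rightarrow> bool" and c \<epsilon> :: int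
  assumes ok_bound: "ok i j \<Longrightarrow> i < a \<and> j < m"
    and ok_opp: "ok i j \<Longrightarrow> ok (a - 1 - i) (m - 1 - j)"
    and eps: "\<epsilon> = 0 \<or> \<epsilon> = 1"
    and c: "2 * c = int a - int b - 1 + \<epsilon>"
begin

definition region :: "(nat \<times> nat) set" where
  "region = {(Suc i, Suc j) | i j. ok i j}"

definition excess :: "(nat \<times> nat \<Rightarrow> nat) \<Rightarrow> nat \<Rightarrow> nat \<Rightarrow> int" where
  "excess A i j = int (A (Suc i, Suc j)) - int i + c"

definition tab :: "(nat \<times> nat \<Rightarrow> nat) \<Rightarrow> nat \<Rightarrow> nat \<Rightarrow> nat" where
  "tab A i j = (if ok i j then nat (excess A i j) else 0)"

text \<open>Recovers all of \<open>excess\<close> from its positive part, since opposite entries sum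
  to \<epsilon>. For \<epsilon> = 0 two opposite zeros give 0 again.\<close>

definition full :: "(nat \<Rightarrow> nat \<Rightarrow> nat) \<Rightarrow> nat \<Rightarrow> nat \<Rightarrow> int" where
  "full T i j = (if 0 < T i j then int (T i j) else \<epsilon> - int (T (a - 1 - i) (m - 1 - j)))"

definition arr :: "(nat \<Rightarrow> nat \<Rightarrow> nat) \<Rightarrow> nat \<times> nat \<Rightarrow> nat" where
  "arr T = restrict (\<lambda>(x, y). nat (int (x - 1) - c + full T (x - 1) (y - 1))) region"

lemma in_region [simp]: "(Suc i, Suc j) \<in> region \<longleftrightarrow> ok i j"
  by (auto simp: region_def)

lemma regionE:
  assumes "p \<in> region"
  obtains i j where "p = (Suc i, Suc j)" "ok i j"
  using assms by (auto simp: region_def)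

lemma opp_opp: "ok i j \<Longrightarrow> a - 1 - (a - 1 - i) = i \<and> m - 1 - (m - 1 - j) = j"
  using ok_bound[of i j] by auto

lemma sc_fillings_iff:
  "A \<in> sc_fillings a b m region \<longleftrightarrow> A \<in> region \<rightarrow>\<^sub>E {0..b} \<and>
     (\<forall>i j. ok i j \<longrightarrow> ok i (Suc j) \<longrightarrow> A (Suc i, Suc (Suc j)) \<le> A (Suc i, Suc j)) \<and>
     (\<forall>i j. ok i j \<longrightarrow> ok (Suc i) j \<longrightarrow> A (Suc (Suc i), Suc j) \<le> A (Suc i, Suc j)) \<and>
     (\<forall>i j. ok i j \<longrightarrow> A (Suc i, Suc j) + A (Suc (a - 1 - i), Suc (m - 1 - j)) = b)"
proof -
  have Sucs: "(x, y) \<in> region \<longleftrightarrow> 0 < x \<and> 0 < y \<and> ok (x - 1) (y - 1)" for x y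
    by (cases x; cases y) (auto simp: region_def)
  have opp: "a - i = Suc (a - 1 - i)" "m - j = Suc (m - 1 - j)" if "ok i j" for i j
    using ok_bound[OF that] by auto
  have "weakly_decreasing region A \<longleftrightarrow>
     (\<forall>i j. ok i j \<longrightarrow> ok i (Suc j) \<longrightarrow> A (Suc i, Suc (Suc j)) \<le> A (Suc i, Suc j)) \<and>
     (\<forall>i j. ok i j \<longrightarrow> ok (Suc i) j \<longrightarrow> A (Suc (Suc i), Suc j) \<le> A (Suc i, Suc j))"
    unfolding weakly_decreasing_def
  proof (intro arg_cong2[where f="(\<and>)"] iffI allI impI)
    fix x y assume *: "\<forall>i j. ok i j \<longrightarrow> ok i (Suc j) \<longrightarrow> A (Suc i, Suc (Suc j)) \<le> A (Suc i, Suc j)"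
      and "(x, y) \<in> region" "(x, y + 1) \<in> region"
    then show "A (x, y + 1) \<le> A (x, y)" by (cases x; cases y) (auto simp: Sucs)
  next
    fix x y assume *: "\<forall>i j. ok i j \<longrightarrow> ok (Suc i) j \<longrightarrow> A (Suc (Suc i), Suc j) \<le> A (Suc i, Suc j)"
      and "(x, y) \<in> region" "(x + 1, y) \<in> region"
    then show "A (x + 1, y) \<le> A (x, y)" by (cases x; cases y) (auto simp: Sucs)
  next
    fix i j assume "\<forall>x y. (x, y) \<in> region \<longrightarrow> (x, y + 1) \<in> region \<longrightarrow> A (x, y + 1) \<le> A (x, y)"
      "ok i j" "ok i (Suc j)"
    then show "A (Suc i, Suc (Suc j)) \<le> A (Suc i, Suc j)"
      by (metis Suc_eq_plus1 in_region)
  next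
    fix i j assume "\<forall>x y. (x, y) \<in> region \<longrightarrow> (x + 1, y) \<in> region \<longrightarrow> A (x + 1, y) \<le> A (x, y)"
      "ok i j" "ok (Suc i) j"
    then show "A (Suc (Suc i), Suc j) \<le> A (Suc i, Suc j)"
      by (metis Suc_eq_plus1 in_region)
  qed
  moreover have "(\<forall>(i, j) \<in> region. A (i, j) + A (a + 1 - i, m + 1 - j) = b) \<longleftrightarrow>
     (\<forall>i j. ok i j \<longrightarrow> A (Suc i, Suc j) + A (Suc (a - 1 - i), Suc (m - 1 - j)) = b)"
  proof (intro iffI allI impI ballI)
    fix i j assume *: "\<forall>(i, j) \<in> region. A (i, j) + A (a + 1 - i, m + 1 - j) = b" and ij: "ok i j"
    from bspec[OF *, of "(Suc i, Suc j)"] ij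
    show "A (Suc i, Suc j) + A (Suc (a - 1 - i), Suc (m - 1 - j)) = b"
      unfolding opp[OF ij, symmetric] by simp
  next
    fix p assume *: "\<forall>i j. ok i j \<longrightarrow> A (Suc i, Suc j) + A (Suc (a - 1 - i), Suc (m - 1 - j)) = b"
      and "p \<in> region"
    then obtain i j where p: "p = (Suc i, Suc j)" and ij: "ok i j" by (blast elim: regionE)
    have "A (Suc i, Suc j) + A (Suc (a - 1 - i), Suc (m - 1 - j)) = b" using * ij by blast
    then show "case p of (i, j) \<Rightarrow> A (i, j) + A (a + 1 - i, m + 1 - j) = b"
      unfolding opp[OF ij, symmetric] p by simp
  qed
  ultimately show ?thesis by (simp only: sc_fillings_def mem_Collect_eq conj_assoc)
qed

text \<open>The constant is \<open>b - (a - 1) + 2 * c\<close>. Parity fixes it: \<epsilon> = 1 if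
  \<open>a\<close> and \<open>b\<close> have equal parity, and then exactly one of two opposite
  entries is positive; otherwise \<epsilon> = 0, and both may vanish.\<close>

lemma excess_opp:
  assumes "A \<in> sc_fillings a b m region" "ok i j"
  shows "excess A i j + excess A (a - 1 - i) (m - 1 - j) = \<epsilon>"
proof -
  have "A (Suc i, Suc j) + A (Suc (a - 1 - i), Suc (m - 1 - j)) = b"
    using assms by (simp add: sc_fillings_iff)
  then show ?thesis
    using ok_bound[OF assms(2)] c by (simp add: excess_def of_nat_diff)
qed

lemma excess_le:
  assumes "A \<in> sc_fillings a b m region" "ok i j"
  shows "excess A i j \<le> int b + c"
proof -
  have "A (Suc i, Suc j) \<in> {0..b}"
    using assms by (intro PiE_mem[of A region]) (simp_all add: sc_fillings_iff)
  then show ?thesis by (simp add: excess_def)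
qed

lemma arr_tab:
  assumes A: "A \<in> sc_fillings a b m region"
  shows "arr (tab A) = A"
proof
  fix p
  show "arr (tab A) p = A p"
  proof (cases "p \<in> region")
    case True
    then obtain i j where p: "p = (Suc i, Suc j)" "ok i j" by (rule regionE)
    have "full (tab A) i j = excess A i j"
      using excess_opp[OF A p(2)] ok_opp[OF p(2)] p(2) eps by (auto simp: full_def tab_def)
    then show ?thesis using p by (simp add: arr_def excess_def)
  next
    case False
    moreover have "A \<in> region \<rightarrow>\<^sub>E {0..b}" using A by (simp add: sc_fillings_iff)
    ultimately show ?thesis using PiE_arb[of A region _ p] by (simp add: arr_def)
  qed
qed

lemma arr_in_sc_fillings:
  assumes disj: "\<And>i j. ok i j \<Longrightarrow> 0 < T i j \<Longrightarrow> T (a - 1 - i) (m - 1 - j) = 0"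
    and exh: "\<And>i j. ok i j \<Longrightarrow> \<epsilon> = 1 \<Longrightarrow> 0 < T i j \<or> 0 < T (a - 1 - i) (m - 1 - j)"
    and supp: "\<And>i j. \<not> ok i j \<Longrightarrow> T i j = 0"
    and rows: "\<And>i j. T i (Suc j) \<le> T i j"
    and cols: "\<And>i j. ok i j \<Longrightarrow> ok (Suc i) j \<Longrightarrow> full T (Suc i) j < full T i j"
    and bound: "\<And>i j. ok i j \<Longrightarrow> int i + full T i j \<le> int b + c"
  shows "arr T \<in> sc_fillings a b m region" "tab (arr T) = T"
    "\<And>i j. ok i j \<Longrightarrow> excess (arr T) i j = full T i j"
proof -
  have opp: "full T i j + full T (a - 1 - i) (m - 1 - j) = \<epsilon>" if "ok i j" for i j
    using disj[OF that] exh[OF that] opp_opp[OF that] eps by (auto simp: full_def)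
  have val: "int (arr T (Suc i, Suc j)) = int i - c + full T i j" if "ok i j" for i j
  proof -
    \<comment> \<open>Non-negativity of an entry is the upper bound at the opposite cell.\<close>
    have "0 \<le> int i - c + full T i j"
      using bound[OF ok_opp[OF that]] opp[OF that] ok_bound[OF that] c by (simp add: of_nat_diff)
    then show ?thesis using that by (simp add: arr_def)
  qed
  show excess: "excess (arr T) i j = full T i j" if "ok i j" for i j
    using val[OF that] by (simp add: excess_def)
  have rows': "full T i (Suc j) \<le> full T i j" if ij: "ok i j" "ok i (Suc j)" for i j
  proof -
    have "m - 1 - j = Suc (m - 1 - Suc j)" using ok_bound[OF ij(2)] by (simp add: Suc_diff_Suc)
    then have "T (a - 1 - i) (m - 1 - j) \<le> T (a - 1 - i) (m - 1 - Suc j)"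
      using rows[of "a - 1 - i" "m - 1 - Suc j"] by simp
    then show ?thesis using rows[of i j] exh[OF ij(2)] eps by (auto simp: full_def)
  qed
  have "arr T \<in> region \<rightarrow>\<^sub>E {0..b}"
  proof (rule PiE_I)
    fix p assume "p \<in> region"
    then obtain i j where p: "p = (Suc i, Suc j)" "ok i j" by (rule regionE)
    then show "arr T p \<in> {0..b}" using val[OF p(2)] bound[OF p(2)] by simp
  qed (simp add: arr_def)
  moreover have "arr T (Suc i, Suc j) + arr T (Suc (a - 1 - i), Suc (m - 1 - j)) = b" if "ok i j" for i j
    using val[OF that] val[OF ok_opp[OF that]] opp[OF that] ok_bound[OF that] c by (simp add: of_nat_diff)
  ultimately show "arr T \<in> sc_fillings a b m region"
    unfolding sc_fillings_iff
  proof (intro conjI allI impI)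
    fix i j
    assume ij: "ok i j"
    show "arr T (Suc i, Suc (Suc j)) \<le> arr T (Suc i, Suc j)" if "ok i (Suc j)"
      using val[OF ij] val[OF that] rows'[OF ij that] by linarith
    show "arr T (Suc (Suc i), Suc j) \<le> arr T (Suc i, Suc j)" if "ok (Suc i) j"
      using val[OF ij] val[OF that] cols[OF ij that] by simp
  qed
  show "tab (arr T) = T"
  proof (intro ext)
    fix i j
    show "tab (arr T) i j = T i j"
      using excess[of i j] exh[of i j] supp[of i j] eps by (cases "ok i j") (auto simp: tab_def full_def)
  qed
qed

lemma card_eq_tableaux:
  assumes "\<A> \<subseteq> sc_fillings a b m region"
    and "\<And>A. A \<in> \<A> \<Longrightarrow> tab A \<in> \<T>"
    and "\<And>T. T \<in> \<T> \<Longrightarrow> arr T \<in> \<A>" "\<And>T. T \<in> \<T> \<Longrightarrow> tab (arr T) = T"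
  shows "card \<A> = card \<T>"
  by (rule bij_betw_same_card[of tab], rule bij_betw_byWitness[where f'=arr])
    (use assms arr_tab in auto)

end

text \<open>The side conditions prescribe signs of \<open>excess\<close> around the middle line.
  With \<open>c = n - b div 2\<close> and rows counted from 1, it is positive in row
  \<open>n\<close> exactly for entries at least \<open>b div 2\<close>, positive in row
  \<open>n + 1\<close> exactly from \<open>b div 2 + 1\<close> on, and non-positive in row
  \<open>n + 2\<close> exactly up to \<open>b div 2 + 1\<close>. The bound on tableau entries is
  \<open>b + c = (a + b) div 2\<close>.\<close>

theorem card_fillings_same_parity:
  fixes a b s t :: nat
  defines "n \<equiv> a div 2" and "m \<equiv> s + t"
    and "E \<equiv> (if odd a then empty_cells a (2 * s) (2 * t) else {})"
  assumes a: "0 < a" and b: "0 < b" and par: "even a \<longleftrightarrow> even b" and ts: "t \<le> s"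
  shows "card {A \<in> sc_fillings a b m (cells a m - E).
      (odd a \<longrightarrow> (\<forall>j. t \<le> j \<and> j < s \<longrightarrow> (0 < n \<longrightarrow> b div 2 \<le> A (n, Suc j)) \<and>
          (n + 2 \<le> a \<longrightarrow> A (n + 2, Suc j) \<le> b div 2 + 1)) \<and> (0 < t \<longrightarrow> b div 2 + 1 \<le> A (n + 1, t))) \<and>
      (even a \<longrightarrow> 0 < s \<longrightarrow> b div 2 \<le> A (n, s))}
    = card (\<Union>\<nu>\<in>shapes a s t. ssyt ((a + b) div 2) \<nu>)"
    (is "card ?\<A> = card ?\<T>")
proof -
  define ok where "ok = (\<lambda>i j. i < a \<and> j < m \<and> \<not> (odd a \<and> i = n \<and> t \<le> j \<and> j < s))"
  define c where "c = int n - int (b div 2)"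
  define N where "N = (a + b) div 2"
  have an: "odd a \<Longrightarrow> a = 2 * n + 1" "even a \<Longrightarrow> a = 2 * n" "2 * n \<le> a" "a \<le> 2 * n + 1"
    by (auto simp: n_def)
  have ok_iff: "ok i j \<longleftrightarrow> i < a \<and> j < m \<and> \<not> (odd a \<and> i = n \<and> t \<le> j \<and> j < s)" for i j
    by (simp add: ok_def)
  have c_val: "int n - int (b div 2) = c" by (simp add: c_def)
  have c2: "2 * c = int a - int b - 1 + 1"
    using par by (cases "even a") (auto simp: c_def n_def elim!: evenE oddE)
  have cN: "int b + c = int N"
    using par by (cases "even a") (auto simp: c_def n_def N_def elim!: evenE oddE)
  have N: "n < N" "0 < N" using par a b by (auto simp: N_def n_def elim!: evenE oddE)
  interpret self_complementary a b m ok c 1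
    by unfold_locales (use c2 in \<open>auto simp: ok_def m_def n_def elim!: oddE\<close>)
  have region: "cells a m - E = region"
  proof (intro equalityI subsetI)
    fix p assume p: "p \<in> cells a m - E"
    then obtain i j where ij: "p = (Suc i, Suc j)" "i < a" "j < m"
      by (auto simp: cells_def) (metis Suc_le_D Suc_le_lessD)
    then have "ok i j" using p an by (auto simp: ok_iff E_def empty_cells_def split: if_splits)
    then show "p \<in> region" by (simp add: ij)
  next
    fix p assume "p \<in> region"
    then obtain i j where ij: "p = (Suc i, Suc j)" "ok i j" by (rule regionE)
    then show "p \<in> cells a m - E" using an by (auto simp: cells_def ok_iff E_def empty_cells_def)
  qed
  have sh: "\<mu> (Suc i) \<le> \<mu> i" "a \<le> i \<Longrightarrow> \<mu> i = 0" "i < n \<Longrightarrow> \<mu> i + \<mu> (a - 1 - i) = m"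
    "odd a \<Longrightarrow> \<mu> n = t" "0 < n \<Longrightarrow> s \<le> \<mu> (n - 1)" if "\<mu> \<in> shapes a s t" for \<mu> i
    using that unfolding shapes_def n_def m_def by blast+
  have ok_rows: "ok i j" if "i < a" "j < m" "i \<noteq> n \<or> even a" for i j
    using that by (auto simp: ok_iff)

  have forward: "tab A \<in> ?\<T>" if "A \<in> ?\<A>" for A
  proof -
    have A: "A \<in> sc_fillings a b m region"
      and odd1: "\<And>j. odd a \<Longrightarrow> t \<le> j \<Longrightarrow> j < s \<Longrightarrow> 0 < n \<Longrightarrow> b div 2 \<le> A (n, Suc j)"
      and odd2: "\<And>j. odd a \<Longrightarrow> t \<le> j \<Longrightarrow> j < s \<Longrightarrow> n + 2 \<le> a \<Longrightarrow> A (n + 2, Suc j) \<le> b div 2 + 1"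
      and odd3: "odd a \<Longrightarrow> 0 < t \<Longrightarrow> b div 2 + 1 \<le> A (n + 1, t)"
      and even1: "even a \<Longrightarrow> 0 < s \<Longrightarrow> b div 2 \<le> A (n, s)"
      using that unfolding region by auto
    define B where "B = (\<lambda>i j. if ok i j then excess A i j else 0)"
    have B_opp: "B i j + B (a - 1 - i) (m - 1 - j) = 1" if "ok i j" for i j
      using excess_opp[OF A that] ok_opp[OF that] that by (simp add: B_def)
    have B_left: "0 < B n (t - 1)" if "odd a" "0 < t"
    proof -
      have "ok n (t - 1)" using that a ts an by (auto simp: ok_iff m_def)
      then show ?thesis using c_val odd3[OF that] that by (simp add: B_def excess_def)
    qed
    \<comment> \<open>With columns counted from 0, column \<open>s\<close> is opposite to column
      \<open>t - 1\<close>, where the excess is positive; the columns further right follow by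
      monotonicity. For \<open>t = 0\<close> the whole middle row is empty.\<close>
    have B_right: "B n j \<le> 0" if "odd a" "t \<le> j" for j
    proof -
      have *: "B n s \<le> 0"
      proof (cases "0 < t")
        case True
        then have "ok n s" "a - 1 - n = n" "m - 1 - s = t - 1" using that a an by (auto simp: ok_iff m_def)
        then show ?thesis using B_opp[of n s] B_left[OF that(1) True] by simp
      qed (simp add: B_def ok_iff m_def)
      show ?thesis
      proof (cases "j < s")
        case True
        then show ?thesis using that by (simp add: B_def ok_iff)
      next
        case False
        then have "s \<le> j" by simp
        then show ?thesis
        proof (induction j rule: dec_induct)
          case (step j)
          show ?case
          proof (cases "ok n (Suc j)")
            case True
            then have "ok n j" using step.hyps by (auto simp: ok_iff)
            then have "A (Suc n, Suc (Suc j)) \<le> A (Suc n, Suc j)" using A True by (simp add: sc_fillings_iff)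
            then show ?thesis using step True \<open>ok n j\<close> by (simp add: B_def excess_def)
          qed (simp add: B_def)
        qed (rule *)
      qed
    qed
    obtain \<nu> where \<nu>: "(\<lambda>i j. nat (B i j)) \<in> ssyt N \<nu>" "\<And>i j. j < \<nu> i \<longleftrightarrow> 0 < B i j"
      "\<And>i. \<nu> (Suc i) \<le> \<nu> i" "\<And>i. a \<le> i \<Longrightarrow> \<nu> i = 0" "\<And>i. \<nu> i \<le> m"
    proof (rule ssyt_of_int_array[of B a m N])
      fix i j
      show "i < a \<and> j < m" if "0 < B i j" using that by (auto simp: B_def ok_iff split: if_splits)
      show "B i j \<le> int N" using excess_le[OF A, of i j] cN by (simp add: B_def)
      show "B i (Suc j) \<le> B i j" if pos: "0 < B i (Suc j)"
      proof -
        have 1: "ok i (Suc j)" using pos by (auto simp: B_def split: if_splits)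
        have "ok i j"
        proof (rule ccontr)
          assume "\<not> ok i j"
          then have "odd a" "i = n" "t \<le> j" using 1 by (auto simp: ok_iff)
          then show False using B_right[of "Suc j"] pos by simp
        qed
        then show ?thesis using 1 A by (simp add: B_def excess_def sc_fillings_iff)
      qed
      show "B (Suc i) j < B i j" if pos: "0 < B (Suc i) j"
      proof -
        have 1: "ok (Suc i) j" using pos by (auto simp: B_def split: if_splits)
        \<comment> \<open>Below an empty cell the excess is non-positive, by the condition on row
          \<open>n + 2\<close>.\<close>
        have "ok i j"
        proof (rule ccontr)
          assume "\<not> ok i j"
          then have g: "odd a" "i = n" "t \<le> j" "j < s" "n + 2 \<le> a" using 1 by (auto simp: ok_iff)
          then show False using c_val odd2[of j] pos 1 by (simp add: B_def excess_def)
        qed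
        then have "A (Suc (Suc i), Suc j) \<le> A (Suc i, Suc j)" using 1 A by (simp add: sc_fillings_iff)
        then show ?thesis using 1 \<open>ok i j\<close> by (simp add: B_def excess_def)
      qed
    qed auto
    have "\<nu> i + \<nu> (a - 1 - i) = m" if "i < n" for i
    proof (rule sum_eq_if_complementary)
      fix j assume "j < m"
      then have "ok i j" using that an by (intro ok_rows) auto
      from B_opp[OF this] show "j < \<nu> i \<longleftrightarrow> \<not> m - 1 - j < \<nu> (a - 1 - i)" unfolding \<nu>(2) by linarith
    qed (rule \<nu>(5))+
    moreover have mid: "\<nu> n = t" if "odd a"
    proof (rule antisym)
      show "\<nu> n \<le> t" using \<nu>(2)[of t n] B_right[OF that, of t] by linarith
      show "t \<le> \<nu> n" using \<nu>(2)[of "t - 1" n] B_left[OF that] by (cases "0 < t") auto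
    qed
    moreover have "s \<le> \<nu> (n - 1)" if "0 < n"
    proof (cases "odd a")
      case True
      show ?thesis
      proof (cases "s = t")
        case True
        then show ?thesis using \<nu>(3)[of "n - 1"] mid[OF \<open>odd a\<close>] that by simp
      next
        case False
        have "ok (n - 1) (s - 1)" using that False ts by (intro ok_rows) (auto simp: n_def m_def)
        moreover have "t \<le> s - 1" "s - 1 < s" using False ts by auto
        ultimately have "0 < B (n - 1) (s - 1)"
          using c_val odd1[OF \<open>odd a\<close>, of "s - 1"] that by (simp add: B_def excess_def of_nat_diff)
        then show ?thesis unfolding \<nu>(2)[symmetric] by simp
      qed
    next
      case False
      show ?thesis
      proof (cases "s = 0")
        case False
        have "ok (n - 1) (s - 1)" using that False ts by (intro ok_rows) (auto simp: n_def m_def)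
        then have "0 < B (n - 1) (s - 1)"
          using c_val even1 \<open>\<not> odd a\<close> that False by (simp add: B_def excess_def of_nat_diff)
        then show ?thesis unfolding \<nu>(2)[symmetric] by simp
      qed simp
    qed
    ultimately have "\<nu> \<in> shapes a s t" using \<nu>(3,4) unfolding shapes_def n_def m_def by blast
    moreover have "tab A = (\<lambda>i j. nat (B i j))" by (auto simp: fun_eq_iff tab_def B_def)
    ultimately show ?thesis using \<nu>(1) unfolding N_def by auto
  qed

  have backward: "arr T \<in> ?\<A> \<and> tab (arr T) = T" if "T \<in> ?\<T>" for T
  proof -
    from that obtain \<mu> where \<mu>: "\<mu> \<in> shapes a s t" and T: "T \<in> ssyt N \<mu>" unfolding N_def by auto
    have pos: "0 < T i j \<longleftrightarrow> j < \<mu> i" and le: "T i j \<le> N" and rows: "T i (Suc j) \<le> T i j"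
      and strict: "0 < T (Suc i) j \<Longrightarrow> T (Suc i) j < T i j" for i j
      using T by (simp_all add: ssyt_def)
    have \<mu>_sum: "\<mu> i + \<mu> (a - 1 - i) = m" if "i < a" "i \<noteq> n \<or> even a" for i
    proof (cases "i < n")
      case False
      have "a - 1 - i < n"
      proof (cases "even a")
        case True
        then show ?thesis using False that(1) an(2) by linarith
      next
        case odd: False
        then have "n < i" using False that(2) by simp
        then show ?thesis using that(1) an(1)[OF odd] by linarith
      qed
      moreover have "a - 1 - (a - 1 - i) = i" using that(1) by simp
      ultimately show ?thesis using sh(3)[OF \<mu>, of "a - 1 - i"] by simp
    qed (rule sh(3)[OF \<mu>])
    have opp: "0 < T i j \<longleftrightarrow> \<not> 0 < T (a - 1 - i) (m - 1 - j)" if "ok i j" for i j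
    proof (cases "odd a \<and> i = n")
      case True
      then have "a - 1 - i = n" using an by simp
      then show ?thesis using True that sh(4)[OF \<mu>] ts unfolding pos by (auto simp: ok_iff m_def)
    next
      case False
      then show ?thesis using \<mu>_sum[of i] that unfolding pos by (auto simp: ok_iff)
    qed
    have supp: "T i j = 0" if "\<not> ok i j" for i j
    proof -
      have "\<mu> i \<le> j"
      proof (cases "i < a \<and> j < m")
        case True
        then show ?thesis using that sh(4)[OF \<mu>] by (auto simp: ok_iff)
      next
        case False
        have "\<mu> i \<le> m" if "i < a" using \<mu>_sum[OF that] sh(4)[OF \<mu>] by (cases "i \<noteq> n \<or> even a") (auto simp: m_def)
        then show ?thesis using False sh(2)[OF \<mu>, of i] by (cases "i < a") auto
      qed
      then show ?thesis using pos[of i j] by simp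
    qed
    have below: "full T (Suc n) j \<le> 0" if g: "odd a" "t \<le> j" "j < s" "ok (Suc n) j" for j
    proof -
      have "\<mu> (Suc n) \<le> t" using sh(1)[OF \<mu>, of n] sh(4)[OF \<mu>] g by simp
      then have "T (Suc n) j = 0" using pos[of "Suc n" j] g by simp
      then show ?thesis using opp[OF g(4)] by (simp add: full_def)
    qed
    have cols: "full T (Suc i) j < full T i j" if ij: "ok i j" "ok (Suc i) j" for i j
    proof -
      have "Suc (a - 1 - Suc i) = a - 1 - i" using ok_bound[OF ij(2)] by (simp add: Suc_diff_Suc)
      then have "0 < T (a - 1 - i) (m - 1 - j) \<Longrightarrow> T (a - 1 - i) (m - 1 - j) < T (a - 1 - Suc i) (m - 1 - j)"
        using strict[of "a - 1 - Suc i"] by simp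
      then show ?thesis using strict[of i j] opp[OF ij(1)] opp[OF ij(2)] by (auto simp: full_def)
    qed
    have bound: "int i + full T i j \<le> int b + c" if "ok i j" for i j
      using that
    proof (induction i)
      case 0
      then show ?case using le[of 0 j] cN N by (simp add: full_def)
    next
      case (Suc i)
      show ?case
      proof (cases "ok i j")
        case True
        then show ?thesis using Suc.IH cols[OF True Suc.prems] by simp
      next
        case False
        \<comment> \<open>An empty cell interrupts the descent along the column. Below it
          \<open>full T\<close> is at most 0, and the row number \<open>n + 1\<close> is at most
          \<open>N\<close> because \<open>b\<close> is positive.\<close>
        then have g: "odd a" "i = n" "t \<le> j" "j < s" using Suc.prems by (auto simp: ok_iff)
        then show ?thesis using below[of j] Suc.prems N cN by simp
      qed
    qed
    have disj: "T (a - 1 - i) (m - 1 - j) = 0" if "ok i j" "0 < T i j" for i j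
      using opp[OF that(1)] that(2) by simp
    have exh: "0 < T i j \<or> 0 < T (a - 1 - i) (m - 1 - j)" if "ok i j" "(1::int) = 1" for i j
      using opp[OF that(1)] by blast
    have arr_sc: "arr T \<in> sc_fillings a b m region"
      by (rule arr_in_sc_fillings(1)) (((rule disj exh supp cols bound, (assumption | rule refl)+) | rule rows)+)
    have tab_arr: "tab (arr T) = T"
      by (rule arr_in_sc_fillings(2)) (((rule disj exh supp cols bound, (assumption | rule refl)+) | rule rows)+)
    have sc_excess: "excess (arr T) i j = full T i j" if "ok i j" for i j
      by (rule arr_in_sc_fillings(3)[OF _ _ _ _ _ _ that]) (((rule disj exh supp cols bound, (assumption | rule refl)+) | rule rows)+)
    have val: "int (arr T (Suc i, Suc j)) = int i - c + full T i j" if "ok i j" for i j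
      using sc_excess[OF that] by (simp add: excess_def)
    have above: "b div 2 \<le> arr T (n, Suc j)" if "0 < n" "j < s" for j
    proof -
      have k: "ok (n - 1) j" using that by (intro ok_rows) (auto simp: n_def m_def)
      have "0 < T (n - 1) j" using pos[of "n - 1" j] sh(5)[OF \<mu> that(1)] that by simp
      then show ?thesis using c_val val[OF k] that by (simp add: full_def of_nat_diff)
    qed
    have "arr T (n + 2, Suc j) \<le> b div 2 + 1" if "odd a" "t \<le> j" "j < s" "n + 2 \<le> a" for j
    proof -
      have k: "ok (Suc n) j" using that by (intro ok_rows) (auto simp: m_def)
      show ?thesis using c_val val[OF k] below[OF that(1-3) k] by simp
    qed
    moreover have "b div 2 + 1 \<le> arr T (n + 1, t)" if "odd a" "0 < t"
    proof -
      have k: "ok n (t - 1)" using that a ts an by (auto simp: ok_iff m_def)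
      have "0 < T n (t - 1)" using pos[of n "t - 1"] sh(4)[OF \<mu>] that by simp
      then show ?thesis using c_val val[OF k] that by (simp add: full_def)
    qed
    moreover have "b div 2 \<le> arr T (n, s)" if "even a" "0 < s"
      using above[of "s - 1"] that a an by simp
    ultimately show ?thesis using arr_sc tab_arr above unfolding region by auto
  qed

  show ?thesis
    by (rule card_eq_tableaux) (use forward backward region in auto)
qed

text \<open>Here opposite entries of \<open>excess\<close> are negatives of each other. They are not
  both positive, which bounds the sum of opposite row lengths from above. By column strictness, the
  entry just above the opposite of a non-positive entry is positive, which gives the interlacing
  inequality. In the middle row the excess is \<open>A - b div 2\<close>, so it vanishes on the
  middle line.\<close>

theorem card_arrays_odd_even:
  fixes a b s t :: nat
  defines "n \<equiv> a div 2" and "m \<equiv> s + t"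
  assumes a: "odd a" and b: "even b" and ts: "t \<le> s"
  shows "card {A \<in> sc_arrays a b m. \<forall>j. t < j \<and> j \<le> s \<longrightarrow> A (n + 1, j) = b div 2}
    = card (\<Union>\<nu>\<in>interlacing_shapes a s t. ssyt (n + b div 2) \<nu>)"
    (is "card ?\<A> = card ?\<T>")
proof -
  define ok where "ok = (\<lambda>i j. i < a \<and> j < m)"
  define c where "c = int n - int (b div 2)"
  define N where "N = n + b div 2"
  have an: "a = 2 * n + 1" using a by (auto simp: n_def)
  have bb: "b = 2 * (b div 2)" using b by simp
  have ok_iff: "ok i j \<longleftrightarrow> i < a \<and> j < m" for i j by (simp add: ok_def)
  have c_val: "int n - int (b div 2) = c" by (simp add: c_def)
  have c2: "2 * c = int a - int b - 1 + 0" using an bb by (simp add: c_def)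
  have cN: "int b + c = int N" using bb by (simp add: c_def N_def)
  interpret self_complementary a b m ok c 0
    by unfold_locales (use c2 in \<open>auto simp: ok_def\<close>)
  have region: "cells a m = region"
  proof (intro equalityI subsetI)
    fix p assume "p \<in> cells a m"
    then obtain i j where "p = (Suc i, Suc j)" "i < a" "j < m"
      by (auto simp: cells_def) (metis Suc_le_D Suc_le_lessD)
    then show "p \<in> region" by (simp add: ok_iff)
  next
    fix p assume "p \<in> region"
    then show "p \<in> cells a m" by (auto simp: cells_def ok_iff elim!: regionE)
  qed
  have sh: "\<mu> (Suc i) \<le> \<mu> i" "a \<le> i \<Longrightarrow> \<mu> i = 0" "i < a \<Longrightarrow> \<mu> i + \<mu> (a - 1 - i) \<le> m"
    "Suc i < a \<Longrightarrow> m \<le> \<mu> i + \<mu> (a - 2 - i)" "\<mu> n \<le> t" if "\<mu> \<in> interlacing_shapes a s t" for \<mu> i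
    using that unfolding interlacing_shapes_def n_def m_def by blast+

  have forward: "tab A \<in> ?\<T>" if "A \<in> ?\<A>" for A
  proof -
    have A: "A \<in> sc_fillings a b m region" and mid: "\<And>j. t < j \<Longrightarrow> j \<le> s \<Longrightarrow> A (n + 1, j) = b div 2"
      using that unfolding sc_arrays_def region by auto
    define B where "B = (\<lambda>i j. if ok i j then excess A i j else 0)"
    have B_opp: "B i j + B (a - 1 - i) (m - 1 - j) = 0" if "i < a" "j < m" for i j
      using excess_opp[OF A, of i j] ok_opp[of i j] that by (simp add: B_def ok_iff)
    have B_cols: "B (Suc i) j < B i j" if "Suc i < a" "j < m" for i j
    proof -
      have "ok i j" "ok (Suc i) j" using that by (auto simp: ok_iff)
      then have "A (Suc (Suc i), Suc j) \<le> A (Suc i, Suc j)" using A by (simp add: sc_fillings_iff)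
      then show ?thesis using \<open>ok i j\<close> \<open>ok (Suc i) j\<close> by (simp add: B_def excess_def)
    qed
    obtain \<nu> where \<nu>: "(\<lambda>i j. nat (B i j)) \<in> ssyt N \<nu>" "\<And>i j. j < \<nu> i \<longleftrightarrow> 0 < B i j"
      "\<And>i. \<nu> (Suc i) \<le> \<nu> i" "\<And>i. a \<le> i \<Longrightarrow> \<nu> i = 0" "\<And>i. \<nu> i \<le> m"
    proof (rule ssyt_of_int_array[of B a m N])
      fix i j
      show in_ok: "i < a \<and> j < m" if "0 < B i j" using that by (auto simp: B_def ok_iff split: if_splits)
      show "B i j \<le> int N" using excess_le[OF A, of i j] cN by (simp add: B_def)
      show "B i (Suc j) \<le> B i j" if pos: "0 < B i (Suc j)"
      proof -
        have 1: "ok i (Suc j)" using pos by (auto simp: B_def split: if_splits)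
        then have "ok i j" by (auto simp: ok_iff)
        then show ?thesis using 1 A by (simp add: B_def excess_def sc_fillings_iff)
      qed
      show "B (Suc i) j < B i j" if pos: "0 < B (Suc i) j"
        using B_cols[of i j] pos by (auto simp: B_def ok_iff split: if_splits)
    qed auto
    have "\<nu> i + \<nu> (a - 1 - i) \<le> m" if "i < a" for i
    proof (rule ccontr)
      assume *: "\<not> ?thesis"
      define j where "j = \<nu> i - 1"
      have j: "j < \<nu> i" "j < m" "m - 1 - j < \<nu> (a - 1 - i)"
        using * \<nu>(5)[of i] \<nu>(5)[of "a - 1 - i"] by (auto simp: j_def)
      then show False using B_opp[OF that j(2)] unfolding \<nu>(2) by linarith
    qed
    moreover have "m \<le> \<nu> i + \<nu> (a - 2 - i)" if "Suc i < a" for i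
    proof (rule ccontr)
      assume *: "\<not> ?thesis"
      define j where "j = \<nu> i"
      have j: "\<not> j < \<nu> i" "j < m" "\<not> m - 1 - j < \<nu> (a - 2 - i)" using * by (auto simp: j_def)
      moreover have "B i j + B (a - 1 - i) (m - 1 - j) = 0" using B_opp[of i j] that j by simp
      moreover have "B (a - 1 - i) (m - 1 - j) < B (a - 2 - i) (m - 1 - j)"
        using B_cols[of "a - 2 - i" "m - 1 - j"] that j by (simp add: Suc_diff_Suc numeral_2_eq_2)
      ultimately show False unfolding \<nu>(2) by linarith
    qed
    moreover have "\<nu> n \<le> t"
    proof (rule ccontr)
      assume "\<not> ?thesis"
      then have 1: "0 < B n t" using \<nu>(2)[of t n] by simp
      then have ok: "ok n t" by (auto simp: B_def split: if_splits)
      show False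
      proof (cases "t < s")
        case True
        then show False using c_val mid[of "Suc t"] 1 ok by (simp add: B_def excess_def)
      next
        case False
        \<comment> \<open>Without a middle line the antisymmetry of the middle row decides: columns
          \<open>t - 1\<close> and \<open>t\<close>, counted from 0, are opposite and cannot both be
          positive.\<close>
        then have st: "s = t" using ts by simp
        then have "0 < t" using ok by (auto simp: ok_iff m_def)
        then have "B n (t - 1) + B n t = 0"
          using B_opp[of n "t - 1"] an st by (simp add: m_def mult_2)
        moreover have "t - 1 < \<nu> n" using \<open>\<not> \<nu> n \<le> t\<close> by simp
        then have "0 < B n (t - 1)" by (simp only: \<nu>(2))
        ultimately show False using 1 by simp
      qed
    qed
    ultimately have "\<nu> \<in> interlacing_shapes a s t"
      using \<nu>(3,4) unfolding interlacing_shapes_def n_def m_def by blast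
    moreover have "tab A = (\<lambda>i j. nat (B i j))" by (auto simp: fun_eq_iff tab_def B_def)
    ultimately show ?thesis using \<nu>(1) unfolding N_def by auto
  qed

  have backward: "arr T \<in> ?\<A> \<and> tab (arr T) = T" if "T \<in> ?\<T>" for T
  proof -
    from that obtain \<mu> where \<mu>: "\<mu> \<in> interlacing_shapes a s t" and T: "T \<in> ssyt N \<mu>" unfolding N_def by auto
    have pos: "0 < T i j \<longleftrightarrow> j < \<mu> i" and le: "T i j \<le> N" and rows: "T i (Suc j) \<le> T i j"
      and strict: "0 < T (Suc i) j \<Longrightarrow> T (Suc i) j < T i j" for i j
      using T by (simp_all add: ssyt_def)
    have disj: "T (a - 1 - i) (m - 1 - j) = 0" if "ok i j" "0 < T i j" for i j
    proof -
      have "\<not> m - 1 - j < \<mu> (a - 1 - i)" using that sh(3)[OF \<mu>, of i] unfolding pos by (auto simp: ok_iff)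
      then show ?thesis using pos[of "a - 1 - i" "m - 1 - j"] by simp
    qed
    have supp: "T i j = 0" if "\<not> ok i j" for i j
    proof -
      have "\<mu> i \<le> j" using that sh(2,3)[OF \<mu>, of i] by (cases "i < a") (auto simp: ok_iff)
      then show ?thesis using pos[of i j] by simp
    qed
    have cols: "full T (Suc i) j < full T i j" if ij: "ok i j" "ok (Suc i) j" for i j
    proof -
      have 1: "Suc (a - 1 - Suc i) = a - 1 - i" "a - 1 - Suc i = a - 2 - i" "Suc i < a" "j < m"
        using ok_bound[OF ij(2)] by auto
      have "0 < T (a - 1 - i) (m - 1 - j) \<Longrightarrow> T (a - 1 - i) (m - 1 - j) < T (a - 1 - Suc i) (m - 1 - j)"
        using strict[of "a - 1 - Suc i"] 1(1) by simp
      \<comment> \<open>The interlacing inequality excludes two zeros of \<open>full T\<close> in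
        succession down a column.\<close>
      moreover have "0 < T i j \<or> 0 < T (a - 1 - Suc i) (m - 1 - j)"
        using sh(4)[OF \<mu> 1(3)] 1 unfolding pos by auto
      ultimately show ?thesis using strict[of i j]
        by (cases "T (a - 1 - i) (m - 1 - j) = 0") (auto simp: full_def)
    qed
    have bound: "int i + full T i j \<le> int b + c" if "ok i j" for i j
      using that
    proof (induction i)
      case 0
      then show ?case using le[of 0 j] cN by (simp add: full_def)
    next
      case (Suc i)
      then have "ok i j" by (auto simp: ok_iff)
      then show ?case using Suc.IH cols[OF _ Suc.prems] by simp
    qed
    have exh: "0 < T i j \<or> 0 < T (a - 1 - i) (m - 1 - j)" if "ok i j" "(0::int) = 1" for i j
      using that(2) by simp
    have arr_sc: "arr T \<in> sc_fillings a b m region"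
      by (rule arr_in_sc_fillings(1)) (((rule disj exh supp cols bound, (assumption | rule refl)+) | rule rows)+)
    have tab_arr: "tab (arr T) = T"
      by (rule arr_in_sc_fillings(2)) (((rule disj exh supp cols bound, (assumption | rule refl)+) | rule rows)+)
    have sc_excess: "excess (arr T) i j = full T i j" if "ok i j" for i j
      by (rule arr_in_sc_fillings(3)[OF _ _ _ _ _ _ that]) (((rule disj exh supp cols bound, (assumption | rule refl)+) | rule rows)+)
    have "arr T (n + 1, j) = b div 2" if j: "t < j" "j \<le> s" for j
    proof -
      have k: "ok n (j - 1)" using j an by (auto simp: ok_iff m_def)
      have "a - 1 - n = n" using an by simp
      moreover have "T n (j - 1) = 0" "T n (m - 1 - (j - 1)) = 0"
        using pos[of n "j - 1"] pos[of n "m - 1 - (j - 1)"] sh(5)[OF \<mu>] j by (auto simp: m_def)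
      ultimately have "full T n (j - 1) = 0" by (simp add: full_def)
      then show ?thesis using c_val sc_excess[OF k] j by (simp add: excess_def)
    qed
    then show ?thesis using arr_sc tab_arr unfolding sc_arrays_def region by auto
  qed

  show ?thesis
    by (rule card_eq_tableaux) (use forward backward region in \<open>auto simp: sc_arrays_def\<close>)
qed

section \<open>The three parity cases\<close>

theorem theorem3:
  fixes a b c1 c2 m :: nat
  assumes "a > 0" and "b > 0"
    and "even c1" and "even c2" and "c1 \<ge> c2"
    and "m = (c1 + c2) div 2"
  shows
    "(even a \<and> even b \<longrightarrow>
        real (card {A \<in> sc_arrays a b m. c1 > 0 \<longrightarrow> A (a div 2, c1 div 2) \<ge> b div 2})
        = MacMahon_box (a div 2) (b div 2) (c1 div 2) *
          MacMahon_box (a div 2) (b div 2) (c2 div 2)) \<and>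
     (odd a \<and> even b \<longrightarrow>
        real (card {A \<in> sc_arrays a b m.
                      \<forall>j. c2 div 2 < j \<and> j \<le> c1 div 2 \<longrightarrow> A ((a + 1) div 2, j) = b div 2})
        = MacMahon_box ((a - 1) div 2) (b div 2) (c1 div 2) *
          MacMahon_box ((a + 1) div 2) (b div 2) (c2 div 2)) \<and>
     (odd a \<and> odd b \<longrightarrow>
        real (card (sc_fillings_around_empty a b c1 c2))
        = MacMahon_box ((a - 1) div 2) ((b + 1) div 2) (c1 div 2) *
          MacMahon_box ((a + 1) div 2) ((b - 1) div 2) (c2 div 2))"
proof (intro conjI impI)
  obtain s t where s: "c1 = 2 * s" and t: "c2 = 2 * t" using assms(3,4) by (auto elim!: evenE)
  have ts: "t \<le> s" and m: "m = s + t" using assms(5,6) s t by auto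
  {
    assume par: "even a \<and> even b"
    have "{A \<in> sc_arrays a b m. c1 > 0 \<longrightarrow> A (a div 2, c1 div 2) \<ge> b div 2}
        = {A \<in> sc_fillings a b (s + t) (cells a (s + t)). 0 < s \<longrightarrow> b div 2 \<le> A (a div 2, s)}"
      by (simp add: sc_arrays_def s m)
    then have "card {A \<in> sc_arrays a b m. c1 > 0 \<longrightarrow> A (a div 2, c1 div 2) \<ge> b div 2}
        = card (\<Union>\<nu>\<in>shapes a s t. ssyt ((a + b) div 2) \<nu>)"
      using card_fillings_same_parity[OF assms(1,2) _ ts] par by simp
    moreover have "(a + b) div 2 - a div 2 = b div 2" "a - a div 2 = a div 2" "a div 2 \<le> (a + b) div 2"
      using par by (auto elim!: evenE)
    ultimately show "real (card {A \<in> sc_arrays a b m. c1 > 0 \<longrightarrow> A (a div 2, c1 div 2) \<ge> b div 2})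
        = MacMahon_box (a div 2) (b div 2) (c1 div 2) * MacMahon_box (a div 2) (b div 2) (c2 div 2)"
      using card_UN_ssyt_shapes[OF ts, of a "(a + b) div 2"] by (simp add: s t)
  next
    assume par: "odd a \<and> even b"
    have half: "(a + 1) div 2 = a div 2 + 1" "(a - 1) div 2 = a div 2" "a - a div 2 = a div 2 + 1"
      using par by (auto elim!: oddE)
    show "real (card {A \<in> sc_arrays a b m.
                      \<forall>j. c2 div 2 < j \<and> j \<le> c1 div 2 \<longrightarrow> A ((a + 1) div 2, j) = b div 2})
        = MacMahon_box ((a - 1) div 2) (b div 2) (c1 div 2) *
          MacMahon_box ((a + 1) div 2) (b div 2) (c2 div 2)"
      using card_arrays_odd_even[of a b t s] card_UN_ssyt_interlacing_shapes[of a t s "a div 2 + b div 2"] par ts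
      unfolding half s t m by simp
  next
    assume par: "odd a \<and> odd b"
    define n where "n = a div 2"
    have half: "(a + 1) div 2 = n + 1" "(a - 1) div 2 = n" "a - n = n + 1" "a div 2 = n" "a = 2 * n + 1"
      "(b + 1) div 2 = b div 2 + 1" "(b - 1) div 2 = b div 2"
      using par by (auto simp: n_def elim!: oddE)
    let ?E = "empty_cells a (2 * s) (2 * t)"
    have "sc_fillings_around_empty a b c1 c2 = {A \<in> sc_fillings a b (s + t) (cells a (s + t) - ?E).
      (\<forall>j. t \<le> j \<and> j < s \<longrightarrow> (0 < n \<longrightarrow> b div 2 \<le> A (n, Suc j)) \<and>
          (n + 2 \<le> a \<longrightarrow> A (n + 2, Suc j) \<le> b div 2 + 1)) \<and> (0 < t \<longrightarrow> b div 2 + 1 \<le> A (n + 1, t))}"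
    proof -
      have "(\<forall>(i, j) \<in> ?E. ((i - 1, j) \<in> cells a (s + t) \<longrightarrow> A (i - 1, j) \<ge> b div 2) \<and>
            ((i + 1, j) \<in> cells a (s + t) \<longrightarrow> A (i + 1, j) \<le> b div 2 + 1)) \<longleftrightarrow>
          (\<forall>j. t \<le> j \<and> j < s \<longrightarrow> (0 < n \<longrightarrow> b div 2 \<le> A (n, Suc j)) \<and>
          (n + 2 \<le> a \<longrightarrow> A (n + 2, Suc j) \<le> b div 2 + 1))" (is "?L \<longleftrightarrow> ?R") for A :: "nat \<times> nat \<Rightarrow> nat"
      proof
        assume L: ?L
        show ?R
        proof (intro allI impI)
          fix j assume j: "t \<le> j \<and> j < s"
          then have "(n + 1, Suc j) \<in> ?E" by (auto simp: empty_cells_def half)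
          from bspec[OF L this] j half(5)
          show "(0 < n \<longrightarrow> b div 2 \<le> A (n, Suc j)) \<and> (n + 2 \<le> a \<longrightarrow> A (n + 2, Suc j) \<le> b div 2 + 1)"
            by (auto simp: cells_def)
        qed
      next
        assume R: ?R
        show ?L
        proof
          fix p assume "p \<in> ?E"
          then obtain j where j: "p = (n + 1, Suc j)" "t \<le> j \<and> j < s"
            unfolding empty_cells_def half by (auto simp: gr0_conv_Suc less_eq_Suc_le elim: Suc_le_D[elim_format])
          from R j(2) show "case p of (i, j) \<Rightarrow> ((i - 1, j) \<in> cells a (s + t) \<longrightarrow> A (i - 1, j) \<ge> b div 2) \<and>
            ((i + 1, j) \<in> cells a (s + t) \<longrightarrow> A (i + 1, j) \<le> b div 2 + 1)"
            unfolding j(1) by (auto simp: cells_def)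
        qed
      qed
      then show ?thesis
        unfolding sc_fillings_around_empty_def Let_def s t half by (simp add: half)
    qed
    then have "card (sc_fillings_around_empty a b c1 c2) = card (\<Union>\<nu>\<in>shapes a s t. ssyt ((a + b) div 2) \<nu>)"
      using card_fillings_same_parity[OF assms(1,2) _ ts] par by (simp add: n_def)
    moreover have "(a + b) div 2 - n = b div 2 + 1" "(a + b) div 2 - (n + 1) = b div 2" "n + 1 \<le> (a + b) div 2"
      using par by (auto simp: n_def elim!: oddE)
    ultimately show "real (card (sc_fillings_around_empty a b c1 c2))
        = MacMahon_box ((a - 1) div 2) ((b + 1) div 2) (c1 div 2) *
          MacMahon_box ((a + 1) div 2) ((b - 1) div 2) (c2 div 2)"
      using card_UN_ssyt_shapes[OF ts, of a "(a + b) div 2"] unfolding half by (simp add: s t half(3))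
  }
qed

end
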